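(* Assume $\mathrm{GCH}$. Let $\kappa<\lambda$ be infinite regular cardinals and let $\mu>\lambda$ be a singular cardinal with $\mathrm{cf}(\mu)=\kappa$. Let $\mathbb{P}=\mathrm{Fn}_{<\kappa}(\mu,2)$ and let $G$ be $\mathbb{P}$-generic over $V$. Then in $V[G]$, $\mathsf{RList}(K_{\mu,\mu},\kappa)$ holds but $\mathsf{SList}(K_{\mu,\mu},\lambda)$ fails.
   Context: $\mathrm{Fn}_{<\kappa}(\mu,2)$ is the poset of partial functions from $\mu$ to $2$ with domain of size $<\kappa$, ordered by reverse inclusion. A graph is $X=(V_X,E_X)$ with $E_X\subseteq [V_X]^2$. A function $c$ with domain $V_X$ is good if $c(v)\neq c(w)$ whenever $\{v,w\}\in E_X$. $\mathsf{RList}(X,\kappa)$ means: for every $L:V_X\to[\kappa]^\kappa$ there is a good $c$ with $c(v)\in L(v)$ for all $v$. For regular $\lambda$, $\mathsf{stat}_\lambda$ is the set of stationary subsets of $\lambda$, and $\mathsf{SList}(X,\lambda)$ means: for every $L:V_X\to\mathsf{stat}_\lambda$ there is a good $c$ with $c(v)\in L(v)$ for all $v$. $K_{\mu,\mu}$ is the complete bipartite graph with parts $A,B$ of size $\mu$ and edges $\{\{a,b\}:a\in A,b\in B\}$. *)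

theory Defs
  imports Main
begin

text \<open>
  The ground model \<open>V\<close> is a well-founded model of ZFC: a type \<open>'v\<close> with a membership relation
  satisfying the first-order axioms of ZFC (transitive models, up to isomorphism).  The extension
  \<open>V[G]\<close> is again a type with a membership relation.  All set-theoretic notions below are
  relative to such a structure, i.e. quantifiers over sets range over its elements.
\<close>

datatype fm = Mem nat nat | Eq nat nat | Neg fm | Conj fm fm | Forall nat fm

primrec sat :: "('v \<Rightarrow> 'v \<Rightarrow> bool) \<Rightarrow> (nat \<Rightarrow> 'v) \<Rightarrow> fm \<Rightarrow> bool" where
  "sat E s (Mem i j) = E (s i) (s j)"
| "sat E s (Eq i j) = (s i = s j)"
| "sat E s (Neg f) = (\<not> sat E s f)"
| "sat E s (Conj f g) = (sat E s f \<and> sat E s g)"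
| "sat E s (Forall i f) = (\<forall>x. sat E (s(i := x)) f)"

locale set_struct =
  fixes mem :: "'v \<Rightarrow> 'v \<Rightarrow> bool"  (infix "\<epsilon>" 50)
begin

subsection \<open>Basic notions\<close>

definition elts :: "'v \<Rightarrow> 'v set" where
  "elts a = {x. x \<epsilon> a}"

definition extensional :: bool where
  "extensional \<longleftrightarrow> (\<forall>a b. elts a = elts b \<longrightarrow> a = b)"

definition is_opair :: "'v \<Rightarrow> 'v \<Rightarrow> 'v \<Rightarrow> bool" where
  "is_opair z x y \<longleftrightarrow> (\<exists>u v. elts u = {x} \<and> elts v = {x, y} \<and> elts z = {u, v})"

definition is_power :: "'v \<Rightarrow> 'v \<Rightarrow> bool" where
  "is_power p a \<longleftrightarrow> (\<forall>x. x \<epsilon> p \<longleftrightarrow> elts x \<subseteq> elts a)"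

definition maps :: "'v \<Rightarrow> 'v \<Rightarrow> 'v \<Rightarrow> bool" where
  "maps f x y \<longleftrightarrow> (\<exists>z \<in> elts f. is_opair z x y)"

definition partial_fun_on :: "'v \<Rightarrow> 'v \<Rightarrow> bool" where
  "partial_fun_on f a \<longleftrightarrow>
     (\<forall>z \<in> elts f. \<exists>x \<in> elts a. \<exists>y. is_opair z x y) \<and>
     (\<forall>x y y'. maps f x y \<longrightarrow> maps f x y' \<longrightarrow> y = y')"

definition fun_on :: "'v \<Rightarrow> 'v \<Rightarrow> bool" where
  "fun_on f a \<longleftrightarrow> partial_fun_on f a \<and> (\<forall>x \<in> elts a. \<exists>y. maps f x y)"

definition fun_into :: "'v \<Rightarrow> 'v \<Rightarrow> 'v \<Rightarrow> bool" where
  "fun_into f a b \<longleftrightarrow> fun_on f a \<and> (\<forall>x y. maps f x y \<longrightarrow> y \<epsilon> b)"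

definition bijection :: "'v \<Rightarrow> 'v \<Rightarrow> 'v \<Rightarrow> bool" where
  "bijection f a b \<longleftrightarrow> fun_into f a b \<and> (\<forall>y \<in> elts b. \<exists>!x. maps f x y)"

definition equinumerous :: "'v \<Rightarrow> 'v \<Rightarrow> bool" where
  "equinumerous a b \<longleftrightarrow> (\<exists>f. bijection f a b)"

subsection \<open>The axioms of ZFC\<close>

definition foundation :: bool where
  "foundation \<longleftrightarrow> (\<forall>a. elts a \<noteq> {} \<longrightarrow> (\<exists>x \<in> elts a. elts x \<inter> elts a = {}))"

definition pairing :: bool where
  "pairing \<longleftrightarrow> (\<forall>x y. \<exists>a. elts a = {x, y})"

definition union :: bool where
  "union \<longleftrightarrow> (\<forall>a. \<exists>b. elts b = (\<Union>x \<in> elts a. elts x))"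

definition power_set :: bool where
  "power_set \<longleftrightarrow> (\<forall>a. \<exists>p. is_power p a)"

definition infinity :: bool where
  "infinity \<longleftrightarrow> (\<exists>a. (\<exists>x \<in> elts a. elts x = {}) \<and>
     (\<forall>x \<in> elts a. \<exists>y \<in> elts a. elts y = insert x (elts x)))"

text \<open>
  In the two schemes the assignment \<open>s\<close> supplies the parameters; variable \<open>0\<close> (and, for
  replacement, variable \<open>1\<close>) is the distinguished one.
\<close>

definition separation :: bool where
  "separation \<longleftrightarrow> (\<forall>\<phi> s a. \<exists>b. \<forall>x. x \<epsilon> b \<longleftrightarrow> x \<epsilon> a \<and> sat (\<epsilon>) (s(0 := x)) \<phi>)"

definition replacement :: bool where
  "replacement \<longleftrightarrow> (\<forall>\<phi> s a.
     (\<forall>x \<in> elts a. \<exists>!y. sat (\<epsilon>) (s(0 := x, 1 := y)) \<phi>) \<longrightarrow>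
     (\<exists>b. \<forall>y. y \<epsilon> b \<longleftrightarrow> (\<exists>x \<in> elts a. sat (\<epsilon>) (s(0 := x, 1 := y)) \<phi>)))"

definition choice :: bool where
  "choice \<longleftrightarrow> (\<forall>a.
     (\<forall>x \<in> elts a. elts x \<noteq> {}) \<and>
     (\<forall>x \<in> elts a. \<forall>y \<in> elts a. x \<noteq> y \<longrightarrow> elts x \<inter> elts y = {}) \<longrightarrow>
     (\<exists>c. \<forall>x \<in> elts a. \<exists>!y. y \<in> elts x \<inter> elts c))"

definition ZFC :: bool where
  "ZFC \<longleftrightarrow> extensional \<and> foundation \<and> pairing \<and> union \<and> power_set \<and> infinity \<and>
     separation \<and> replacement \<and> choice"

subsection \<open>Ordinals and cardinals\<close>

definition transitive :: "'v \<Rightarrow> bool" where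
  "transitive a \<longleftrightarrow> (\<forall>x \<in> elts a. elts x \<subseteq> elts a)"

definition ordinal :: "'v \<Rightarrow> bool" where
  "ordinal a \<longleftrightarrow> transitive a \<and> (\<forall>x \<in> elts a. transitive x)"

definition limit_ordinal :: "'v \<Rightarrow> bool" where
  "limit_ordinal a \<longleftrightarrow> ordinal a \<and> elts a \<noteq> {} \<and> (\<forall>x \<in> elts a. \<exists>y \<in> elts a. x \<epsilon> y)"

definition is_omega :: "'v \<Rightarrow> bool" where
  "is_omega w \<longleftrightarrow> limit_ordinal w \<and> (\<forall>x \<in> elts w. \<not> limit_ordinal x)"

definition cardinal :: "'v \<Rightarrow> bool" where
  "cardinal a \<longleftrightarrow> ordinal a \<and> (\<forall>x \<in> elts a. \<not> equinumerous x a)"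

definition infinite_cardinal :: "'v \<Rightarrow> bool" where
  "infinite_cardinal a \<longleftrightarrow> cardinal a \<and> (\<exists>w. is_omega w \<and> elts w \<subseteq> elts a)"

definition successor_cardinal :: "'v \<Rightarrow> 'v \<Rightarrow> bool" where
  "successor_cardinal b a \<longleftrightarrow> cardinal b \<and> a \<epsilon> b \<and>
     (\<forall>c. cardinal c \<and> a \<epsilon> c \<longrightarrow> elts b \<subseteq> elts c)"

definition cofinal_function :: "'v \<Rightarrow> 'v \<Rightarrow> 'v \<Rightarrow> bool" where
  "cofinal_function f b a \<longleftrightarrow> fun_into f b a \<and>
     (\<forall>x \<in> elts a. \<exists>i y. maps f i y \<and> (x = y \<or> x \<epsilon> y))"

definition cofinality :: "'v \<Rightarrow> 'v \<Rightarrow> bool" where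
  "cofinality a b \<longleftrightarrow> ordinal b \<and> (\<exists>f. cofinal_function f b a) \<and>
     (\<forall>c \<in> elts b. \<not> (\<exists>f. cofinal_function f c a))"

definition regular :: "'v \<Rightarrow> bool" where
  "regular a \<longleftrightarrow> infinite_cardinal a \<and> cofinality a a"

definition singular :: "'v \<Rightarrow> bool" where
  "singular a \<longleftrightarrow> infinite_cardinal a \<and> \<not> cofinality a a"

definition GCH :: bool where
  "GCH \<longleftrightarrow> (\<forall>a b p. infinite_cardinal a \<longrightarrow> successor_cardinal b a \<longrightarrow> is_power p a \<longrightarrow>
     equinumerous p b)"

definition unbounded_in :: "'v \<Rightarrow> 'v \<Rightarrow> bool" where
  "unbounded_in c d \<longleftrightarrow> (\<forall>x \<in> elts d. \<exists>y \<in> elts c \<inter> elts d. x \<epsilon> y)"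

definition club :: "'v \<Rightarrow> 'v \<Rightarrow> bool" where
  "club c l \<longleftrightarrow> elts c \<subseteq> elts l \<and> unbounded_in c l \<and>
     (\<forall>d \<in> elts l. limit_ordinal d \<and> unbounded_in c d \<longrightarrow> d \<epsilon> c)"

definition stationary :: "'v \<Rightarrow> 'v \<Rightarrow> bool" where
  "stationary a l \<longleftrightarrow> elts a \<subseteq> elts l \<and> (\<forall>c. club c l \<longrightarrow> elts a \<inter> elts c \<noteq> {})"

subsection \<open>Colourings of graphs from lists\<close>

text \<open>A graph is given by its vertex set \<open>X\<close> and its set \<open>F\<close> of unordered pairs.\<close>

definition good :: "'v \<Rightarrow> 'v \<Rightarrow> 'v \<Rightarrow> bool" where
  "good X F c \<longleftrightarrow> fun_on c X \<and>
     (\<forall>e v w x y. e \<epsilon> F \<and> elts e = {v, w} \<and> maps c v x \<and> maps c w y \<longrightarrow> x \<noteq> y)"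

definition colourable_from :: "'v \<Rightarrow> 'v \<Rightarrow> 'v \<Rightarrow> bool" where
  "colourable_from X F L \<longleftrightarrow>
     (\<exists>c. good X F c \<and> (\<forall>v S x. maps L v S \<and> maps c v x \<longrightarrow> x \<epsilon> S))"

definition RList :: "'v \<Rightarrow> 'v \<Rightarrow> 'v \<Rightarrow> bool" where
  "RList X F k \<longleftrightarrow> (\<forall>L.
     fun_on L X \<and> (\<forall>v S. maps L v S \<longrightarrow> elts S \<subseteq> elts k \<and> equinumerous S k) \<longrightarrow>
     colourable_from X F L)"

definition SList :: "'v \<Rightarrow> 'v \<Rightarrow> 'v \<Rightarrow> bool" where
  "SList X F l \<longleftrightarrow> (\<forall>L.
     fun_on L X \<and> (\<forall>v S. maps L v S \<longrightarrow> stationary S l) \<longrightarrow>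
     colourable_from X F L)"

text \<open>\<open>(X, F)\<close> is a copy of the complete bipartite graph with both parts of size \<open>m\<close>.\<close>

definition complete_bipartite :: "'v \<Rightarrow> 'v \<Rightarrow> 'v \<Rightarrow> bool" where
  "complete_bipartite X F m \<longleftrightarrow> (\<exists>A B.
     equinumerous A m \<and> equinumerous B m \<and> elts A \<inter> elts B = {} \<and>
     elts X = elts A \<union> elts B \<and>
     (\<forall>e. e \<epsilon> F \<longleftrightarrow> (\<exists>a \<in> elts A. \<exists>b \<in> elts B. elts e = {a, b})))"

subsection \<open>Forcing\<close>

text \<open>\<open>P\<close> is the set of partial functions from \<open>m\<close> to \<open>2 = {0, {0}}\<close> of size less than \<open>k\<close>.\<close>

definition is_Fn :: "'v \<Rightarrow> 'v \<Rightarrow> 'v \<Rightarrow> bool" where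
  "is_Fn P k m \<longleftrightarrow> (\<forall>p. p \<epsilon> P \<longleftrightarrow>
     partial_fun_on p m \<and>
     (\<forall>x y. maps p x y \<longrightarrow> elts y = {} \<or> (\<exists>z. elts z = {} \<and> elts y = {z})) \<and>
     (\<exists>d. (\<forall>x. x \<epsilon> d \<longleftrightarrow> (\<exists>y. maps p x y)) \<and> (\<exists>n \<in> elts k. equinumerous d n)))"

definition reverse_inclusion :: "'v \<Rightarrow> 'v \<Rightarrow> bool" where
  "reverse_inclusion p q \<longleftrightarrow> elts q \<subseteq> elts p"

definition dense :: "'v \<Rightarrow> ('v \<Rightarrow> 'v \<Rightarrow> bool) \<Rightarrow> 'v \<Rightarrow> bool" where
  "dense P le D \<longleftrightarrow> elts D \<subseteq> elts P \<and> (\<forall>p \<in> elts P. \<exists>q \<in> elts D. le q p)"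

text \<open>
  \<open>G\<close> is a set of conditions in the metatheory, usually not (the extension of) an element of the
  model, whereas the dense sets \<open>D\<close> range over elements of the model.
\<close>

definition generic :: "'v \<Rightarrow> ('v \<Rightarrow> 'v \<Rightarrow> bool) \<Rightarrow> 'v set \<Rightarrow> bool" where
  "generic P le G \<longleftrightarrow> G \<subseteq> elts P \<and> G \<noteq> {} \<and>
     (\<forall>p \<in> G. \<forall>q \<in> elts P. le p q \<longrightarrow> q \<in> G) \<and>
     (\<forall>p \<in> G. \<forall>q \<in> G. \<exists>r \<in> G. le r p \<and> le r q) \<and>
     (\<forall>D. dense P le D \<longrightarrow> G \<inter> elts D \<noteq> {})"

inductive name :: "'v \<Rightarrow> 'v \<Rightarrow> bool" for P where
  "(\<And>z. z \<epsilon> t \<Longrightarrow> \<exists>s p. is_opair z s p \<and> name P s \<and> p \<epsilon> P) \<Longrightarrow> name P t"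

end

text \<open>
  \<open>E'\<close> is (isomorphic to) the membership relation of the generic extension \<open>V[G]\<close>: its elements
  are exactly the values of \<open>P\<close>-names, where the value of \<open>t\<close> is
  \<open>{val s | (s, p) \<in> t, p \<in> G}\<close>.  As \<open>E\<close> is well-founded, this determines \<open>E'\<close> up to a unique
  isomorphism.
\<close>

definition generic_extension ::
    "('v \<Rightarrow> 'v \<Rightarrow> bool) \<Rightarrow> 'v \<Rightarrow> 'v set \<Rightarrow> ('w \<Rightarrow> 'w \<Rightarrow> bool) \<Rightarrow> bool" where
  "generic_extension E P G E' \<longleftrightarrow> set_struct.extensional E' \<and>
     (\<exists>val :: 'v \<Rightarrow> 'w.
        (\<forall>t. set_struct.name E P t \<longrightarrow>
           set_struct.elts E' (val t) =
             {val s | s p z. E z t \<and> set_struct.is_opair E z s p \<and> p \<in> G}) \<and>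
        (\<forall>x. \<exists>t. set_struct.name E P t \<and> x = val t))"

text \<open>
  The inclusion of \<open>V\<close> into \<open>V[G]\<close> as a transitive subclass, \<open>x \<mapsto> val x\<^sup>\<or>\<close> for the canonical
  names \<open>x\<^sup>\<or>\<close>.  Uniqueness follows from well-foundedness of \<open>E\<close> and extensionality of \<open>E'\<close>.
\<close>

definition ground_inclusion :: "('v \<Rightarrow> 'v \<Rightarrow> bool) \<Rightarrow> ('w \<Rightarrow> 'w \<Rightarrow> bool) \<Rightarrow> 'v \<Rightarrow> 'w" where
  "ground_inclusion E E' =
     (THE j. \<forall>x. set_struct.elts E' (j x) = j ` set_struct.elts E x)"

end

theory Submission
  imports Defs
begin

text \<open>
  Since \<open>\<kappa> = cf \<mu>\<close>, every condition has its domain bounded in \<open>\<mu>\<close>.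

  \<open>SList\<close> fails: list, on both sides, all stationary subsets of \<open>\<lambda>\<close> that have a name contained in
  \<open>\<lambda> \<times> Fn(i, 2)\<close> for some \<open>i < \<mu>\<close>; by GCH there are only \<open>\<mu>\<close> such names.  Let \<open>Y\<close> be the set of colours
  that a colouring uses on \<open>A\<close>, and \<open>f\<close> cofinal from \<open>\<kappa>\<close> to \<open>\<mu>\<close>.  Every \<open>\<xi> < \<lambda>\<close> is put into \<open>Y\<close> or out of \<open>Y\<close>
  by some \<open>p \<in> G\<close> in some \<open>Fn(f i, 2)\<close>, which splits \<open>\<lambda>\<close> into \<open>\<kappa>\<close> pieces.  One of them is stationary, so it
  is a list on both sides; but it is contained in \<open>Y\<close> or disjoint from it.

  \<open>RList\<close> holds: the elements of the list of the \<open>\<alpha>\<close>th vertex are decided by conditions with domain in a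
  set \<open>I \<alpha>\<close> of size \<open>\<kappa>\<close>.  For \<open>\<beta> < \<kappa>\<close> pick \<open>h \<beta> < \<mu>\<close> outside \<open>I \<alpha>\<close> for the first \<open>f \<beta>\<close> many \<open>\<alpha>\<close>.  As every \<open>I \<alpha>\<close>
  is eventually avoided, density gives in each list colours \<open>\<beta>\<close> with \<open>G(h \<beta>) = 0\<close>, which serve for \<open>A\<close>, and
  colours with \<open>G(h \<beta>) = 1\<close>, which serve for \<open>B\<close>.

  ZFC is not needed in \<open>V[G]\<close>, whose structure is interpreted in \<open>(V, \<in>, G)\<close> by names: the relations
  definable over \<open>(V, \<in>, G)\<close> have definable forcing relations, and subsets of \<open>V\<close> in \<open>V[G]\<close> are
  studied as such relations.
\<close>

section \<open>Definable relations\<close>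

text \<open>Separation and replacement in V apply only to definable predicates, so every set that is
  formed carries a definability proof, which \<open>intro dfn\<close> composes along the syntax of
  the term; \<open>fc\<close> does the same over (V, G). GCH enters twice. It gives 2^{<\<kappa>} =
  \<kappa>, so Fn(I, 2) has size \<kappa> when I has, and such an I can be closed under a fixed
  choice of deciding extensions. A condition is then restricted to I, extended inside I to a
  deciding condition, and glued back to what it says outside I. This takes the place of a chain
  condition: values in \<lambda> are bounded by a function in V, and lists are decided on small
  supports. GCH also makes \<mu> a strong limit, as 2^\<theta> = \<theta>^+ and the singular \<mu>
  is not a successor. The obstacle for \<lambda> is that the pieces, and the clubs avoiding them,
  exist only in V[G]; bounding their next elements in V moves the argument to a closure point found
  in V. For \<kappa> the obstacle is that a list of size \<kappa> could be bounded in V[G]; closure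
  of P under short descending sequences excludes it.\<close>

named_theorems dfn

context set_struct
begin

text \<open>Assignments are used as de Bruijn environments: a bound variable is \<open>s 0\<close>, and entering its scope
  shifts the others by one.\<close>

inductive dfb :: "((nat \<Rightarrow> 'v) \<Rightarrow> bool) \<Rightarrow> bool" where
  dfb_mem: "dfb (\<lambda>s. s i \<epsilon> s j)"
| dfb_eq: "dfb (\<lambda>s. s i = s j)"
| dfb_neg: "dfb Q \<Longrightarrow> dfb (\<lambda>s. \<not> Q s)"
| dfb_conj: "dfb Q \<Longrightarrow> dfb R \<Longrightarrow> dfb (\<lambda>s. Q s \<and> R s)"
| dfb_all: "dfb Q \<Longrightarrow> dfb (\<lambda>s. \<forall>x. Q (case_nat x s))"

lemma dfb_rename: "dfb Q \<Longrightarrow> dfb (\<lambda>s. Q (\<lambda>i. s (r i)))"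
proof (induction arbitrary: r rule: dfb.induct)
  case (dfb_all Q)
  have "Q (\<lambda>i. case_nat x s (case_nat 0 (\<lambda>n. Suc (r n)) i)) = Q (case_nat x (\<lambda>i. s (r i)))" for x s
    by (rule arg_cong[of _ _ Q]) (auto split: nat.split)
  then show ?case
    using dfb.dfb_all[OF dfb_all.IH[of "case_nat 0 (\<lambda>n. Suc (r n))"]] by (simp only:)
qed (auto intro: dfb.intros)

text \<open>Formulas of the object language bind named variables, so translating a quantifier needs
  a name that clashes with no relevant variable; the finite bound N provides it. The renaming r in
  the second claim lets the induction hypothesis send the bound variable to that fresh name.\<close>

lemma dfb_sat:
  "dfb Q \<Longrightarrow> (\<exists>N. \<forall>s s'. (\<forall>i<N. s i = s' i) \<longrightarrow> Q s = Q s') \<and>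
     (\<forall>r. \<exists>\<phi>. \<forall>s. Q (\<lambda>i. s (r i)) = sat (\<epsilon>) s \<phi>)"
proof (induction rule: dfb.induct)
  case (dfb_mem i j)
  have "\<forall>s s'. (\<forall>k < Suc (max i j). s k = s' k) \<longrightarrow> (s i \<epsilon> s j) = (s' i \<epsilon> s' j)"
    by (simp add: less_Suc_eq_le)
  moreover have "(s (r i) \<epsilon> s (r j)) = sat (\<epsilon>) s (Mem (r i) (r j))" for r :: "nat \<Rightarrow> nat" and s
    by simp
  ultimately show ?case by blast
next
  case (dfb_eq i j)
  have "\<forall>s s' :: nat \<Rightarrow> 'v. (\<forall>k < Suc (max i j). s k = s' k) \<longrightarrow> (s i = s j) = (s' i = s' j)"
    by (simp add: less_Suc_eq_le)
  moreover have "(s (r i) = s (r j)) = sat (\<epsilon>) s (Eq (r i) (r j))" for r :: "nat \<Rightarrow> nat" and s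
    by simp
  ultimately show ?case by blast
next
  case (dfb_neg Q)
  then obtain N where N: "\<forall>s s'. (\<forall>i<N. s i = s' i) \<longrightarrow> Q s = Q s'" by blast
  have "\<exists>\<phi>. \<forall>s. (\<not> Q (\<lambda>i. s (r i))) = sat (\<epsilon>) s \<phi>" for r
  proof -
    obtain \<phi> where "\<forall>s. Q (\<lambda>i. s (r i)) = sat (\<epsilon>) s \<phi>" using dfb_neg.IH by blast
    then have "\<forall>s. (\<not> Q (\<lambda>i. s (r i))) = sat (\<epsilon>) s (Neg \<phi>)" by simp
    then show ?thesis by blast
  qed
  moreover have "\<forall>s s'. (\<forall>i<N. s i = s' i) \<longrightarrow> (\<not> Q s) = (\<not> Q s')" using N by blast
  ultimately show ?case by blast
next
  case (dfb_conj Q R)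
  then obtain N M where "\<forall>s s'. (\<forall>i<N. s i = s' i) \<longrightarrow> Q s = Q s'"
    "\<forall>s s'. (\<forall>i<M. s i = s' i) \<longrightarrow> R s = R s'" by blast
  then have "(Q s \<and> R s) = (Q s' \<and> R s')" if "\<forall>i<max N M. s i = s' i" for s s'
    using that less_max_iff_disj by (smt (verit))
  then have "\<forall>s s'. (\<forall>i<max N M. s i = s' i) \<longrightarrow> (Q s \<and> R s) = (Q s' \<and> R s')" by blast
  moreover have "\<exists>\<phi>. \<forall>s. (Q (\<lambda>i. s (r i)) \<and> R (\<lambda>i. s (r i))) = sat (\<epsilon>) s \<phi>" for r
  proof -
    obtain \<phi> \<psi> where "\<forall>s. Q (\<lambda>i. s (r i)) = sat (\<epsilon>) s \<phi>" "\<forall>s. R (\<lambda>i. s (r i)) = sat (\<epsilon>) s \<psi>"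
      using dfb_conj.IH by blast
    then have "\<forall>s. (Q (\<lambda>i. s (r i)) \<and> R (\<lambda>i. s (r i))) = sat (\<epsilon>) s (Conj \<phi> \<psi>)" by simp
    then show ?thesis by blast
  qed
  ultimately show ?case by blast
next
  case (dfb_all Q)
  then obtain N where N: "\<forall>s s'. (\<forall>i<N. s i = s' i) \<longrightarrow> Q s = Q s'" by blast
  have 1: "(\<forall>x. Q (case_nat x s)) = (\<forall>x. Q (case_nat x s'))" if "\<forall>i<N. s i = s' i" for s s'
  proof -
    have "Q (case_nat x s) = Q (case_nat x s')" for x
      using that by (intro N[rule_format]) (auto split: nat.split)
    then show ?thesis by simp
  qed
  have 2: "\<exists>\<phi>. \<forall>s. (\<forall>x. Q (case_nat x (\<lambda>i. s (r i)))) = sat (\<epsilon>) s \<phi>" for r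
  proof -
    \<comment> \<open>n lies above all names r i with i < N, so quantifying over it captures none of
      them.\<close>
    define n where "n = Suc (Max (insert 0 (r ` {..<N})))"
    have n: "n \<noteq> r i" if "i < N" for i
    proof -
      have "r i \<le> Max (insert 0 (r ` {..<N}))" using that by (intro Max_ge) auto
      then show ?thesis by (simp add: n_def)
    qed
    obtain \<phi> where phi: "\<forall>s. Q (\<lambda>i. s (case_nat n r i)) = sat (\<epsilon>) s \<phi>"
      using dfb_all.IH by blast
    have "Q (case_nat x (\<lambda>i. s (r i))) = Q (\<lambda>i. (s(n := x)) (case_nat n r i))" for x s
    proof (intro N[rule_format])
      fix i assume "i < N"
      then show "case_nat x (\<lambda>i. s (r i)) i = (s(n := x)) (case_nat n r i)"
        using n[of "i - 1"] by (cases i) auto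
    qed
    then have "\<forall>s. (\<forall>x. Q (case_nat x (\<lambda>i. s (r i)))) = sat (\<epsilon>) s (Forall n \<phi>)"
      unfolding phi[rule_format] sat.simps by simp
    then show ?thesis by blast
  qed
  show ?case using 1 2 by blast
qed

text \<open>Constant operations among the \<open>atoms\<close> provide parameters.\<close>

definition atoms :: "((nat \<Rightarrow> 'v) \<Rightarrow> 'v) set" where
  "atoms = range (\<lambda>n e. e n) \<union> range (\<lambda>c e. c)"

text \<open>Definability over (V, \<in>) with parameters. The parameters sit in the substitution
  \<sigma> and not in the environment, so a predicate such as
  \<open>\<lambda>e. e 0 \<epsilon> c\<close> qualifies.\<close>

definition dfn :: "((nat \<Rightarrow> 'v) \<Rightarrow> bool) \<Rightarrow> bool" where
  "dfn Q \<longleftrightarrow> (\<exists>R \<sigma>. dfb R \<and> (\<forall>i. \<sigma> i \<in> atoms) \<and> Q = (\<lambda>e. R (\<lambda>i. \<sigma> i e)))"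

lemma dfnI: "dfb R \<Longrightarrow> (\<And>i. \<sigma> i \<in> atoms) \<Longrightarrow> (\<And>e. Q e = R (\<lambda>i. \<sigma> i e)) \<Longrightarrow> dfn Q"
  unfolding dfn_def by (rule exI[of _ R], rule exI[of _ \<sigma>]) auto

lemma dfnE:
  assumes "dfn Q" obtains R \<sigma> where "dfb R" "\<And>i. \<sigma> i \<in> atoms" "Q = (\<lambda>e. R (\<lambda>i. \<sigma> i e))"
  using assms unfolding dfn_def by (elim exE conjE) auto

lemma atom_subst:
  assumes "t \<in> atoms" "\<And>n. \<sigma> n \<in> atoms" shows "(\<lambda>e. t (\<lambda>n. \<sigma> n e)) \<in> atoms"
  using assms unfolding atoms_def by (auto simp: image_iff)

lemma atom_var: "(\<lambda>e. e n) \<in> atoms" and atom_const: "(\<lambda>e. c) \<in> atoms"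
  unfolding atoms_def by auto

lemma dfn_subst:
  assumes "dfn Q" "\<And>n. \<sigma> n \<in> atoms" shows "dfn (\<lambda>e. Q (\<lambda>n. \<sigma> n e))"
proof -
  obtain R \<tau> where R: "dfb R" "\<And>i. \<tau> i \<in> atoms" "Q = (\<lambda>e. R (\<lambda>i. \<tau> i e))"
    by (rule dfnE[OF assms(1)]) (rule that)
  then show ?thesis
    using atom_subst[OF R(2) assms(2)] by (intro dfnI[of R "\<lambda>i e. \<tau> i (\<lambda>n. \<sigma> n e)"]) simp_all
qed

lemma dfn_rename: "dfn Q \<Longrightarrow> dfn (\<lambda>e. Q (\<lambda>n. e (r n)))"
  by (rule dfn_subst) (auto simp: atom_var)

lemma dfn_atom_mem: "dfn (\<lambda>e. e i \<epsilon> e j)"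
  by (rule dfnI[OF dfb_mem[of i j], of "\<lambda>n e. e n"]) (auto simp: atom_var)

lemma dfn_atom_eq: "dfn (\<lambda>e. e i = e j)"
  by (rule dfnI[OF dfb_eq[of i j], of "\<lambda>n e. e n"]) (auto simp: atom_var)

lemma dfn_neg[dfn]: "dfn Q \<Longrightarrow> dfn (\<lambda>e. \<not> Q e)"
  by (erule dfnE, rule dfnI[OF dfb_neg]) auto

lemma dfn_conj[dfn]:
  assumes "dfn Q" "dfn R" shows "dfn (\<lambda>e. Q e \<and> R e)"
proof -
  obtain Q' \<sigma> where Q: "dfb Q'" "\<And>i. \<sigma> i \<in> atoms" "Q = (\<lambda>e. Q' (\<lambda>i. \<sigma> i e))"
    by (rule dfnE[OF assms(1)]) (rule that)
  obtain R' \<tau> where R: "dfb R'" "\<And>i. \<tau> i \<in> atoms" "R = (\<lambda>e. R' (\<lambda>i. \<tau> i e))"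
    by (rule dfnE[OF assms(2)]) (rule that)
  have "dfb (\<lambda>s. Q' (\<lambda>i. s (2 * i)) \<and> R' (\<lambda>i. s (Suc (2 * i))))"
    using dfb_rename[OF Q(1), of "\<lambda>i. 2 * i"] dfb_rename[OF R(1), of "\<lambda>i. Suc (2 * i)"]
    by (rule dfb_conj)
  then show ?thesis
    by (rule dfnI[where \<sigma> = "\<lambda>i. if even i then \<sigma> (i div 2) else \<tau> (i div 2)"])
      (auto simp: Q R)
qed

lemma dfn_all[dfn]:
  assumes "dfn (\<lambda>e. Q (e 0) (\<lambda>n. e (Suc n)))" shows "dfn (\<lambda>e. \<forall>x. Q x e)"
proof -
  obtain R \<sigma> where R: "dfb R" "\<And>i. \<sigma> i \<in> atoms"
    "(\<lambda>e. Q (e 0) (\<lambda>n. e (Suc n))) = (\<lambda>e. R (\<lambda>i. \<sigma> i e))"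
    by (rule dfnE[OF assms]) (rule that)
  \<comment> \<open>Several variables of R may stand for the bound variable; they are all merged
    into variable 0, and every other atom is pulled out of the scope as \<tau> i.\<close>
  define r where "r i = (if \<sigma> i = (\<lambda>e. e 0) then 0 else Suc i)" for i
  define \<tau> where "\<tau> i = (if \<sigma> i = (\<lambda>e. e 0) then (\<lambda>e. e 0) else
     (SOME t. t \<in> atoms \<and> \<sigma> i = (\<lambda>e. t (\<lambda>n. e (Suc n)))))" for i
  have tau: "\<tau> i \<in> atoms \<and> (\<sigma> i \<noteq> (\<lambda>e. e 0) \<longrightarrow> \<sigma> i = (\<lambda>e. \<tau> i (\<lambda>n. e (Suc n))))" for i
  proof (cases "\<sigma> i = (\<lambda>e. e 0)")
    case False
    have "\<exists>t. t \<in> atoms \<and> \<sigma> i = (\<lambda>e. t (\<lambda>n. e (Suc n)))"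
    proof -
      consider n where "\<sigma> i = (\<lambda>e. e n)" | c where "\<sigma> i = (\<lambda>e. c)"
        using R(2)[of i] unfolding atoms_def by auto
      then show ?thesis
      proof cases
        case 1
        then obtain m where "n = Suc m" using False by (cases n) auto
        then show ?thesis using 1 atom_var[of m] by auto
      qed (use atom_const in auto)
    qed
    from someI_ex[OF this] show ?thesis using False by (simp add: \<tau>_def)
  qed (simp add: \<tau>_def atom_var)
  have "dfb (\<lambda>s. \<forall>x. R (\<lambda>i. case_nat x s (r i)))"
    using dfb_all[OF dfb_rename[OF R(1), of r]] .
  moreover have "(\<forall>x. Q x e) = (\<forall>x. R (\<lambda>i. case_nat x (\<lambda>i. \<tau> i e) (r i)))" for e
  proof -
    have "Q x e = R (\<lambda>i. \<sigma> i (case_nat x e))" for x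
      using fun_cong[OF R(3), of "case_nat x e"] by simp
    moreover have "(\<lambda>i. \<sigma> i (case_nat x e)) = (\<lambda>i. case_nat x (\<lambda>i. \<tau> i e) (r i))" for x
    proof
      fix i
      show "\<sigma> i (case_nat x e) = case_nat x (\<lambda>i. \<tau> i e) (r i)"
      proof (cases "\<sigma> i = (\<lambda>e. e 0)")
        case True
        then show ?thesis by (simp add: r_def)
      next
        case False
        then have "\<sigma> i (case_nat x e) = \<tau> i (\<lambda>n. case_nat x e (Suc n))"
          using conjunct2[OF tau[of i], rule_format, OF False, THEN fun_cong] by simp
        then show ?thesis using False by (simp add: r_def)
      qed
    qed
    ultimately show ?thesis by simp
  qed
  ultimately show ?thesis using tau by (intro dfnI) auto
qed

lemma dfn_const[dfn]: "dfn (\<lambda>e. C)"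
proof -
  have T: "dfn (\<lambda>e. True)" using dfn_atom_eq[of 0 0] by simp
  show ?thesis using T dfn_neg[OF T] by (cases C) simp_all
qed

lemma disj_conv_conj: "(A \<or> B) = (\<not> (\<not> A \<and> \<not> B))" by blast

lemma dfn_disj[dfn]: "dfn Q \<Longrightarrow> dfn R \<Longrightarrow> dfn (\<lambda>e. Q e \<or> R e)"
  unfolding disj_conv_conj by (rule dfn_neg, rule dfn_conj; rule dfn_neg)

lemma dfn_imp[dfn]: "dfn Q \<Longrightarrow> dfn R \<Longrightarrow> dfn (\<lambda>e. Q e \<longrightarrow> R e)"
  unfolding imp_conv_disj by (rule dfn_disj, rule dfn_neg)

lemma dfn_iff[dfn]: "dfn Q \<Longrightarrow> dfn R \<Longrightarrow> dfn (\<lambda>e. Q e \<longleftrightarrow> R e)"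
  unfolding iff_conv_conj_imp by (rule dfn_conj; rule dfn_imp)

lemma dfn_ex[dfn]:
  "dfn (\<lambda>e. Q (e 0) (\<lambda>n. e (Suc n))) \<Longrightarrow> dfn (\<lambda>e. \<exists>x. Q x e)"
  using dfn_neg[OF dfn_all[of "\<lambda>x e. \<not> Q x e", OF dfn_neg]] by simp

text \<open>The language has no terms, so an operation counts as definable if its graph is;
  substituting it into a formula costs an existential quantifier (\<open>dfn_sub\<close>).\<close>

definition dt :: "((nat \<Rightarrow> 'v) \<Rightarrow> 'v) \<Rightarrow> bool" where
  "dt t \<longleftrightarrow> dfn (\<lambda>e. e 0 = t (\<lambda>n. e (Suc n)))"

lemma dt_const[dfn]: "dt (\<lambda>e. c)"
  unfolding dt_def
  using dfn_subst[OF dfn_atom_eq[of 0 1], of "\<lambda>n. if n = 0 then (\<lambda>e. e 0) else (\<lambda>e. c)"]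
  by (simp add: atom_var atom_const)

lemma dt_var[dfn]: "dt (\<lambda>e. e n)"
  unfolding dt_def by (rule dfn_atom_eq)

lemma dt_shift: "dt t \<Longrightarrow> dt (\<lambda>e. t (\<lambda>n. e (r n)))"
  unfolding dt_def
  using dfn_rename[of "\<lambda>e. e 0 = t (\<lambda>n. e (Suc n))" "case_nat 0 (\<lambda>n. Suc (r n))"] by simp

lemma dfn_sub:
  assumes "dfn (\<lambda>e. Q (e 0) (\<lambda>n. e (Suc n)))" "dt t" shows "dfn (\<lambda>e. Q (t e) e)"
proof -
  have "dfn (\<lambda>e. \<exists>x. x = t e \<and> Q x e)"
    using assms unfolding dt_def by (intro dfn)
  then show ?thesis by simp
qed

lemma dfn_sub1:
  assumes "dfn (\<lambda>e. Q (e 0))" "dt t" shows "dfn (\<lambda>e. Q (t e))"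
  using dfn_sub[of "\<lambda>x e. Q x", OF assms] .

lemma dfn_sub2:
  assumes "dfn (\<lambda>e. Q (e 0) (e 1))" "dt t" "dt u" shows "dfn (\<lambda>e. Q (t e) (u e))"
proof -
  have "dfn (\<lambda>e. Q (t e) (e 0))"
    using dfn_sub[of "\<lambda>x e. Q x (e 0)", OF _ assms(2)] assms(1) by simp
  have 1: "dfn (\<lambda>e. Q (t (\<lambda>n. e (Suc n))) (e 0))"
    using dfn_sub[of "\<lambda>x e. Q x (e 0)", OF _ dt_shift[OF assms(2), of Suc]] assms(1) by simp
  show ?thesis using dfn_sub[of "\<lambda>x e. Q (t e) x", OF 1 assms(3)] .
qed

lemma dfn_sub3:
  assumes "dfn (\<lambda>e. Q (e 0) (e 1) (e 2))" "dt t" "dt u" "dt v"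
  shows "dfn (\<lambda>e. Q (t e) (u e) (v e))"
proof -
  have 0: "dfn (\<lambda>e. Q (e 0) (e (Suc 0)) (e (Suc (Suc 0))))"
    using assms(1) by (simp add: numeral_2_eq_2)
  have 1: "dfn (\<lambda>e. Q (t (\<lambda>n. e (Suc (Suc n)))) (e 0) (e 1))"
    using dfn_sub[of "\<lambda>x e. Q x (e 0) (e 1)", OF _ dt_shift[OF assms(2), of "\<lambda>n. Suc (Suc n)"]] 0 by simp
  have 2: "dfn (\<lambda>e. Q (t (\<lambda>n. e (Suc n))) (u (\<lambda>n. e (Suc n))) (e 0))"
    using dfn_sub[of "\<lambda>x e. Q (t (\<lambda>n. e (Suc n))) x (e 0)", OF _ dt_shift[OF assms(3), of Suc]] 1 by simp
  show ?thesis using dfn_sub[of "\<lambda>x e. Q (t e) (u e) x", OF 2 assms(4)] .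
qed

lemma dfn_mem[dfn]: "dt t \<Longrightarrow> dt u \<Longrightarrow> dfn (\<lambda>e. t e \<epsilon> u e)"
  using dfn_sub2[of "\<lambda>x y. x \<epsilon> y"] dfn_atom_mem by blast

lemma dfn_eq[dfn]: "dt t \<Longrightarrow> dt u \<Longrightarrow> dfn (\<lambda>e. t e = u e)"
  using dfn_sub2[of "\<lambda>x y. x = y"] dfn_atom_eq by blast

lemma dfn_elts[dfn]: "dt t \<Longrightarrow> dt u \<Longrightarrow> dfn (\<lambda>e. t e \<in> elts (u e))"
  unfolding elts_def by (simp add: dfn)

lemma dfn_ball[dfn]:
  "dt t \<Longrightarrow> dfn (\<lambda>e. Q (e 0) (\<lambda>n. e (Suc n))) \<Longrightarrow> dfn (\<lambda>e. \<forall>x\<in>elts (t e). Q x e)"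
  unfolding Ball_def by (intro dfn dt_shift[of t Suc])

lemma dfn_subset[dfn]: "dt t \<Longrightarrow> dt u \<Longrightarrow> dfn (\<lambda>e. elts (t e) \<subseteq> elts (u e))"
  unfolding subset_eq by (intro dfn dt_shift[of t Suc] dt_shift[of u Suc])

lemma dfn_ex1[dfn]:
  assumes "dfn (\<lambda>e. Q (e 0) (\<lambda>n. e (Suc n)))" shows "dfn (\<lambda>e. \<exists>!x. Q x e)"
proof -
  have "dfn (\<lambda>e. Q (e 0) (\<lambda>n. e (Suc (Suc n))))"
    using dfn_rename[OF assms, of "case_nat 0 (\<lambda>n. Suc (Suc n))"] by simp
  then show ?thesis unfolding Ex1_def using assms by (intro dfn)
qed

definition df1 :: "('v \<Rightarrow> 'v) \<Rightarrow> bool" where "df1 F \<longleftrightarrow> dt (\<lambda>e. F (e 0))"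
definition df2 :: "('v \<Rightarrow> 'v \<Rightarrow> 'v) \<Rightarrow> bool" where "df2 F \<longleftrightarrow> dt (\<lambda>e. F (e 0) (e 1))"

lemma dt_sub1: assumes "dt (\<lambda>e. F (e 0))" "dt t" shows "dt (\<lambda>e. F (t e))"
proof -
  have "dfn (\<lambda>e. e 0 = F (e (Suc 0)))" using assms(1) unfolding dt_def .
  then have "dfn (\<lambda>e. e (Suc 0) = F (e 0))"
    using dfn_rename[of _ "\<lambda>n. if n = 0 then 1 else 0"] by force
  from dfn_sub[of "\<lambda>x e. e 0 = F x", OF this dt_shift[OF assms(2), of Suc]]
  show ?thesis unfolding dt_def .
qed

lemma dt_sub2: assumes "dt (\<lambda>e. F (e 0) (e 1))" "dt t" "dt u" shows "dt (\<lambda>e. F (t e) (u e))"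
proof -
  have "dfn (\<lambda>e. e 0 = F (e (Suc 0)) (e (Suc (Suc 0))))" using assms(1) unfolding dt_def by simp
  then show ?thesis unfolding dt_def
    using dfn_sub3[of "\<lambda>x y z. x = F y z", OF _ dt_var dt_shift[OF assms(2), of Suc] dt_shift[OF assms(3), of Suc]]
    by (simp add: numeral_2_eq_2)
qed

lemma df1_app: "df1 F \<Longrightarrow> dt t \<Longrightarrow> dt (\<lambda>e. F (t e))"
  unfolding df1_def by (rule dt_sub1)

lemma df2_app: "df2 F \<Longrightarrow> dt t \<Longrightarrow> dt u \<Longrightarrow> dt (\<lambda>e. F (t e) (u e))"
  unfolding df2_def by (rule dt_sub2)

lemma dt_if[dfn]: "dfn Q \<Longrightarrow> dt t \<Longrightarrow> dt u \<Longrightarrow> dt (\<lambda>e. if Q e then t e else u e)"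
proof -
  assume a: "dfn Q" "dt t" "dt u"
  have "dfn (\<lambda>e. (Q (\<lambda>n. e (Suc n)) \<and> e 0 = t (\<lambda>n. e (Suc n))) \<or> (\<not> Q (\<lambda>n. e (Suc n)) \<and> e 0 = u (\<lambda>n. e (Suc n))))"
    using a(2,3) unfolding dt_def by (intro dfn_disj dfn_conj dfn_neg dfn_rename[OF a(1), of Suc])
  moreover have "(\<lambda>e. (Q (\<lambda>n. e (Suc n)) \<and> e 0 = t (\<lambda>n. e (Suc n))) \<or> (\<not> Q (\<lambda>n. e (Suc n)) \<and> e 0 = u (\<lambda>n. e (Suc n)))) =
    (\<lambda>e. e 0 = (if Q (\<lambda>n. e (Suc n)) then t (\<lambda>n. e (Suc n)) else u (\<lambda>n. e (Suc n))))" by auto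
  ultimately show ?thesis unfolding dt_def by simp
qed

lemma dfn_inst: "dfn (\<lambda>e. Q (e 0) (\<lambda>n. e (Suc n))) \<Longrightarrow> dfn (\<lambda>e. Q (e 0) s)"
  using dfn_subst[of "\<lambda>e. Q (e 0) (\<lambda>n. e (Suc n))" "case_nat (\<lambda>e. e 0) (\<lambda>n e. s n)"]
  by (simp add: atom_var atom_const split: nat.split)

lemma dt_inst: "dt (\<lambda>e. F (e 0) (\<lambda>n. e (Suc n))) \<Longrightarrow> df1 (\<lambda>x. F x s)"
proof -
  assume "dt (\<lambda>e. F (e 0) (\<lambda>n. e (Suc n)))"
  then have "dfn (\<lambda>e. e 0 = F (e (Suc 0)) (\<lambda>n. e (Suc (Suc n))))" unfolding dt_def .
  from dfn_subst[OF this, of "case_nat (\<lambda>e. e 0) (case_nat (\<lambda>e. e 1) (\<lambda>n e. s n))"]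
  show ?thesis unfolding df1_def dt_def by (simp add: atom_var atom_const split: nat.split)
qed

lemma separation_dfn:
  assumes "separation" "dfn (\<lambda>e. Q (e 0))" shows "\<exists>b. \<forall>x. x \<epsilon> b \<longleftrightarrow> x \<epsilon> a \<and> Q x"
proof -
  obtain R \<sigma> where R: "dfb R" "\<And>i. \<sigma> i \<in> atoms" "(\<lambda>e. Q (e 0)) = (\<lambda>e. R (\<lambda>i. \<sigma> i e))"
    by (rule dfnE[OF assms(2)]) (rule that)
  \<comment> \<open>As Q looks only at \<open>e 0\<close>, all variables may be identified with the
    distinguished variable 0; a constant in position i becomes the parameter at Suc i.\<close>
  define r where "r i = (if \<sigma> i \<in> range (\<lambda>n e. e n) then 0 else Suc i)" for i
  obtain \<phi> where phi: "\<And>s. R (\<lambda>i. s (r i)) = sat (\<epsilon>) s \<phi>" using dfb_sat[OF R(1)] by blast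
  define s where "s = case_nat undefined (\<lambda>i. \<sigma> i (\<lambda>n. undefined))"
  have "Q x = sat (\<epsilon>) (s(0 := x)) \<phi>" for x
  proof -
    have "Q x = R (\<lambda>i. \<sigma> i (\<lambda>n. x))" using fun_cong[OF R(3), of "\<lambda>n. x"] by simp
    also have "(\<lambda>i. \<sigma> i (\<lambda>n. x)) = (\<lambda>i. (s(0 := x)) (r i))"
    proof
      fix i show "\<sigma> i (\<lambda>n. x) = (s(0 := x)) (r i)"
        using R(2)[of i] by (cases "\<sigma> i \<in> range (\<lambda>n e. e n)") (auto simp: atoms_def r_def s_def)
    qed
    finally show ?thesis using phi[of "s(0 := x)"] by (simp only:)
  qed
  then show ?thesis using assms(1) unfolding separation_def by simp
qed

lemma replacement_dfn:
  assumes "replacement" "dfn (\<lambda>e. Q (e 0) (e 1))" "\<forall>x \<in> elts a. \<exists>!y. Q x y"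
  shows "\<exists>b. \<forall>y. y \<epsilon> b \<longleftrightarrow> (\<exists>x \<in> elts a. Q x y)"
proof -
  obtain R \<sigma> where R: "dfb R" "\<And>i. \<sigma> i \<in> atoms" "(\<lambda>e. Q (e 0) (e 1)) = (\<lambda>e. R (\<lambda>i. \<sigma> i e))"
    by (rule dfnE[OF assms(2)]) (rule that)
  \<comment> \<open>Variables 0 and 1 are the two places of Q, so every variable other than the
    first may be read as the second; parameters start at 2.\<close>
  define r where "r i = (if \<sigma> i = (\<lambda>e. e 0) then 0 else if \<sigma> i \<in> range (\<lambda>n e. e n) then 1 else i + 2)" for i
  obtain \<phi> where phi: "\<And>s. R (\<lambda>i. s (r i)) = sat (\<epsilon>) s \<phi>" using dfb_sat[OF R(1)] by blast
  define s where "s i = \<sigma> (i - 2) (\<lambda>n. undefined)" for i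
  have *: "Q x y = sat (\<epsilon>) (s(0 := x, 1 := y)) \<phi>" for x y
  proof -
    have "Q x y = R (\<lambda>i. \<sigma> i (\<lambda>n. if n = 0 then x else y))"
      using fun_cong[OF R(3), of "\<lambda>n. if n = 0 then x else y"] by simp
    also have "(\<lambda>i. \<sigma> i (\<lambda>n. if n = 0 then x else y)) = (\<lambda>i. (s(0 := x, 1 := y)) (r i))"
    proof
      fix i
      consider "\<sigma> i = (\<lambda>e. e 0)" | n where "\<sigma> i = (\<lambda>e. e n)" "\<sigma> i \<noteq> (\<lambda>e. e 0)"
        | c where "\<sigma> i = (\<lambda>e. c)" "\<sigma> i \<notin> range (\<lambda>n e. e n)"
        using R(2)[of i] unfolding atoms_def by blast
      then show "\<sigma> i (\<lambda>n. if n = 0 then x else y) = (s(0 := x, 1 := y)) (r i)"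
      proof cases
        case 3
        moreover have "\<sigma> i \<noteq> (\<lambda>e. e 0)" using 3 by blast
        ultimately show ?thesis by (simp add: r_def s_def)
      qed (auto simp: r_def)
    qed
    finally show ?thesis using phi[of "s(0 := x, 1 := y)"] by (simp only:)
  qed
  have "\<forall>x \<in> elts a. \<exists>!y. sat (\<epsilon>) (s(0 := x, 1 := y)) \<phi>" using assms(3) unfolding * .
  with assms(1) show ?thesis unfolding replacement_def * by blast
qed

end

section \<open>Sets and ordinals\<close>

locale zfc_model = set_struct mem for mem :: "'v \<Rightarrow> 'v \<Rightarrow> bool" (infix "\<epsilon>" 50) +
  assumes wfE: "wfp (\<epsilon>)" and zfc: ZFC
begin

lemma extV: "elts a = elts b \<Longrightarrow> a = b"
  using zfc unfolding ZFC_def extensional_def by blast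

lemma wf_induct[case_names step]: "(\<And>x. (\<And>y. y \<epsilon> x \<Longrightarrow> Q y) \<Longrightarrow> Q x) \<Longrightarrow> Q x"
  using wfp_induct_rule[OF wfE] by blast

lemma wf_min: "Q x \<Longrightarrow> \<exists>y. Q y \<and> (\<forall>z. z \<epsilon> y \<longrightarrow> \<not> Q z)"
  by (induction x rule: wf_induct) blast

lemma mem_irrefl: "\<not> x \<epsilon> x"
  by (induction x rule: wf_induct) blast

lemma mem_asym: "x \<epsilon> y \<Longrightarrow> \<not> y \<epsilon> x"
  by (induction x arbitrary: y rule: wf_induct) blast

text \<open>A total operation, so that set formation can be written as a term; it is meaningful only
  for those S that are the extension of an element (\<open>elts_setof\<close>).\<close>

definition setof :: "'v set \<Rightarrow> 'v" where "setof S = (THE b. elts b = S)"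

lemma setof_elts: "setof (elts a) = a"
  unfolding setof_def by (rule the_equality) (auto intro: extV)

lemma elts_setof: "\<exists>b. elts b = S \<Longrightarrow> elts (setof S) = S"
  using setof_elts by metis

lemma mem_elts: "x \<in> elts a \<longleftrightarrow> x \<epsilon> a" by (simp add: elts_def)

lemma set_eqI: "(\<And>x. x \<epsilon> a \<longleftrightarrow> x \<epsilon> b) \<Longrightarrow> a = b"
  by (rule extV) (auto simp: elts_def)

definition coll :: "'v \<Rightarrow> ('v \<Rightarrow> bool) \<Rightarrow> 'v" where "coll a Q = setof {x \<in> elts a. Q x}"
definition im :: "('v \<Rightarrow> 'v) \<Rightarrow> 'v \<Rightarrow> 'v" where "im F a = setof (F ` elts a)"
definition emp :: 'v where "emp = setof {}"
definition up :: "'v \<Rightarrow> 'v \<Rightarrow> 'v" where "up x y = setof {x, y}"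
definition Un' :: "'v \<Rightarrow> 'v" where "Un' a = setof (\<Union>x\<in>elts a. elts x)"
definition pow :: "'v \<Rightarrow> 'v" where "pow a = setof {x. elts x \<subseteq> elts a}"
definition un :: "'v \<Rightarrow> 'v \<Rightarrow> 'v" where "un a b = Un' (up a b)"
definition sing :: "'v \<Rightarrow> 'v" where "sing x = up x x"
definition ins :: "'v \<Rightarrow> 'v \<Rightarrow> 'v" where "ins x a = un (sing x) a"
definition pr :: "'v \<Rightarrow> 'v \<Rightarrow> 'v" where "pr x y = up (sing x) (up x y)"

lemma mem_coll: "dfn (\<lambda>e. Q (e 0)) \<Longrightarrow> x \<epsilon> coll a Q \<longleftrightarrow> x \<epsilon> a \<and> Q x"
proof -
  assume "dfn (\<lambda>e. Q (e 0))"
  then obtain b where "\<forall>x. x \<epsilon> b \<longleftrightarrow> x \<epsilon> a \<and> Q x"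
    using separation_dfn zfc unfolding ZFC_def by blast
  then have "elts b = {x \<in> elts a. Q x}" by (auto simp: elts_def)
  then have "elts (coll a Q) = {x \<in> elts a. Q x}" unfolding coll_def using elts_setof by blast
  then show ?thesis using mem_elts by blast
qed

lemma mem_im: "df1 F \<Longrightarrow> y \<epsilon> im F a \<longleftrightarrow> (\<exists>x. x \<epsilon> a \<and> y = F x)"
proof -
  assume F: "df1 F"
  have "dfn (\<lambda>e. e 1 = F (e 0))"
    using dfn_eq[OF dt_var df1_app[OF F dt_var]] .
  then obtain b where "\<forall>y. y \<epsilon> b \<longleftrightarrow> (\<exists>x \<in> elts a. y = F x)"
    using replacement_dfn[of "\<lambda>x y. y = F x" a] zfc unfolding ZFC_def by blast
  then have "elts b = F ` elts a" by (auto simp: elts_def)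
  then have "elts (im F a) = F ` elts a" unfolding im_def using elts_setof by blast
  then show ?thesis using mem_elts by (metis imageE imageI)
qed

lemma mem_up: "z \<epsilon> up x y \<longleftrightarrow> z = x \<or> z = y"
proof -
  obtain a where "elts a = {x, y}" using zfc unfolding ZFC_def pairing_def by blast
  then have "elts (up x y) = {x, y}" unfolding up_def using elts_setof by blast
  then show ?thesis by (auto simp: elts_def)
qed

lemma not_mem_emp: "\<not> z \<epsilon> emp"
proof -
  obtain a :: 'v where "elts a = {}" using zfc unfolding ZFC_def infinity_def by blast
  then have "elts emp = {}" unfolding emp_def using elts_setof by blast
  then show ?thesis by (auto simp: elts_def)
qed

lemma mem_Un': "z \<epsilon> Un' a \<longleftrightarrow> (\<exists>x. x \<epsilon> a \<and> z \<epsilon> x)"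
proof -
  obtain b where "elts b = (\<Union>x \<in> elts a. elts x)" using zfc unfolding ZFC_def union_def by blast
  then have "elts (Un' a) = (\<Union>x\<in>elts a. elts x)" unfolding Un'_def using elts_setof by blast
  then show ?thesis by (auto simp: elts_def)
qed

lemma mem_pow: "z \<epsilon> pow a \<longleftrightarrow> (\<forall>x. x \<epsilon> z \<longrightarrow> x \<epsilon> a)"
proof -
  obtain p where "is_power p a" using zfc unfolding ZFC_def power_set_def by blast
  then have "elts p = {x. elts x \<subseteq> elts a}" by (auto simp: elts_def is_power_def)
  then have "elts (pow a) = {x. elts x \<subseteq> elts a}" unfolding pow_def using elts_setof by blast
  then show ?thesis by (auto simp: elts_def)
qed

lemma mem_un: "z \<epsilon> un a b \<longleftrightarrow> z \<epsilon> a \<or> z \<epsilon> b"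
  unfolding un_def by (auto simp: mem_Un' mem_up)

lemma mem_sing: "z \<epsilon> sing x \<longleftrightarrow> z = x" unfolding sing_def by (simp add: mem_up)

lemma mem_ins: "z \<epsilon> ins x a \<longleftrightarrow> z = x \<or> z \<epsilon> a" unfolding ins_def by (simp add: mem_un mem_sing)

lemmas mem_simps = mem_up not_mem_emp mem_Un' mem_pow mem_un mem_sing mem_ins mem_elts

lemma emp_iff: "a = emp \<longleftrightarrow> (\<forall>x. \<not> x \<epsilon> a)"
  by (auto simp: not_mem_emp intro: set_eqI)

lemma elts_up: "elts (up x y) = {x, y}" by (auto simp: elts_def mem_simps)
lemma elts_emp: "elts emp = {}" by (auto simp: elts_def mem_simps)
lemma elts_Un': "elts (Un' a) = (\<Union>x\<in>elts a. elts x)" by (auto simp: elts_def mem_simps)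
lemma elts_un: "elts (un a b) = elts a \<union> elts b" by (auto simp: elts_def mem_simps)
lemma elts_ins: "elts (ins x a) = insert x (elts a)" by (auto simp: elts_def mem_simps)
lemma elts_im: "df1 F \<Longrightarrow> elts (im F a) = F ` elts a" by (auto simp: elts_def mem_im)
lemma up_eq: "up x y = up u v \<longleftrightarrow> (x = u \<and> y = v) \<or> (x = v \<and> y = u)"
proof
  assume "up x y = up u v"
  then have "{x, y} = {u, v}" using elts_up[of x y] elts_up[of u v] by simp
  then show "(x = u \<and> y = v) \<or> (x = v \<and> y = u)" by (simp add: doubleton_eq_iff)
qed (auto intro!: extV simp: elts_up)

lemma pr_inject[simp]: "pr x y = pr u v \<longleftrightarrow> x = u \<and> y = v"
  unfolding pr_def sing_def by (auto simp: up_eq)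

lemma is_opair_iff: "is_opair z x y \<longleftrightarrow> z = pr x y"
proof
  assume "is_opair z x y"
  then obtain u v where "elts u = {x}" "elts v = {x, y}" "elts z = {u, v}" unfolding is_opair_def by blast
  moreover from this have "u = sing x" "v = up x y"
    by (auto intro!: extV simp: sing_def elts_up)
  ultimately show "z = pr x y" unfolding pr_def by (auto intro!: extV simp: elts_up)
next
  assume "z = pr x y"
  then show "is_opair z x y" unfolding is_opair_def pr_def
    by (intro exI[of _ "sing x"] exI[of _ "up x y"]) (simp add: elts_up sing_def)
qed

lemma is_opair_fun: "is_opair = (\<lambda>z x y. z = pr x y)"
  by (intro HOL.ext) (rule is_opair_iff)

lemma maps_iff: "maps f x y \<longleftrightarrow> pr x y \<epsilon> f"
  unfolding maps_def is_opair_iff by (auto simp: elts_def)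

text \<open>By extensionality, a formula that fixes the members of the value defines the
  graph.\<close>

lemma dtI:
  assumes "dfn (\<lambda>e. \<forall>z. z \<epsilon> e 0 \<longleftrightarrow> Q z (\<lambda>n. e (Suc n)))" "\<And>e z. z \<epsilon> t e \<longleftrightarrow> Q z e"
  shows "dt t"
proof -
  have "(e 0 = t (\<lambda>n. e (Suc n))) = (\<forall>z. z \<epsilon> e 0 \<longleftrightarrow> Q z (\<lambda>n. e (Suc n)))" for e
    using assms(2) by (auto intro: set_eqI)
  then show ?thesis using assms(1) unfolding dt_def by simp
qed

lemma df_up: "df2 up" unfolding df2_def
  by (rule dtI[of "\<lambda>z e. z = e 0 \<or> z = e 1"]) (auto simp: mem_simps intro!: dfn)
lemmas dt_up[dfn] = df2_app[OF df_up]

lemma dt_pr[dfn]: "dt t \<Longrightarrow> dt u \<Longrightarrow> dt (\<lambda>e. pr (t e) (u e))"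
  unfolding pr_def sing_def by (intro dfn)

lemma df_Un': "df1 Un'" unfolding df1_def
  by (rule dtI[of "\<lambda>z e. \<exists>x. x \<epsilon> e 0 \<and> z \<epsilon> x"]) (auto simp: mem_simps intro!: dfn)
lemmas dt_Un'[dfn] = df1_app[OF df_Un']

lemma df_pow: "df1 pow" unfolding df1_def
  by (rule dtI[of "\<lambda>z e. \<forall>x. x \<epsilon> z \<longrightarrow> x \<epsilon> e 0"]) (auto simp: mem_simps intro!: dfn)
lemmas dt_pow[dfn] = df1_app[OF df_pow]

lemma dt_un[dfn]: "dt t \<Longrightarrow> dt u \<Longrightarrow> dt (\<lambda>e. un (t e) (u e))"
  unfolding un_def by (intro dfn)
lemma dt_sing[dfn]: "dt t \<Longrightarrow> dt (\<lambda>e. sing (t e))"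
  unfolding sing_def by (intro dfn)
lemma dt_ins[dfn]: "dt t \<Longrightarrow> dt u \<Longrightarrow> dt (\<lambda>e. ins (t e) (u e))"
  unfolding ins_def by (intro dfn)

lemma dfn_swap_under:
  assumes "dfn (\<lambda>e. Q (e 0) (\<lambda>n. e (Suc n)))" shows "dfn (\<lambda>e. Q (e 0) (\<lambda>n. e (Suc (Suc n))))"
  using dfn_rename[OF assms, of "case_nat 0 (\<lambda>n. Suc (Suc n))"] by simp

lemma dt_coll[dfn]:
  assumes "dt t" "dfn (\<lambda>e. Q (e 0) (\<lambda>n. e (Suc n)))"
  shows "dt (\<lambda>e. coll (t e) (\<lambda>x. Q x e))"
proof (rule dtI[of "\<lambda>z e. z \<epsilon> t e \<and> Q z e"])
  show "dfn (\<lambda>e. \<forall>z. (z \<epsilon> e 0) = (z \<epsilon> t (\<lambda>n. e (Suc n)) \<and> Q z (\<lambda>n. e (Suc n))))"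
    using dfn_swap_under[OF assms(2)] dt_shift[OF assms(1), of "\<lambda>n. Suc (Suc n)"] by (intro dfn)
  show "(z \<epsilon> coll (t e) (\<lambda>x. Q x e)) = (z \<epsilon> t e \<and> Q z e)" for e z
    using dfn_inst[OF assms(2)] by (rule mem_coll)
qed

lemma dt_im[dfn]:
  assumes "dt t" "dt (\<lambda>e. F (e 0) (\<lambda>n. e (Suc n)))"
  shows "dt (\<lambda>e. im (\<lambda>x. F x e) (t e))"
proof (rule dtI[of "\<lambda>z e. \<exists>x. x \<epsilon> t e \<and> z = F x e"])
  have "dt (\<lambda>e. F (e 0) (\<lambda>n. e (Suc (Suc (Suc n)))))"
    using dt_shift[OF assms(2), of "case_nat 0 (\<lambda>n. Suc (Suc (Suc n)))"] by simp
  then show "dfn (\<lambda>e. \<forall>z. (z \<epsilon> e 0) = (\<exists>x. x \<epsilon> t (\<lambda>n. e (Suc n)) \<and> z = F x (\<lambda>n. e (Suc n))))"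
    using dt_shift[OF assms(1), of "\<lambda>n. Suc (Suc (Suc n))"] by (intro dfn)
  show "(z \<epsilon> im (\<lambda>x. F x e) (t e)) = (\<exists>x. x \<epsilon> t e \<and> z = F x e)" for e z
    using dt_inst[OF assms(2)] by (rule mem_im)
qed

text \<open>\<open>THE\<close> is arbitrary without a unique witness; the default \<open>emp\<close>
  makes the operation definable in every case (\<open>dt_the0\<close>).\<close>

definition the0 :: "('v \<Rightarrow> bool) \<Rightarrow> 'v" where
  "the0 Q = (if \<exists>!x. Q x then (THE x. Q x) else emp)"

lemma the0_eq: "Q x \<Longrightarrow> (\<And>y. Q y \<Longrightarrow> y = x) \<Longrightarrow> the0 Q = x"
  unfolding the0_def by (subst if_P) (blast, blast)

lemma dt_the0[dfn]:
  assumes "dfn (\<lambda>e. Q (e 0) (\<lambda>n. e (Suc n)))" shows "dt (\<lambda>e. the0 (\<lambda>x. Q x e))"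
proof -
  have "(e 0 = the0 (\<lambda>x. Q x (\<lambda>n. e (Suc n)))) \<longleftrightarrow>
     (\<exists>!x. Q x (\<lambda>n. e (Suc n))) \<and> Q (e 0) (\<lambda>n. e (Suc n)) \<or>
     \<not> (\<exists>!x. Q x (\<lambda>n. e (Suc n))) \<and> e 0 = emp" for e
  proof (cases "\<exists>!x. Q x (\<lambda>n. e (Suc n))")
    case True
    then obtain x where x: "Q x (\<lambda>n. e (Suc n))" "\<And>y. Q y (\<lambda>n. e (Suc n)) \<Longrightarrow> y = x"
      by (rule ex1E) (metis that)
    then have "the0 (\<lambda>x. Q x (\<lambda>n. e (Suc n))) = x" by (rule the0_eq)
    moreover have "e 0 = x \<longleftrightarrow> Q (e 0) (\<lambda>n. e (Suc n))" using x(1) x(2)[of "e 0"] by (cases "e 0 = x") auto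
    ultimately show ?thesis by (simp only: True simp_thms)
  qed (simp add: the0_def)
  then show ?thesis unfolding dt_def
    by simp (intro dfn assms dfn_swap_under[OF assms])
qed

definition prod' :: "'v \<Rightarrow> 'v \<Rightarrow> 'v" where "prod' a b = Un' (im (\<lambda>x. im (\<lambda>y. pr x y) b) a)"

lemma df_prod': "df2 prod'" unfolding df2_def prod'_def by (intro dfn)
lemmas dt_prod'[dfn] = df2_app[OF df_prod']

lemma mem_prod': "z \<epsilon> prod' a b \<longleftrightarrow> (\<exists>x y. x \<epsilon> a \<and> y \<epsilon> b \<and> z = pr x y)"
proof -
  have 1: "df1 (\<lambda>x. im (\<lambda>y. pr x y) b)" unfolding df1_def by (intro dfn)
  have 2: "df1 (\<lambda>y. pr x y)" for x unfolding df1_def by (intro dfn)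
  show ?thesis unfolding prod'_def mem_Un' mem_im[OF 1] by (auto simp: mem_im[OF 2])
qed

lemma pr_mem_prod'[simp]: "pr x y \<epsilon> prod' a b \<longleftrightarrow> x \<epsilon> a \<and> y \<epsilon> b"
  by (simp add: mem_prod')

definition app :: "'v \<Rightarrow> 'v \<Rightarrow> 'v" where "app f x = the0 (\<lambda>y. pr x y \<epsilon> f)"
definition lam :: "('v \<Rightarrow> 'v) \<Rightarrow> 'v \<Rightarrow> 'v" where "lam F a = im (\<lambda>x. pr x (F x)) a"
definition fstv :: "'v \<Rightarrow> 'v" where "fstv z = the0 (\<lambda>x. \<exists>y. z = pr x y)"
definition sndv :: "'v \<Rightarrow> 'v" where "sndv z = the0 (\<lambda>y. \<exists>x. z = pr x y)"

lemma fstv_pr[simp]: "fstv (pr x y) = x" unfolding fstv_def by (rule the0_eq) auto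
lemma sndv_pr[simp]: "sndv (pr x y) = y" unfolding sndv_def by (rule the0_eq) auto

lemma df_fstv: "df1 fstv" unfolding df1_def fstv_def by (intro dfn)
lemma df_sndv: "df1 sndv" unfolding df1_def sndv_def by (intro dfn)
lemmas dt_fstv[dfn] = df1_app[OF df_fstv]
lemmas dt_sndv[dfn] = df1_app[OF df_sndv]

lemma df_app: "df2 app" unfolding df2_def app_def by (intro dfn)
lemmas dt_app[dfn] = df2_app[OF df_app]

lemma dt_lam[dfn]:
  assumes "dt t" "dt (\<lambda>e. F (e 0) (\<lambda>n. e (Suc n)))"
  shows "dt (\<lambda>e. lam (\<lambda>x. F x e) (t e))"
  unfolding lam_def using assms by (intro dfn)

lemma mem_lam: "df1 F \<Longrightarrow> z \<epsilon> lam F a \<longleftrightarrow> (\<exists>x. x \<epsilon> a \<and> z = pr x (F x))"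
  unfolding lam_def by (subst mem_im) (auto simp: df1_def intro!: dfn)

lemma app_lam: "df1 F \<Longrightarrow> x \<epsilon> a \<Longrightarrow> app (lam F a) x = F x"
  unfolding app_def by (rule the0_eq) (auto simp: mem_lam)

lemma maps_lam: "df1 F \<Longrightarrow> maps (lam F a) x y \<longleftrightarrow> x \<epsilon> a \<and> y = F x"
  by (auto simp: maps_iff mem_lam)

lemma fun_on_app: "fun_on f a \<Longrightarrow> x \<epsilon> a \<Longrightarrow> maps f x y \<longleftrightarrow> y = app f x"
proof
  assume f: "fun_on f a" "x \<epsilon> a"
  then obtain z where z: "maps f x z" unfolding fun_on_def by (auto simp: elts_def)
  have u: "maps f x w \<Longrightarrow> maps f x w' \<Longrightarrow> w = w'" for w w'
    using f(1) unfolding fun_on_def partial_fun_on_def by blast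
  have "app f x = z" unfolding app_def maps_iff[symmetric] using z u by (intro the0_eq)
  then show "maps f x y \<Longrightarrow> y = app f x" "y = app f x \<Longrightarrow> maps f x y" using z u by auto
qed

lemma fun_on_lam: "df1 F \<Longrightarrow> fun_on (lam F a) a"
  unfolding fun_on_def partial_fun_on_def
  by (auto simp add: mem_lam maps_lam elts_def is_opair_fun)

lemma fun_into_lam: "df1 F \<Longrightarrow> (\<And>x. x \<epsilon> a \<Longrightarrow> F x \<epsilon> b) \<Longrightarrow> fun_into (lam F a) a b"
  unfolding fun_into_def by (auto simp: fun_on_lam maps_lam)

lemma df1_app_const: "df1 (app f)"
  unfolding df1_def by (intro dfn)

end

section \<open>Ordinals, transitive closures, recursion along membership, choice functions\<close>

context zfc_model
begin

lemma transitive_iff: "transitive a \<longleftrightarrow> (\<forall>x y. x \<epsilon> a \<longrightarrow> y \<epsilon> x \<longrightarrow> y \<epsilon> a)"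
  unfolding transitive_def by (auto simp: elts_def)

lemma dfn_transitive[dfn]: "dt t \<Longrightarrow> dfn (\<lambda>e. transitive (t e))"
  by (rule dfn_sub1) (auto simp: transitive_iff intro!: dfn)

lemma dfn_ordinal[dfn]: "dt t \<Longrightarrow> dfn (\<lambda>e. ordinal (t e))"
  by (rule dfn_sub1) (auto simp: ordinal_def intro!: dfn)

lemma ordinal_mem: "ordinal a \<Longrightarrow> x \<epsilon> a \<Longrightarrow> ordinal x"
  unfolding ordinal_def transitive_iff by (metis mem_elts)

lemma ordinal_trans: "ordinal a \<Longrightarrow> x \<epsilon> a \<Longrightarrow> y \<epsilon> x \<Longrightarrow> y \<epsilon> a"
  unfolding ordinal_def transitive_iff by metis

lemma ordinalI: "(\<And>x. x \<epsilon> a \<Longrightarrow> ordinal x) \<Longrightarrow> (\<And>x y. x \<epsilon> a \<Longrightarrow> y \<epsilon> x \<Longrightarrow> y \<epsilon> a) \<Longrightarrow> ordinal a"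
  unfolding ordinal_def transitive_iff by (metis mem_elts)

lemma ordinal_linear: "ordinal a \<Longrightarrow> ordinal b \<Longrightarrow> a \<epsilon> b \<or> a = b \<or> b \<epsilon> a"
proof (induction a arbitrary: b rule: wf_induct)
  case (step a)
  note IHa = step.IH
  from step.prems(2) show ?case
  proof (induction b rule: wf_induct)
    case (step b)
    show ?case
    proof (rule ccontr)
      assume c: "\<not> (a \<epsilon> b \<or> a = b \<or> b \<epsilon> a)"
      have "x \<epsilon> b" if "x \<epsilon> a" for x
        using IHa[OF that ordinal_mem[OF \<open>ordinal a\<close> that] \<open>ordinal b\<close>] that c
          ordinal_trans[OF \<open>ordinal a\<close> that] by blast
      moreover have "x \<epsilon> a" if "x \<epsilon> b" for x
        using step.IH[OF that ordinal_mem[OF \<open>ordinal b\<close> that]] that c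
          ordinal_trans[OF \<open>ordinal b\<close> that] by blast
      ultimately have "a = b" by (blast intro: set_eqI)
      then show False using c by blast
    qed
  qed
qed

lemma ordinal_subset: "ordinal a \<Longrightarrow> ordinal b \<Longrightarrow> elts a \<subseteq> elts b \<longleftrightarrow> a = b \<or> a \<epsilon> b"
proof
  assume "ordinal a" "ordinal b" "elts a \<subseteq> elts b"
  then show "a = b \<or> a \<epsilon> b" using ordinal_linear[of a b] mem_irrefl[of b] by (auto simp: elts_def)
next
  assume "ordinal a" "ordinal b" "a = b \<or> a \<epsilon> b"
  then show "elts a \<subseteq> elts b" using ordinal_trans[of b a] by (auto simp: elts_def)
qed

lemma ordinal_not_mem: "ordinal a \<Longrightarrow> ordinal b \<Longrightarrow> \<not> a \<epsilon> b \<longleftrightarrow> elts b \<subseteq> elts a"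
  using ordinal_subset[of b a] ordinal_linear[of a b] mem_irrefl mem_asym by blast

lemma ordinal_least:
  assumes "ordinal x" "Q x"
  obtains y where "ordinal y" "Q y" "\<And>z. ordinal z \<Longrightarrow> Q z \<Longrightarrow> elts y \<subseteq> elts z"
proof -
  obtain y where y: "ordinal y \<and> Q y" "\<forall>z. z \<epsilon> y \<longrightarrow> \<not> (ordinal z \<and> Q z)"
    using wf_min[of "\<lambda>x. ordinal x \<and> Q x"] assms by blast
  have "elts y \<subseteq> elts z" if "ordinal z" "Q z" for z
    using y that ordinal_not_mem by blast
  then show thesis using that y by blast
qed

definition least :: "('v \<Rightarrow> bool) \<Rightarrow> 'v" where
  "least Q = the0 (\<lambda>x. ordinal x \<and> Q x \<and> (\<forall>y. y \<epsilon> x \<longrightarrow> \<not> Q y))"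

lemma dt_least[dfn]:
  assumes "dfn (\<lambda>e. Q (e 0) (\<lambda>n. e (Suc n)))" shows "dt (\<lambda>e. least (\<lambda>x. Q x e))"
  unfolding least_def by (intro dfn assms dfn_swap_under[OF assms])

lemma least_ordinal:
  assumes "ordinal x" "Q x"
  shows "ordinal (least Q)" "Q (least Q)" "\<And>z. ordinal z \<Longrightarrow> Q z \<Longrightarrow> elts (least Q) \<subseteq> elts z"
    "\<And>z. z \<epsilon> least Q \<Longrightarrow> \<not> Q z"
proof -
  obtain y where y: "ordinal y" "Q y" "\<And>z. ordinal z \<Longrightarrow> Q z \<Longrightarrow> elts y \<subseteq> elts z"
    using ordinal_least[of x Q] assms by blast
  have n: "\<not> Q z" if "z \<epsilon> y" for z
    using y(3)[of z] that ordinal_mem[OF y(1)] mem_irrefl by (auto simp: elts_def)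
  have "least Q = y" unfolding least_def
  proof (rule the0_eq)
    fix z assume "ordinal z \<and> Q z \<and> (\<forall>y. y \<epsilon> z \<longrightarrow> \<not> Q y)"
    then show "z = y" using y n ordinal_linear[of z y] by blast
  qed (use y n in blast)
  then show "ordinal (least Q)" "Q (least Q)" "\<And>z. ordinal z \<Longrightarrow> Q z \<Longrightarrow> elts (least Q) \<subseteq> elts z"
    "\<And>z. z \<epsilon> least Q \<Longrightarrow> \<not> Q z" using y n by blast+
qed

definition succ :: "'v \<Rightarrow> 'v" where "succ x = ins x x"

lemma mem_succ: "y \<epsilon> succ x \<longleftrightarrow> y = x \<or> y \<epsilon> x" unfolding succ_def by (simp add: mem_simps)
lemma dt_succ[dfn]: "dt t \<Longrightarrow> dt (\<lambda>e. succ (t e))" unfolding succ_def by (intro dfn)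

lemma ordinal_succ: "ordinal x \<Longrightarrow> ordinal (succ x)"
  by (rule ordinalI) (auto simp: mem_succ intro: ordinal_mem ordinal_trans)

lemma ordinal_emp: "ordinal emp" by (rule ordinalI) (auto simp: not_mem_emp)

lemma ordinal_Un': "(\<And>x. x \<epsilon> a \<Longrightarrow> ordinal x) \<Longrightarrow> ordinal (Un' a)"
  by (rule ordinalI; unfold mem_Un') (blast intro: ordinal_mem, metis ordinal_trans)

lemma ordinal_un: "ordinal a \<Longrightarrow> ordinal b \<Longrightarrow> ordinal (un a b)"
  by (rule ordinalI) (auto simp: mem_simps intro: ordinal_mem ordinal_trans)

lemma ordinal_emp_mem: "ordinal a \<Longrightarrow> x \<epsilon> a \<Longrightarrow> emp \<epsilon> a"
  using ordinal_linear[OF ordinal_emp, of a] by (auto simp: not_mem_emp)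

lemma limit_ordinal_iff:
  "limit_ordinal a \<longleftrightarrow> ordinal a \<and> emp \<epsilon> a \<and> (\<forall>x. x \<epsilon> a \<longrightarrow> succ x \<epsilon> a)"
proof
  assume l: "limit_ordinal a"
  then have o: "ordinal a" "emp \<epsilon> a" unfolding limit_ordinal_def using ordinal_emp_mem
    by (auto simp: elts_def)
  have "succ x \<epsilon> a" if xa: "x \<epsilon> a" for x
  proof -
    obtain y where y: "y \<epsilon> a" "x \<epsilon> y"
      using l xa unfolding limit_ordinal_def Ball_def Bex_def mem_elts by blast
    have "ordinal y" "ordinal x" using o y xa ordinal_mem by blast+
    then show ?thesis
      using ordinal_linear[OF ordinal_succ, of x a] o y xa ordinal_trans[OF o(1)]
        mem_succ mem_irrefl mem_asym by metis
  qed
  then show "ordinal a \<and> emp \<epsilon> a \<and> (\<forall>x. x \<epsilon> a \<longrightarrow> succ x \<epsilon> a)" using o by blast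
next
  assume "ordinal a \<and> emp \<epsilon> a \<and> (\<forall>x. x \<epsilon> a \<longrightarrow> succ x \<epsilon> a)"
  then show "limit_ordinal a" unfolding limit_ordinal_def elts_def using mem_succ by blast
qed

text \<open>Characterising the transitive closure by minimality is first-order, which makes it
  available before recursion is; x itself is not among its elements.\<close>

definition is_tc :: "'v \<Rightarrow> 'v \<Rightarrow> bool" where
  "is_tc x c \<longleftrightarrow> transitive c \<and> elts x \<subseteq> elts c \<and>
     (\<forall>d. transitive d \<longrightarrow> elts x \<subseteq> elts d \<longrightarrow> elts c \<subseteq> elts d)"

definition tc :: "'v \<Rightarrow> 'v" where "tc x = the0 (is_tc x)"

lemma dfn_is_tc[dfn]: "dt t \<Longrightarrow> dt u \<Longrightarrow> dfn (\<lambda>e. is_tc (t e) (u e))"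
  by (rule dfn_sub2) (auto simp: is_tc_def intro!: dfn)

lemma df_tc: "df1 tc" unfolding df1_def tc_def by (intro dfn)
lemma tc_props: "is_tc x (tc x)" and tc_eq: "elts (tc x) = elts x \<union> (\<Union>y\<in>elts x. elts (tc y))"
proof -
  have u: "is_tc x c \<Longrightarrow> is_tc x d \<Longrightarrow> c = d" for x c d
    unfolding is_tc_def by (intro extV) blast
  have e: "is_tc x c \<Longrightarrow> tc x = c" for x c
    unfolding tc_def using u by (intro the0_eq)
  \<comment> \<open>Existence goes by induction on membership: the closures of the elements of x
    exist already, and \<open>tc\<close> agrees with any set satisfying
    \<open>is_tc\<close>.\<close>
  have "is_tc x (un x (Un' (im tc x))) \<and> is_tc x (tc x)" for x
  proof (induction x rule: wf_induct)
    case (step x)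
    let ?c = "un x (Un' (im tc x))"
    have m: "z \<epsilon> ?c \<longleftrightarrow> z \<epsilon> x \<or> (\<exists>y. y \<epsilon> x \<and> z \<epsilon> tc y)" for z
      by (auto simp: mem_simps mem_im[OF df_tc])
    have IH: "is_tc y (tc y)" if "y \<epsilon> x" for y using step that by blast
    have "transitive ?c" unfolding transitive_iff m
    proof (intro allI impI)
      fix u v assume u: "u \<epsilon> x \<or> (\<exists>y. y \<epsilon> x \<and> u \<epsilon> tc y)" "v \<epsilon> u"
      have "\<exists>y. y \<epsilon> x \<and> v \<epsilon> tc y"
        using u IH unfolding is_tc_def transitive_iff subset_eq Ball_def mem_elts by metis
      then show "v \<epsilon> x \<or> (\<exists>y. y \<epsilon> x \<and> v \<epsilon> tc y)" by blast
    qed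
    moreover have "elts ?c \<subseteq> elts d" if d: "transitive d" "elts x \<subseteq> elts d" for d
    proof -
      have "elts (tc y) \<subseteq> elts d" if "y \<epsilon> x" for y
      proof -
        have "elts y \<subseteq> elts d" using d that unfolding transitive_def by (auto simp: elts_def)
        then show ?thesis using IH[OF that] d(1) unfolding is_tc_def by blast
      qed
      then show ?thesis using d by (auto simp: elts_def m)
    qed
    ultimately have "is_tc x ?c" unfolding is_tc_def by (auto simp: elts_def m)
    then show ?case using e by simp
  qed
  then show "is_tc x (tc x)" "elts (tc x) = elts x \<union> (\<Union>y\<in>elts x. elts (tc y))"
    using e[of x "un x (Un' (im tc x))"] by (auto simp: elts_un elts_Un' elts_im[OF df_tc])
qed

lemma mem_tc: "y \<epsilon> x \<Longrightarrow> y \<epsilon> tc x" and trans_tc: "y \<epsilon> tc x \<Longrightarrow> z \<epsilon> y \<Longrightarrow> z \<epsilon> tc x"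
  using tc_props[of x] unfolding is_tc_def transitive_iff by (auto simp: elts_def)

text \<open>Recursion along membership: the graph of the recursive operation is defined by the existence
  of a set-sized approximation with transitive domain.\<close>

definition approx :: "('v \<Rightarrow> 'v) \<Rightarrow> 'v \<Rightarrow> 'v \<Rightarrow> bool" where
  "approx H d f \<longleftrightarrow> transitive d \<and> (\<forall>u. u \<epsilon> d \<longrightarrow> app f u = H (lam (app f) u))"

theorem recursion:
  assumes H: "df1 H"
  obtains F where "df1 F" "\<And>x. F x = H (lam F x)"
proof -
  \<comment> \<open>Membership is well-founded in the metatheory, so F exists outside the model at
    once; what remains is to define it inside.\<close>
  define F where "F = wfrec {(y, x). y \<epsilon> x} (\<lambda>F x. H (setof ((\<lambda>y. pr y (F y)) ` elts x)))"
  have wf: "wf {(y, x). y \<epsilon> x}" using wfE by (simp add: wfp_def)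
  have F: "F x = H (lam F x)" for x
  proof -
    have "F x = H (setof ((\<lambda>y. pr y (cut F {(y, x). y \<epsilon> x} x y)) ` elts x))"
      unfolding F_def by (subst wfrec[OF wf]) simp
    also have "(\<lambda>y. pr y (cut F {(y, x). y \<epsilon> x} x y)) ` elts x = (\<lambda>y. pr y (F y)) ` elts x"
      by (rule image_cong) (auto simp: cut_def elts_def)
    finally show ?thesis unfolding lam_def im_def .
  qed
  have lam_cong: "lam F u = lam G u" if "\<And>y. y \<epsilon> u \<Longrightarrow> F y = G y" for G u
  proof -
    have "(\<lambda>y. pr y (F y)) ` elts u = (\<lambda>y. pr y (G y)) ` elts u"
      by (rule image_cong) (auto simp: that elts_def)
    then show ?thesis unfolding lam_def im_def by simp
  qed
  have approx: "app f u = F u" if "approx H d f" "u \<epsilon> d" for d f u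
    using that(2)
  proof (induction u rule: wf_induct)
    case (step u)
    have "lam F u = lam (app f) u"
      using step that(1) unfolding approx_def transitive_iff by (intro lam_cong) auto
    then show ?case using F[of u] that(1) step.prems unfolding approx_def by simp
  qed
  define \<Gamma> where "\<Gamma> x y \<longleftrightarrow> (\<exists>d f. approx H d f \<and> x \<epsilon> d \<and> y = app f x)" for x y
  have dA: "dfn (\<lambda>e. approx H (t e) (u e))" if "dt t" "dt u" for t u
    by (rule dfn_sub2[OF _ that]) (auto simp: approx_def intro!: dfn df1_app[OF H])
  have dG: "dfn (\<lambda>e. \<Gamma> (t e) (u e))" if "dt t" "dt u" for t u
    by (rule dfn_sub2[OF _ that]) (auto simp: \<Gamma>_def intro!: dfn dA)
  have G1: "y = F x" if "\<Gamma> x y" for x y using approx that unfolding \<Gamma>_def by blast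
  have G2: "\<Gamma> x (F x)" for x
  proof (induction x rule: wf_induct)
    case (step x)
    have tcG: "\<Gamma> u (F u)" if "u \<epsilon> tc x" for u
    proof -
      consider "u \<epsilon> x" | y where "y \<epsilon> x" "u \<epsilon> tc y" using tc_eq[of x] \<open>u \<epsilon> tc x\<close> by (auto simp: elts_def)
      then show ?thesis
      proof cases
        case 2
        then obtain d f where d: "approx H d f" "y \<epsilon> d" using step unfolding \<Gamma>_def by blast
        have "elts (tc y) \<subseteq> elts d"
          using tc_props[of y] d unfolding is_tc_def approx_def transitive_def elts_def by blast
        then show ?thesis using d approx 2 unfolding \<Gamma>_def elts_def by fastforce
      qed (use step in blast)
    qed
    \<comment> \<open>On tc x this agrees with F, but it is visibly definable, so
      \<open>lam Gt (tc x)\<close> is a legitimate set of the model.\<close>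
    define Gt where "Gt u = the0 (\<Gamma> u)" for u
    have dGt: "df1 Gt" unfolding df1_def Gt_def by (intro dfn dG)
    have Gt: "Gt u = F u" if "u \<epsilon> tc x" for u
      unfolding Gt_def using tcG[OF that] G1 by (intro the0_eq)
    define f where "f = ins (pr x (H (lam Gt x))) (lam Gt (tc x))"
    define d where "d = ins x (tc x)"
    have xn: "\<not> x \<epsilon> tc x"
    proof
      assume "x \<epsilon> tc x"
      moreover have "\<not> x \<epsilon> tc x" for x
      proof (induction x rule: wf_induct)
        case (step x)
        show ?case
        proof
          assume "x \<epsilon> tc x"
          then obtain y where y: "y \<epsilon> x" "x \<epsilon> tc y"
            using tc_eq[of x] mem_irrefl by (auto simp: elts_def)
          then show False using step trans_tc by blast
        qed
      qed
      ultimately show False by blast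
    qed
    have f1: "app f u = F u" if "u \<epsilon> tc x" for u
      unfolding app_def using that xn Gt
      by (intro the0_eq) (auto simp: f_def mem_simps mem_lam[OF dGt])
    have "lam Gt x = lam F x" by (rule lam_cong[symmetric]) (simp add: Gt mem_tc)
    then have f2: "app f x = F x"
      unfolding app_def using xn F[of x]
      by (intro the0_eq) (auto simp: f_def mem_simps mem_lam[OF dGt])
    have fd: "app f u = F u" if "u \<epsilon> d" for u using that f1 f2 by (auto simp: d_def mem_simps)
    have "transitive d" unfolding d_def transitive_iff using mem_tc trans_tc by (auto simp: mem_simps)
    moreover have "app f u = H (lam (app f) u)" if "u \<epsilon> d" for u
    proof -
      have "lam F u = lam (app f) u" using fd \<open>transitive d\<close> that
        unfolding transitive_iff by (intro lam_cong) metis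
      then show ?thesis using fd[OF that] F[of u] by simp
    qed
    ultimately have "approx H d f" unfolding approx_def by blast
    then show ?case unfolding \<Gamma>_def using f2 by (intro exI[of _ d] exI[of _ f]) (auto simp: d_def mem_simps)
  qed
  have "F = (\<lambda>x. the0 (\<Gamma> x))"
    by (rule HOL.ext, rule sym, rule the0_eq) (use G1 G2 in auto)
  then have "df1 F" unfolding df1_def by (simp only:) (intro dfn dG)
  then show thesis using that F by blast
qed

lemma choice_function:
  obtains f where "\<And>x. x \<epsilon> a \<Longrightarrow> x \<noteq> emp \<Longrightarrow> app f x \<epsilon> x"
proof -
  \<comment> \<open>Tagging the elements of x with x makes the family disjoint, as
    \<open>choice\<close> demands.\<close>
  define T where "T x = prod' (sing x) x" for x
  have dT: "df1 T" unfolding df1_def T_def by (intro dfn)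
  define A where "A = im T (coll a (\<lambda>x. x \<noteq> emp))"
  have mA: "z \<epsilon> A \<longleftrightarrow> (\<exists>x. x \<epsilon> a \<and> x \<noteq> emp \<and> z = T x)" for z
    unfolding A_def mem_im[OF dT] by (subst mem_coll) (auto intro!: dfn)
  have mT: "z \<epsilon> T x \<longleftrightarrow> (\<exists>y. y \<epsilon> x \<and> z = pr x y)" for z x
    unfolding T_def mem_prod' by (auto simp: mem_simps)
  have "(\<forall>x\<in>elts A. elts x \<noteq> {}) \<and> (\<forall>x\<in>elts A. \<forall>y\<in>elts A. x \<noteq> y \<longrightarrow> elts x \<inter> elts y = {})"
    by (auto simp: elts_def mA mT emp_iff)
  then obtain c where c: "\<forall>x\<in>elts A. \<exists>!y. y \<in> elts x \<inter> elts c"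
    using zfc unfolding ZFC_def choice_def by blast
  define f where "f = coll (Un' A) (\<lambda>z. z \<epsilon> c)"
  have mf: "pr x y \<epsilon> f \<longleftrightarrow> x \<epsilon> a \<and> y \<epsilon> x \<and> pr x y \<epsilon> c" for x y
  proof -
    have "pr x y \<epsilon> Un' A \<longleftrightarrow> x \<epsilon> a \<and> y \<epsilon> x"
      unfolding mem_Un' mA emp_iff using mT[of "pr x y"] by (metis pr_inject)
    then show ?thesis unfolding f_def by (subst mem_coll) (auto intro!: dfn)
  qed
  have "app f x \<epsilon> x" if "x \<epsilon> a" "x \<noteq> emp" for x
  proof -
    have "T x \<in> elts A" using that mA by (auto simp: elts_def)
    with c have "\<exists>!y. y \<epsilon> T x \<and> y \<epsilon> c" by (auto simp: elts_def)
    then obtain z where z: "z \<epsilon> T x" "z \<epsilon> c" "\<And>z'. z' \<epsilon> T x \<Longrightarrow> z' \<epsilon> c \<Longrightarrow> z' = z"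
      by (rule ex1E) (metis that)
    then obtain y where y: "y \<epsilon> x" "z = pr x y" unfolding mT by blast
    have "app f x = y" unfolding app_def
    proof (rule the0_eq)
      show "pr x y \<epsilon> f" using that(1) y(1) z(2)[unfolded y(2)] mf by blast
      show "y' = y" if "pr x y' \<epsilon> f" for y'
        using that z(3)[of "pr x y'", unfolded y(2) pr_inject] mf[of x y'] mT[of "pr x y'" x] by blast
    qed
    then show ?thesis using y by simp
  qed
  then show thesis using that by blast
qed

end

section \<open>Cardinalities\<close>

context zfc_model
begin

text \<open>By replacement, a definable injection between sets restricts to an element of \<open>V\<close>, so this is
  comparison of cardinalities in \<open>V\<close> (see \<open>lep_iff\<close>).\<close>

definition lep :: "'v \<Rightarrow> 'v \<Rightarrow> bool" where
  "lep x y \<longleftrightarrow> (\<exists>F. df1 F \<and> (\<forall>u. u \<epsilon> x \<longrightarrow> F u \<epsilon> y) \<and>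
     (\<forall>u v. u \<epsilon> x \<longrightarrow> v \<epsilon> x \<longrightarrow> F u = F v \<longrightarrow> u = v))"

definition injf :: "'v \<Rightarrow> 'v \<Rightarrow> 'v \<Rightarrow> bool" where
  "injf f x y \<longleftrightarrow> (\<forall>u. u \<epsilon> x \<longrightarrow> app f u \<epsilon> y) \<and>
     (\<forall>u v. u \<epsilon> x \<longrightarrow> v \<epsilon> x \<longrightarrow> app f u = app f v \<longrightarrow> u = v)"

lemma lepI: "df1 F \<Longrightarrow> (\<And>u. u \<epsilon> x \<Longrightarrow> F u \<epsilon> y) \<Longrightarrow>
    (\<And>u v. u \<epsilon> x \<Longrightarrow> v \<epsilon> x \<Longrightarrow> F u = F v \<Longrightarrow> u = v) \<Longrightarrow> lep x y"
  unfolding lep_def by metis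

lemma lepE:
  assumes "lep x y"
  obtains F where "df1 F" "\<And>u. u \<epsilon> x \<Longrightarrow> F u \<epsilon> y"
    "\<And>u v. u \<epsilon> x \<Longrightarrow> v \<epsilon> x \<Longrightarrow> F u = F v \<Longrightarrow> u = v"
  using assms unfolding lep_def by metis

text \<open>The bound \<open>pow (prod' x y)\<close> confines the injections to a set, from which
  \<open>lep_Union\<close> can choose.\<close>

lemma lep_injf: assumes "lep x y" shows "\<exists>f. f \<epsilon> pow (prod' x y) \<and> injf f x y"
proof -
  obtain F where F: "df1 F" "\<And>u. u \<epsilon> x \<Longrightarrow> F u \<epsilon> y"
    "\<And>u v. u \<epsilon> x \<Longrightarrow> v \<epsilon> x \<Longrightarrow> F u = F v \<Longrightarrow> u = v" using lepE[OF assms] by metis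
  have "lam F x \<epsilon> pow (prod' x y)" using F by (auto simp: mem_pow mem_lam)
  moreover have "injf (lam F x) x y" unfolding injf_def using F by (simp add: app_lam)
  ultimately show ?thesis by blast
qed

lemma injf_lep: "injf f x y \<Longrightarrow> lep x y"
  unfolding injf_def by (rule lepI[OF df1_app_const]) auto

lemma lep_iff: "lep x y \<longleftrightarrow> (\<exists>f. injf f x y)"
  using lep_injf injf_lep by blast

lemma dfn_injf[dfn]: "dt t \<Longrightarrow> dt u \<Longrightarrow> dt v \<Longrightarrow> dfn (\<lambda>e. injf (t e) (u e) (v e))"
  by (rule dfn_sub3) (auto simp: injf_def intro!: dfn)

lemma dfn_lep[dfn]: "dt t \<Longrightarrow> dt u \<Longrightarrow> dfn (\<lambda>e. lep (t e) (u e))"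
  by (rule dfn_sub2) (auto simp: lep_iff intro!: dfn)

lemma lep_subset: "(\<And>u. u \<epsilon> x \<Longrightarrow> u \<epsilon> y) \<Longrightarrow> lep x y"
  by (rule lepI[of "\<lambda>x. x"]) (auto simp: df1_def intro!: dfn)

lemma lep_refl: "lep x x" by (rule lep_subset)

lemma lep_mem: "ordinal y \<Longrightarrow> x \<epsilon> y \<Longrightarrow> lep x y"
  by (rule lep_subset) (rule ordinal_trans)

lemma lep_trans: assumes "lep x y" "lep y z" shows "lep x z"
proof -
  obtain F where F: "df1 F" "\<And>u. u \<epsilon> x \<Longrightarrow> F u \<epsilon> y"
    "\<And>u v. u \<epsilon> x \<Longrightarrow> v \<epsilon> x \<Longrightarrow> F u = F v \<Longrightarrow> u = v" using lepE[OF assms(1)] by metis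
  obtain G where G: "df1 G" "\<And>u. u \<epsilon> y \<Longrightarrow> G u \<epsilon> z"
    "\<And>u v. u \<epsilon> y \<Longrightarrow> v \<epsilon> y \<Longrightarrow> G u = G v \<Longrightarrow> u = v" using lepE[OF assms(2)] by metis
  show ?thesis
  proof (rule lepI[of "\<lambda>x. G (F x)"])
    show "df1 (\<lambda>x. G (F x))" unfolding df1_def by (intro dfn df1_app[OF G(1)] df1_app[OF F(1)])
  qed (use F G in blast)+
qed

lemma lep_finite: assumes "lep x y" "finite (elts y)" shows "finite (elts x)"
proof -
  obtain F where F: "df1 F" "\<And>u. u \<epsilon> x \<Longrightarrow> F u \<epsilon> y"
    "\<And>u v. u \<epsilon> x \<Longrightarrow> v \<epsilon> x \<Longrightarrow> F u = F v \<Longrightarrow> u = v" using lepE[OF assms(1)] by metis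
  have "inj_on F (elts x)" "F ` elts x \<subseteq> elts y" using F by (auto simp: inj_on_def elts_def)
  then show ?thesis using assms(2) inj_on_finite by blast
qed

lemma lep_onto:
  assumes "df1 F" "ordinal a" "\<And>y. y \<epsilon> b \<Longrightarrow> \<exists>x. x \<epsilon> a \<and> F x = y" shows "lep b a"
proof (rule lepI[of "\<lambda>y. least (\<lambda>x. x \<epsilon> a \<and> F x = y)"])
  show "df1 (\<lambda>y. least (\<lambda>x. x \<epsilon> a \<and> F x = y))"
    unfolding df1_def by (intro dfn df1_app[OF assms(1)])
  have *: "least (\<lambda>x. x \<epsilon> a \<and> F x = y) \<epsilon> a \<and> F (least (\<lambda>x. x \<epsilon> a \<and> F x = y)) = y" if yb: "y \<epsilon> b" for y
  proof -
    obtain x where "x \<epsilon> a" "F x = y" using assms(3)[OF yb] by blast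
    then show ?thesis using least_ordinal(2)[of x "\<lambda>x. x \<epsilon> a \<and> F x = y"] ordinal_mem[OF assms(2)] by blast
  qed
  show "least (\<lambda>x. x \<epsilon> a \<and> F x = y) \<epsilon> a" if "y \<epsilon> b" for y using *[OF that] by blast
  show "u = v" if "u \<epsilon> b" "v \<epsilon> b" "least (\<lambda>x. x \<epsilon> a \<and> F x = u) = least (\<lambda>x. x \<epsilon> a \<and> F x = v)" for u v
    using *[OF that(1)] *[OF that(2)] that(3) by metis
qed

lemma fun_into_app: "fun_into f a b \<Longrightarrow> x \<epsilon> a \<Longrightarrow> app f x \<epsilon> b \<and> maps f x (app f x)"
  unfolding fun_into_def using fun_on_app by blast

lemma fun_on_dom: "fun_on f a \<Longrightarrow> maps f x y \<Longrightarrow> x \<epsilon> a"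
  unfolding fun_on_def partial_fun_on_def maps_def is_opair_fun by (auto simp: elts_def)

lemma equinumerous_lep: assumes "equinumerous a b" shows "lep a b" "lep b a"
proof -
  obtain f where f: "fun_into f a b" "\<And>y. y \<epsilon> b \<Longrightarrow> \<exists>!x. maps f x y"
    using assms unfolding equinumerous_def bijection_def mem_elts Ball_def by blast
  show "lep a b"
  proof (rule lepI[OF df1_app_const[of f]])
    fix u v assume "u \<epsilon> a" "v \<epsilon> a" "app f u = app f v"
    then show "u = v" using fun_into_app[OF f(1)] f(2)[of "app f u"] by metis
  qed (use fun_into_app[OF f(1)] in blast)
  show "lep b a"
  proof (rule lepI[of "\<lambda>y. the0 (\<lambda>x. pr x y \<epsilon> f)"])
    show "df1 (\<lambda>y. the0 (\<lambda>x. pr x y \<epsilon> f))" unfolding df1_def by (intro dfn)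
    have *: "pr (the0 (\<lambda>x. pr x y \<epsilon> f)) y \<epsilon> f" if yb: "y \<epsilon> b" for y
    proof -
      obtain x where x: "pr x y \<epsilon> f" "\<And>z. pr z y \<epsilon> f \<Longrightarrow> z = x"
        by (rule ex1E[OF f(2)[OF yb, unfolded maps_iff]]) (rule that, blast+)
      then have "the0 (\<lambda>x. pr x y \<epsilon> f) = x" by (rule the0_eq)
      then show ?thesis using x(1) by simp
    qed
    show "the0 (\<lambda>x. pr x y \<epsilon> f) \<epsilon> a" if "y \<epsilon> b" for y
      using *[OF that] f(1) fun_on_dom unfolding maps_iff fun_into_def by blast
    fix u v assume uv: "u \<epsilon> b" "v \<epsilon> b" "the0 (\<lambda>x. pr x u \<epsilon> f) = the0 (\<lambda>x. pr x v \<epsilon> f)"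
    have "maps f (the0 (\<lambda>x. pr x u \<epsilon> f)) u" "maps f (the0 (\<lambda>x. pr x u \<epsilon> f)) v"
      using *[OF uv(1)] *[OF uv(2)] uv(3) by (auto simp: maps_iff)
    then show "u = v" using f(1) unfolding fun_into_def fun_on_def partial_fun_on_def by blast
  qed
qed

text \<open>Cantor--Bernstein, with the set of points moved by \<open>F\<close> obtained as a greatest fixed point.\<close>

lemma lep_antisym: assumes "lep a b" "lep b a" shows "equinumerous a b"
proof -
  obtain F where F: "df1 F" "\<And>u. u \<epsilon> a \<Longrightarrow> F u \<epsilon> b"
    "\<And>u v. u \<epsilon> a \<Longrightarrow> v \<epsilon> a \<Longrightarrow> F u = F v \<Longrightarrow> u = v" using lepE[OF assms(1)] by metis
  obtain G where G: "df1 G" "\<And>u. u \<epsilon> b \<Longrightarrow> G u \<epsilon> a"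
    "\<And>u v. u \<epsilon> b \<Longrightarrow> v \<epsilon> b \<Longrightarrow> G u = G v \<Longrightarrow> u = v" using lepE[OF assms(2)] by metis
  define ok where "ok Y z \<longleftrightarrow> (\<forall>w. w \<epsilon> b \<longrightarrow> z = G w \<longrightarrow> (\<exists>u. u \<epsilon> Y \<and> w = F u))" for Y z
  define post where "post Y \<longleftrightarrow> (\<forall>z. z \<epsilon> Y \<longrightarrow> z \<epsilon> a \<and> ok Y z)" for Y
  have d: "dfn (\<lambda>e. post (t e))" if "dt t" for t
    by (rule dfn_sub1[OF _ that]) (auto simp: post_def ok_def intro!: dfn df1_app[OF F(1)] df1_app[OF G(1)])
  define Z where "Z = coll a (\<lambda>z. \<exists>Y. post Y \<and> z \<epsilon> Y)"
  have mZ: "z \<epsilon> Z \<longleftrightarrow> z \<epsilon> a \<and> (\<exists>Y. post Y \<and> z \<epsilon> Y)" for z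
    unfolding Z_def by (rule mem_coll) (intro dfn d)
  have mono: "ok Y z \<Longrightarrow> (\<And>u. u \<epsilon> Y \<Longrightarrow> u \<epsilon> Y') \<Longrightarrow> ok Y' z" for Y Y' z
    unfolding ok_def by blast
  have Z1: "ok Z z" if z: "z \<epsilon> Z" for z
  proof -
    obtain Y where Y: "post Y" "z \<epsilon> Y" using z mZ by blast
    have "u \<epsilon> Z" if "u \<epsilon> Y" for u using that Y unfolding mZ post_def by blast
    then show ?thesis using mono Y unfolding post_def by blast
  qed
  have Z2: "z \<epsilon> Z" if z: "z \<epsilon> a" "ok Z z" for z
  proof -
    have "post (ins z Z)" unfolding post_def
    proof (intro allI impI conjI)
      fix y assume y: "y \<epsilon> ins z Z"
      then show "y \<epsilon> a" using z mZ by (auto simp: mem_simps)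
      have "ok Z y" using y Z1 z by (auto simp: mem_simps)
      then show "ok (ins z Z) y" by (rule mono) (simp add: mem_simps)
    qed
    then show ?thesis using z mZ by (auto simp: mem_simps)
  qed
  \<comment> \<open>A point outside Z has a G-preimage that is not an F-value on Z, so the two
    halves of H have disjoint ranges.\<close>
  define H where "H x = (if x \<epsilon> Z then F x else the0 (\<lambda>w. w \<epsilon> b \<and> x = G w))" for x
  have dH: "df1 H" unfolding df1_def H_def by (intro dfn df1_app[OF F(1)] df1_app[OF G(1)])
  have H1: "H x = F x" if "x \<epsilon> Z" for x using that by (simp add: H_def)
  have H2: "H x \<epsilon> b \<and> x = G (H x) \<and> \<not> (\<exists>u. u \<epsilon> Z \<and> H x = F u)" if xa: "x \<epsilon> a" "\<not> x \<epsilon> Z" for x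
  proof -
    obtain w where w: "w \<epsilon> b" "x = G w" "\<not> (\<exists>u. u \<epsilon> Z \<and> w = F u)"
      using Z2[OF xa(1)] xa(2) unfolding ok_def by blast
    have "the0 (\<lambda>w. w \<epsilon> b \<and> x = G w) = w" by (rule the0_eq) (use w G(3) in auto)
    then have "H x = w" using xa by (simp add: H_def)
    then show ?thesis using w by simp
  qed
  have Hb: "H x \<epsilon> b" if "x \<epsilon> a" for x using that H1 H2 F(2) by (cases "x \<epsilon> Z") auto
  have Hinj: "u = v" if "u \<epsilon> a" "v \<epsilon> a" "H u = H v" for u v
    using that H1[of u] H1[of v] H2[of u] H2[of v] F(3)[of u v] by metis
  have Hsur: "\<exists>x. x \<epsilon> a \<and> H x = y" if y: "y \<epsilon> b" for y
  proof (cases "G y \<epsilon> Z")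
    case True
    then obtain u where "u \<epsilon> Z" "y = F u" using Z1[OF True] y unfolding ok_def by blast
    then show ?thesis using H1 mZ by blast
  next
    case False
    then have "H (G y) \<epsilon> b" "G y = G (H (G y))" using H2[OF G(2)[OF y]] by auto
    then show ?thesis using G(3)[OF y] G(2)[OF y] by metis
  qed
  have "bijection (lam H a) a b"
    unfolding bijection_def
  proof (intro conjI ballI)
    show "fun_into (lam H a) a b" using fun_into_lam[OF dH Hb] .
    fix y assume "y \<in> elts b"
    then obtain x where "x \<epsilon> a" "H x = y" using Hsur by (auto simp: mem_elts)
    then show "\<exists>!x. maps (lam H a) x y" unfolding maps_lam[OF dH] using Hinj by (intro ex1I[of _ x]) auto
  qed
  then show ?thesis unfolding equinumerous_def by blast
qed

lemma cardinal_not_lep: assumes "cardinal a" "x \<epsilon> a" shows "\<not> lep a x"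
proof
  assume "lep a x"
  moreover have "lep x a" using assms unfolding cardinal_def by (blast intro: lep_mem)
  ultimately have "equinumerous x a" using lep_antisym by blast
  then show False using assms unfolding cardinal_def by (auto simp: elts_def)
qed

text \<open>Recursion in which a stage sees the set of earlier values, the form suited to
  transfinite enumeration and to closing off a set.\<close>

lemma enumeration:
  assumes K: "df1 K"
  obtains F where "df1 F" "\<And>x. F x = K (im F x)"
proof -
  have "df1 (\<lambda>g. K (im sndv g))" unfolding df1_def by (intro dfn df1_app[OF K])
  then obtain F where F: "df1 F" "\<And>x. F x = K (im sndv (lam F x))" using recursion by blast
  have "im sndv (lam F x) = im F x" for x
    by (rule set_eqI) (auto simp: mem_im[OF df_sndv] mem_im[OF F(1)] mem_lam[OF F(1)])
  then show thesis using that F by simp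
qed

text \<open>Burali-Forti: if a contained every ordinal, the ordinals in a would themselves form an
  ordinal.\<close>

lemma not_all_ordinals: "\<exists>x. ordinal x \<and> \<not> x \<epsilon> a"
proof (rule ccontr)
  assume c: "\<not> ?thesis"
  have m: "x \<epsilon> coll a ordinal \<longleftrightarrow> ordinal x" for x
    using c by (subst mem_coll) (auto intro!: dfn)
  have "ordinal (coll a ordinal)" by (rule ordinalI) (auto simp: m intro: ordinal_mem)
  then show False using m mem_irrefl by blast
qed

definition rem :: "'v \<Rightarrow> 'v \<Rightarrow> 'v" where "rem Y s = coll Y (\<lambda>y. \<not> y \<epsilon> s)"

lemma dt_rem[dfn]: "dt t \<Longrightarrow> dt u \<Longrightarrow> dt (\<lambda>e. rem (t e) (u e))"
  by (rule dt_sub2) (auto simp: rem_def intro!: dfn)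

lemma mem_rem: "y \<epsilon> rem Y s \<longleftrightarrow> y \<epsilon> Y \<and> \<not> y \<epsilon> s"
  unfolding rem_def by (rule mem_coll) (intro dfn)

text \<open>F keeps choosing from what is left of Y. Were Y never exhausted, F would embed the
  ordinals into Y, and replacement along its inverse would collect all ordinals in a set.\<close>

theorem well_order:
  obtains \<rho> F where "ordinal \<rho>" "df1 F" "\<And>x. x \<epsilon> \<rho> \<Longrightarrow> F x \<epsilon> Y"
    "\<And>x y. x \<epsilon> \<rho> \<Longrightarrow> y \<epsilon> \<rho> \<Longrightarrow> F x = F y \<Longrightarrow> x = y" "\<And>y. y \<epsilon> Y \<Longrightarrow> \<exists>x. x \<epsilon> \<rho> \<and> F x = y"
proof -
  obtain c where c: "\<And>x. x \<epsilon> pow Y \<Longrightarrow> x \<noteq> emp \<Longrightarrow> app c x \<epsilon> x" using choice_function[of "pow Y"] by blast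
  have "df1 (\<lambda>s. app c (rem Y s))" unfolding df1_def by (intro dfn)
  then obtain F where F: "df1 F" "\<And>x. F x = app c (rem Y (im F x))" using enumeration by blast
  have F': "F x \<epsilon> Y \<and> \<not> F x \<epsilon> im F x" if "rem Y (im F x) \<noteq> emp" for x
    using c[of "rem Y (im F x)"] that F(2)[of x] by (auto simp: mem_pow mem_rem)
  have *: "\<exists>x. ordinal x \<and> rem Y (im F x) = emp"
  proof (rule ccontr)
    assume n: "\<not> ?thesis"
    have inj: "x = y" if "ordinal x" "ordinal y" "F x = F y" for x y
    proof -
      have "\<not> F x \<epsilon> im F x" "\<not> F y \<epsilon> im F y" using F' n that by blast+
      then have "\<not> x \<epsilon> y" "\<not> y \<epsilon> x" using that(3) mem_im[OF F(1)] by auto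
      then show ?thesis using ordinal_linear that by blast
    qed
    define g where "g y = the0 (\<lambda>x. ordinal x \<and> F x = y)" for y
    have dg: "df1 g" unfolding df1_def g_def by (intro dfn df1_app[OF F(1)])
    have "x \<epsilon> im g Y" if "ordinal x" for x
    proof -
      have "g (F x) = x" unfolding g_def by (rule the0_eq) (use that inj in auto)
      then show ?thesis using F'[of x] n that mem_im[OF dg] by metis
    qed
    then show False using not_all_ordinals by blast
  qed
  then obtain \<rho> where r: "ordinal \<rho>" "rem Y (im F \<rho>) = emp"
    "\<And>z. ordinal z \<Longrightarrow> rem Y (im F z) = emp \<Longrightarrow> elts \<rho> \<subseteq> elts z"
    by (elim exE conjE) (rule ordinal_least[of _ "\<lambda>x. rem Y (im F x) = emp"], blast+)
  have ne: "rem Y (im F x) \<noteq> emp" if "x \<epsilon> \<rho>" for x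
    using r(3)[of x] that ordinal_mem[OF r(1) that] mem_irrefl[of x] by (auto simp: elts_def)
  show thesis
  proof (rule that[OF r(1) F(1)])
    show "F x \<epsilon> Y" if "x \<epsilon> \<rho>" for x using F' ne that by blast
    show "x = y" if "x \<epsilon> \<rho>" "y \<epsilon> \<rho>" "F x = F y" for x y
    proof -
      have "\<not> F x \<epsilon> im F x" "\<not> F y \<epsilon> im F y" using F'[OF ne] that by blast+
      then have "\<not> x \<epsilon> y" "\<not> y \<epsilon> x" using that(3) mem_im[OF F(1)] by auto
      then show ?thesis using ordinal_linear ordinal_mem[OF r(1)] that by blast
    qed
    show "\<exists>x. x \<epsilon> \<rho> \<and> F x = y" if "y \<epsilon> Y" for y
    proof -
      have "y \<epsilon> im F \<rho>" using r(2) that unfolding emp_iff mem_rem by blast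
      then show ?thesis unfolding mem_im[OF F(1)] by blast
    qed
  qed
qed

text \<open>Always enumerating a new element of the lowest level that is not yet exhausted, one cannot be
  stuck inside a level that is too small, so everything is enumerated before stage \<open>\<theta>\<close>.\<close>

lemma greedy:
  assumes L: "df1 L" and \<rho>: "ordinal \<rho>" and \<theta>: "ordinal \<theta>"
    and cov: "\<And>y. y \<epsilon> Y \<Longrightarrow> \<exists>i. i \<epsilon> \<rho> \<and> y \<epsilon> L i"
    and mono: "\<And>i j x. i \<epsilon> j \<Longrightarrow> j \<epsilon> \<rho> \<Longrightarrow> x \<epsilon> L i \<Longrightarrow> x \<epsilon> L j"
    and small: "\<And>i. i \<epsilon> \<rho> \<Longrightarrow> \<not> lep \<theta> (L i)"
  shows "lep Y \<theta>"
proof -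
  obtain c where c: "\<And>x. x \<epsilon> pow (Un' (im L \<rho>)) \<Longrightarrow> x \<noteq> emp \<Longrightarrow> app c x \<epsilon> x"
    using choice_function[of "pow (Un' (im L \<rho>))"] by blast
  define I where "I s = least (\<lambda>i. i \<epsilon> \<rho> \<and> rem (L i) s \<noteq> emp)" for s
  have dI: "df1 I" unfolding df1_def I_def by (intro dfn df1_app[OF L])
  have "df1 (\<lambda>s. app c (rem (L (I s)) s))" unfolding df1_def by (intro dfn df1_app[OF L] df1_app[OF dI])
  then obtain F where F: "df1 F" "\<And>x. F x = app c (rem (L (I (im F x))) (im F x))"
    using enumeration by blast
  have step: "F x \<epsilon> L j \<and> \<not> F x \<epsilon> im F x" if j: "j \<epsilon> \<rho>" "rem (L j) (im F x) \<noteq> emp" for j x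
  proof -
    let ?i = "I (im F x)"
    let ?Q = "\<lambda>i. i \<epsilon> \<rho> \<and> rem (L i) (im F x) \<noteq> emp"
    have q: "ordinal j" "?Q j" using j ordinal_mem[OF \<rho>] by auto
    have i: "?i \<epsilon> \<rho>" "rem (L ?i) (im F x) \<noteq> emp" "elts ?i \<subseteq> elts j"
      using least_ordinal(2)[of j ?Q, OF q] least_ordinal(3)[of j ?Q j, OF q q] by (simp_all add: I_def)
    have "rem (L ?i) (im F x) \<epsilon> pow (Un' (im L \<rho>))"
      using i(1) by (auto simp: mem_simps mem_rem mem_im[OF L])
    then have "F x \<epsilon> rem (L ?i) (im F x)" using c i(2) F(2)[of x] by simp
    moreover have "?i = j \<or> ?i \<epsilon> j" using ordinal_subset[of ?i j] i j ordinal_mem[OF \<rho>] by blast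
    ultimately show ?thesis using mono[of ?i j] j by (auto simp: mem_rem)
  qed
  have "\<exists>x. x \<epsilon> \<theta> \<and> F x = y" if y: "y \<epsilon> Y" for y
  proof (rule ccontr)
    assume n: "\<not> ?thesis"
    obtain j where j: "j \<epsilon> \<rho>" "y \<epsilon> L j" using cov y by blast
    \<comment> \<open>Level j still contains y, so every stage before \<theta> picks a new element
      of L j, and \<theta> is embedded into L j.\<close>
    have ne: "rem (L j) (im F x) \<noteq> emp" if "x \<epsilon> \<theta>" for x
      using n j(2) that ordinal_trans[OF \<theta> that] unfolding emp_iff mem_rem mem_im[OF F(1)] by blast
    have "lep \<theta> (L j)"
    proof (rule lepI[OF F(1)])
      show "u = v" if "u \<epsilon> \<theta>" "v \<epsilon> \<theta>" "F u = F v" for u v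
      proof -
        have "\<not> F u \<epsilon> im F u" "\<not> F v \<epsilon> im F v" using step[OF j(1) ne] that by blast+
        then have "\<not> u \<epsilon> v" "\<not> v \<epsilon> u" using that(3) mem_im[OF F(1)] by auto
        then show ?thesis using ordinal_linear ordinal_mem[OF \<theta>] that by blast
      qed
    qed (use step[OF j(1) ne] in blast)
    then show False using small j by blast
  qed
  then show ?thesis by (rule lep_onto[OF F(1) \<theta>])
qed

text \<open>Well-foundedness makes the \<omega> of the model standard, so that \<open>finite\<close>
  of HOL can express finiteness in the model.\<close>

lemma omega_finite: assumes "is_omega w" shows "n \<epsilon> w \<Longrightarrow> finite (elts n)"
proof (induction n rule: wf_induct)
  case (step n)
  have w: "ordinal w" "\<not> limit_ordinal n" using assms step.prems
    unfolding is_omega_def limit_ordinal_def by (auto simp: elts_def)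
  then have n: "ordinal n" using ordinal_mem step.prems by blast
  show ?case
  proof (cases "n = emp")
    case False
    then obtain x where "x \<epsilon> n" unfolding emp_iff by blast
    then have "emp \<epsilon> n" using ordinal_emp_mem n by blast
    then obtain m where m: "m \<epsilon> n" "\<not> succ m \<epsilon> n" using n w(2) limit_ordinal_iff by blast
    have "ordinal m" using ordinal_mem n m by blast
    then have "elts n \<subseteq> insert m (elts m)"
      using ordinal_not_mem[OF ordinal_succ n, of m] m(2) unfolding subset_eq by (simp add: mem_elts mem_succ)
    moreover have "finite (elts m)" using step.IH[OF m(1)] m(1) step.prems ordinal_trans w(1) by blast
    ultimately show ?thesis using finite_subset by blast
  qed (simp add: elts_emp)
qed

lemma infinite_limit: assumes "limit_ordinal w" shows "infinite (elts w)"
proof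
  assume fin: "finite (elts w)"
  have w: "ordinal w" "emp \<epsilon> w" "\<And>x. x \<epsilon> w \<Longrightarrow> succ x \<epsilon> w" using assms limit_ordinal_iff by auto
  have "finite A \<Longrightarrow> A \<subseteq> elts w \<Longrightarrow> \<exists>z. z \<epsilon> w \<and> (\<forall>x\<in>A. x \<epsilon> z)" for A
  proof (induction A rule: finite_induct)
    case (insert a A)
    then obtain z where z: "z \<epsilon> w" "\<forall>x\<in>A. x \<epsilon> z" by auto
    have a: "a \<epsilon> w" using insert by (simp add: mem_elts)
    have o: "ordinal z" "ordinal (succ a)" using ordinal_mem w a z ordinal_succ by blast+
    have "succ a \<epsilon> w" using w a by blast
    then show ?case using z o mem_succ[of a a] ordinal_linear[OF o] ordinal_trans[of z] ordinal_trans[of "succ a"]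
      by (metis insert_iff)
  qed (use w in auto)
  from this[OF fin] show False using mem_irrefl by (metis mem_elts order_refl)
qed

lemma omega_iff_finite:
  assumes w: "is_omega w" and x: "ordinal x" shows "x \<epsilon> w \<longleftrightarrow> finite (elts x)"
proof
  assume "finite (elts x)"
  moreover have "infinite (elts w)" using infinite_limit w unfolding is_omega_def by blast
  moreover have "ordinal w" using w unfolding is_omega_def limit_ordinal_def by blast
  ultimately show "x \<epsilon> w" using ordinal_not_mem[OF x, of w] finite_subset by blast
qed (rule omega_finite[OF w])

end

section \<open>Cardinal arithmetic: powers, products, unions, and the effect of GCH\<close>

context zfc_model
begin

lemma lep_pow: assumes "lep x y" shows "lep (pow x) (pow y)"
proof -
  obtain F where F: "df1 F" "\<And>u. u \<epsilon> x \<Longrightarrow> F u \<epsilon> y"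
    "\<And>u v. u \<epsilon> x \<Longrightarrow> v \<epsilon> x \<Longrightarrow> F u = F v \<Longrightarrow> u = v" using lepE[OF assms] by metis
  show ?thesis
  proof (rule lepI[of "\<lambda>s. im F s"])
    show "df1 (im F)" unfolding df1_def by (intro dfn df1_app[OF F(1)])
    show "im F u \<epsilon> pow y" if "u \<epsilon> pow x" for u
      using that F(2) by (auto simp: mem_pow mem_im[OF F(1)])
    fix u v assume uv: "u \<epsilon> pow x" "v \<epsilon> pow x" "im F u = im F v"
    have *: "z \<epsilon> s \<longleftrightarrow> F z \<epsilon> im F s" if "s \<epsilon> pow x" "z \<epsilon> x" for s z
      using that F(3) unfolding mem_im[OF F(1)] mem_pow by metis
    show "u = v" using uv * unfolding mem_pow by (intro set_eqI) metis
  qed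
qed

lemma lep_prod': assumes "lep a c" "lep b d" shows "lep (prod' a b) (prod' c d)"
proof -
  obtain F where F: "df1 F" "\<And>u. u \<epsilon> a \<Longrightarrow> F u \<epsilon> c"
    "\<And>u v. u \<epsilon> a \<Longrightarrow> v \<epsilon> a \<Longrightarrow> F u = F v \<Longrightarrow> u = v" using lepE[OF assms(1)] by metis
  obtain G where G: "df1 G" "\<And>u. u \<epsilon> b \<Longrightarrow> G u \<epsilon> d"
    "\<And>u v. u \<epsilon> b \<Longrightarrow> v \<epsilon> b \<Longrightarrow> G u = G v \<Longrightarrow> u = v" using lepE[OF assms(2)] by metis
  show ?thesis
    by (rule lepI[of "\<lambda>z. pr (F (fstv z)) (G (sndv z))"])
      (use F G in \<open>auto simp: mem_prod' df1_def[of "\<lambda>z. pr (F (fstv z)) (G (sndv z))"]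
        intro!: dfn df1_app[OF F(1)] df1_app[OF G(1)]\<close>)
qed

lemma elts_prod': "elts (prod' a b) = (\<lambda>(x, y). pr x y) ` (elts a \<times> elts b)"
  by (auto simp: elts_def mem_prod')

lemma elts_pow: "elts (pow a) = {x. elts x \<subseteq> elts a}"
  by (auto simp: elts_def mem_pow)

lemma finite_pow: "finite (elts a) \<Longrightarrow> finite (elts (pow a))"
  unfolding elts_pow by (rule finite_imageD[of elts]) (auto intro: finite_subset[of _ "Pow (elts a)"] inj_onI extV)

lemma infinite_ordinal_omega:
  "is_omega w \<Longrightarrow> ordinal x \<Longrightarrow> infinite (elts x) \<longleftrightarrow> elts w \<subseteq> elts x"
  using omega_iff_finite[of w x] ordinal_not_mem[of x w] unfolding is_omega_def limit_ordinal_def by blast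

lemma omega_succ: "is_omega w \<Longrightarrow> x \<epsilon> w \<Longrightarrow> succ x \<epsilon> w" and omega_emp: "is_omega w \<Longrightarrow> emp \<epsilon> w"
  and omega_ordinal: "is_omega w \<Longrightarrow> ordinal w"
  unfolding is_omega_def limit_ordinal_iff by blast+

text \<open>Hilbert's hotel: the new point goes to 0 and \<omega> is shifted by one.\<close>

lemma lep_succ: assumes w: "is_omega w" and x: "ordinal x" "infinite (elts x)" shows "lep (succ x) x"
proof -
  have wx: "u \<epsilon> x" if "u \<epsilon> w" for u using infinite_ordinal_omega[OF w x(1)] x(2) that by (auto simp: elts_def)
  define F where "F u = (if u = x then emp else if u \<epsilon> w then succ u else u)" for u
  have s: "succ u \<noteq> emp" for u using mem_succ[of u u] not_mem_emp by metis
  have s2: "succ u = succ v \<Longrightarrow> u = v" for u v using mem_succ[of u u] mem_succ[of v v] mem_succ mem_asym by metis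
  have e: "emp \<epsilon> w" "\<And>u. u \<epsilon> w \<Longrightarrow> succ u \<epsilon> w" using omega_succ omega_emp w by blast+
  show ?thesis
  proof (rule lepI[of F])
    show "df1 F" unfolding df1_def F_def by (intro dfn)
    show "F u \<epsilon> x" if "u \<epsilon> succ x" for u using that wx e by (auto simp: F_def mem_succ)
    show "u = v" if "u \<epsilon> succ x" "v \<epsilon> succ x" "F u = F v" for u v
      using that s s2 e unfolding F_def mem_succ by (metis (full_types))
  qed
qed

text \<open>\<open>greedy\<close> with the levels \<open>(i + 1) \<times> (i + 1)\<close>, which are small by induction.\<close>

theorem lep_square:
  assumes w: "is_omega w" shows "ordinal \<xi> \<Longrightarrow> infinite (elts \<xi>) \<Longrightarrow> lep (prod' \<xi> \<xi>) \<xi>"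
proof (induction \<xi> rule: wf_induct)
  case (step \<xi>)
  show ?case
  proof (cases "\<exists>x. x \<epsilon> \<xi> \<and> lep \<xi> x")
    case True
    then obtain x where x: "x \<epsilon> \<xi>" "lep \<xi> x" by blast
    have "infinite (elts x)" using lep_finite[OF x(2)] step.prems by blast
    then have "lep (prod' x x) x" using step x ordinal_mem by blast
    then show ?thesis using lep_prod'[OF x(2) x(2)] lep_mem[OF step.prems(1) x(1)] lep_trans by blast
  next
    case False
    \<comment> \<open>An infinite \<xi> that embeds into no smaller ordinal is a limit, so the side
      \<open>succ i\<close> of a level is below \<xi> and the induction hypothesis covers
      it.\<close>
    have succ: "succ i \<epsilon> \<xi>" if i: "i \<epsilon> \<xi>" for i
    proof (rule ccontr)
      assume n: "\<not> succ i \<epsilon> \<xi>"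
      have o: "ordinal i" using ordinal_mem step.prems i by blast
      have "x \<epsilon> succ i" if "x \<epsilon> \<xi>" for x
        using n ordinal_not_mem[OF ordinal_succ[OF o] step.prems(1)] that by (auto simp: elts_def)
      then have l: "lep \<xi> (succ i)" by (rule lep_subset)
      then have "infinite (elts (succ i))" using lep_finite step.prems by blast
      then have "infinite (elts i)" unfolding succ_def elts_ins by simp
      then have "lep \<xi> i" using lep_succ[OF w o] l lep_trans by blast
      then show False using False i by blast
    qed
    show ?thesis
    proof (rule greedy[of "\<lambda>i. prod' (succ i) (succ i)" \<xi>])
      show "df1 (\<lambda>i. prod' (succ i) (succ i))" unfolding df1_def by (intro dfn)
      show "\<exists>i. i \<epsilon> \<xi> \<and> y \<epsilon> prod' (succ i) (succ i)" if y: "y \<epsilon> prod' \<xi> \<xi>" for y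
      proof -
        obtain a b where "a \<epsilon> \<xi>" "b \<epsilon> \<xi>" "y = pr a b" using y unfolding mem_prod' by blast
        then show ?thesis using ordinal_linear[of a b] ordinal_mem[OF step.prems(1)]
          by (auto simp: mem_succ)
      qed
      show "x \<epsilon> prod' (succ j) (succ j)" if "i \<epsilon> j" "j \<epsilon> \<xi>" "x \<epsilon> prod' (succ i) (succ i)" for i j x
        using that ordinal_trans[OF ordinal_mem[OF step.prems(1) that(2)]] by (auto simp: mem_prod' mem_succ)
      show "\<not> lep \<xi> (prod' (succ i) (succ i))" if i: "i \<epsilon> \<xi>" for i
      proof
        assume l: "lep \<xi> (prod' (succ i) (succ i))"
        then have "infinite (elts (prod' (succ i) (succ i)))" using lep_finite step.prems by blast
        then have "infinite (elts (succ i))" unfolding elts_prod' by blast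
        then have "lep (prod' (succ i) (succ i)) (succ i)"
          using step.IH[OF succ[OF i]] ordinal_mem[OF step.prems(1) succ[OF i]] by blast
        then show False using l lep_trans False succ[OF i] by blast
      qed
    qed (use step.prems in auto)
  qed
qed

lemma lep_un:
  assumes w: "is_omega w" and \<theta>: "ordinal \<theta>" "infinite (elts \<theta>)" and l: "lep a \<theta>" "lep b \<theta>"
  shows "lep (un a b) \<theta>"
proof -
  obtain F where F: "df1 F" "\<And>u. u \<epsilon> a \<Longrightarrow> F u \<epsilon> \<theta>"
    "\<And>u v. u \<epsilon> a \<Longrightarrow> v \<epsilon> a \<Longrightarrow> F u = F v \<Longrightarrow> u = v" using lepE[OF l(1)] by metis
  obtain G where G: "df1 G" "\<And>u. u \<epsilon> b \<Longrightarrow> G u \<epsilon> \<theta>"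
    "\<And>u v. u \<epsilon> b \<Longrightarrow> v \<epsilon> b \<Longrightarrow> G u = G v \<Longrightarrow> u = v" using lepE[OF l(2)] by metis
  have i: "emp \<epsilon> \<theta>" "succ emp \<epsilon> \<theta>" "succ emp \<noteq> emp"
    using infinite_ordinal_omega[OF w \<theta>(1)] \<theta>(2) omega_emp[OF w] omega_succ[OF w] not_mem_emp mem_succ[of emp emp]
    by (auto simp: elts_def)
  have "lep (un a b) (prod' \<theta> \<theta>)"
  proof (rule lepI[of "\<lambda>z. if z \<epsilon> a then pr (F z) emp else pr (G z) (succ emp)"])
    show "df1 (\<lambda>z. if z \<epsilon> a then pr (F z) emp else pr (G z) (succ emp))"
      unfolding df1_def by (intro dfn df1_app[OF F(1)] df1_app[OF G(1)])
  qed (use F G i in \<open>auto simp: mem_un split: if_splits\<close>)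
  then show ?thesis using lep_square[OF w \<theta>] lep_trans by blast
qed

text \<open>An element z is coded by the least G-value of an index x with z in B x, together with
  its image under an injection of B x into \<theta>; the injections are chosen simultaneously from
  the sets J x.\<close>

theorem lep_Union:
  assumes w: "is_omega w" and \<theta>: "ordinal \<theta>" "infinite (elts \<theta>)"
    and a: "lep a \<theta>" and B: "df1 B" "\<And>x. x \<epsilon> a \<Longrightarrow> lep (B x) \<theta>"
  shows "lep (Un' (im B a)) \<theta>"
proof -
  obtain G where G: "df1 G" "\<And>u. u \<epsilon> a \<Longrightarrow> G u \<epsilon> \<theta>"
    "\<And>u v. u \<epsilon> a \<Longrightarrow> v \<epsilon> a \<Longrightarrow> G u = G v \<Longrightarrow> u = v" using lepE[OF a] by metis
  define J where "J x = coll (pow (prod' (B x) \<theta>)) (\<lambda>f. injf f (B x) \<theta>)" for x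
  have dJ: "df1 J" unfolding df1_def J_def by (intro dfn df1_app[OF B(1)])
  have mJ: "f \<epsilon> J x \<longleftrightarrow> f \<epsilon> pow (prod' (B x) \<theta>) \<and> injf f (B x) \<theta>" for f x
    unfolding J_def by (rule mem_coll) (intro dfn)
  obtain c where c: "\<And>x. x \<epsilon> im J a \<Longrightarrow> x \<noteq> emp \<Longrightarrow> app c x \<epsilon> x" using choice_function[of "im J a"] by blast
  have h: "injf (app c (J x)) (B x) \<theta>" if "x \<epsilon> a" for x
  proof -
    have "J x \<noteq> emp" using lep_injf[OF B(2)[OF that]] mJ unfolding emp_iff by blast
    then show ?thesis using c[of "J x"] that mem_im[OF dJ] mJ by blast
  qed
  define I where "I z = least (\<lambda>i. \<exists>x. x \<epsilon> a \<and> z \<epsilon> B x \<and> G x = i)" for z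
  define X where "X i = the0 (\<lambda>x. x \<epsilon> a \<and> G x = i)" for i
  have dI: "df1 I" unfolding df1_def I_def by (intro dfn df1_app[OF B(1)] df1_app[OF G(1)])
  have dX: "df1 X" unfolding df1_def X_def by (intro dfn df1_app[OF G(1)])
  have XI: "X (I z) \<epsilon> a \<and> z \<epsilon> B (X (I z)) \<and> I z \<epsilon> \<theta>" if "z \<epsilon> Un' (im B a)" for z
  proof -
    obtain y where y: "y \<epsilon> a" "z \<epsilon> B y" using \<open>z \<epsilon> Un' (im B a)\<close> unfolding mem_Un' mem_im[OF B(1)] by blast
    have "\<exists>x. x \<epsilon> a \<and> z \<epsilon> B x \<and> G x = I z" unfolding I_def
      using least_ordinal(2)[of "G y" "\<lambda>i. \<exists>x. x \<epsilon> a \<and> z \<epsilon> B x \<and> G x = i"] y G(2)[OF y(1)] ordinal_mem[OF \<theta>(1)] by blast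
    then obtain x where x: "x \<epsilon> a" "z \<epsilon> B x" "G x = I z" by blast
    then have "X (I z) = x" unfolding X_def using G(3) by (intro the0_eq) auto
    then show ?thesis using x G(2)[OF x(1)] by simp
  qed
  have "lep (Un' (im B a)) (prod' \<theta> \<theta>)"
  proof (rule lepI[of "\<lambda>z. pr (I z) (app (app c (J (X (I z)))) z)"])
    show "df1 (\<lambda>z. pr (I z) (app (app c (J (X (I z)))) z))"
      unfolding df1_def by (intro dfn df1_app[OF dI] df1_app[OF dJ] df1_app[OF dX])
    show "pr (I u) (app (app c (J (X (I u)))) u) \<epsilon> prod' \<theta> \<theta>" if "u \<epsilon> Un' (im B a)" for u
      using XI[OF that] h[of "X (I u)"] unfolding injf_def by simp
    fix u v assume uv: "u \<epsilon> Un' (im B a)" "v \<epsilon> Un' (im B a)"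
      "pr (I u) (app (app c (J (X (I u)))) u) = pr (I v) (app (app c (J (X (I v)))) v)"
    then have e: "I u = I v" "app (app c (J (X (I v)))) u = app (app c (J (X (I v)))) v" by auto
    then show "u = v" using XI[OF uv(1)] XI[OF uv(2)] h[of "X (I v)"] unfolding injf_def by metis
  qed
  then show ?thesis using lep_square[OF w \<theta>] lep_trans by blast
qed

lemma lep_finite_ordinal:
  assumes w: "is_omega w" and "finite (elts x)" "ordinal \<theta>" "infinite (elts \<theta>)" shows "lep x \<theta>"
proof -
  obtain \<rho> F where r: "ordinal \<rho>" "df1 F" "\<And>u. u \<epsilon> \<rho> \<Longrightarrow> F u \<epsilon> x"
    "\<And>u v. u \<epsilon> \<rho> \<Longrightarrow> v \<epsilon> \<rho> \<Longrightarrow> F u = F v \<Longrightarrow> u = v" "\<And>y. y \<epsilon> x \<Longrightarrow> \<exists>u. u \<epsilon> \<rho> \<and> F u = y"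
    by (rule well_order[of x]) (rule that)
  have "lep \<rho> x" by (rule lepI[OF r(2-4)])
  then have "finite (elts \<rho>)" using lep_finite assms by blast
  then have "\<rho> \<epsilon> w" using omega_iff_finite w r by blast
  then have "\<rho> \<epsilon> \<theta>" using infinite_ordinal_omega[OF w] assms by (auto simp: elts_def)
  then have "lep \<rho> \<theta>" using lep_mem assms by blast
  moreover have "lep x \<rho>" by (rule lep_onto[OF r(2,1,5)])
  ultimately show ?thesis using lep_trans by blast
qed

lemma cardinal_least:
  assumes x: "ordinal x"
  obtains c where "cardinal c" "lep x c" "lep c x" "elts c \<subseteq> elts x"
proof -
  obtain c where c: "ordinal c" "lep x c" "\<And>z. ordinal z \<Longrightarrow> lep x z \<Longrightarrow> elts c \<subseteq> elts z"
    using ordinal_least[OF x, of "lep x"] lep_refl by metis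
  have "cardinal c" unfolding cardinal_def
  proof (intro conjI ballI notI)
    fix y assume y: "y \<in> elts c" "equinumerous y c"
    then have yc: "y \<epsilon> c" by (simp add: elts_def)
    have "lep x y" using lep_trans[OF c(2) equinumerous_lep(2)[OF y(2)]] .
    then have "elts c \<subseteq> elts y" using c(3)[of y] ordinal_mem[OF c(1) yc] by blast
    then show False using yc mem_irrefl by (auto simp: elts_def)
  qed (rule c)
  moreover have s: "elts c \<subseteq> elts x" using c(3)[OF x] lep_refl by blast
  moreover have "lep c x" using s by (intro lep_subset) (auto simp: elts_def)
  ultimately show thesis using that c by blast
qed

lemma infinite_cardinalI: "is_omega w \<Longrightarrow> cardinal a \<Longrightarrow> infinite (elts a) \<Longrightarrow> infinite_cardinal a"
  unfolding infinite_cardinal_def cardinal_def using infinite_ordinal_omega by blast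

lemma infinite_cardinalD:
  assumes "infinite_cardinal a" shows "cardinal a" "ordinal a" "infinite (elts a)"
  using assms infinite_ordinal_omega unfolding infinite_cardinal_def cardinal_def by blast+

text \<open>GCH speaks of successor cardinals. The cardinal M above \<theta> ensures that a least
  cardinal b above \<theta> exists, and bounds it.\<close>

lemma GCH_pow:
  assumes w: "is_omega w" and g: GCH and t: "infinite_cardinal \<theta>" and M: "cardinal M" "\<theta> \<epsilon> M"
  obtains b where "cardinal b" "\<theta> \<epsilon> b" "elts b \<subseteq> elts M" "lep (pow \<theta>) b"
    "\<And>x. x \<epsilon> b \<Longrightarrow> lep x \<theta>"
proof -
  have oM: "ordinal M" using M unfolding cardinal_def by blast
  obtain b where b: "ordinal b" "cardinal b \<and> \<theta> \<epsilon> b"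
    "\<And>z. ordinal z \<Longrightarrow> cardinal z \<and> \<theta> \<epsilon> z \<Longrightarrow> elts b \<subseteq> elts z"
    using ordinal_least[OF oM, of "\<lambda>b. cardinal b \<and> \<theta> \<epsilon> b"] M by metis
  have "successor_cardinal b \<theta>" unfolding successor_cardinal_def
    using b unfolding cardinal_def by blast
  moreover have "is_power (pow \<theta>) \<theta>" unfolding is_power_def by (auto simp: mem_pow elts_def)
  ultimately have "equinumerous (pow \<theta>) b" using g t unfolding GCH_def by blast
  moreover have "lep x \<theta>" if x: "x \<epsilon> b" for x
  proof -
    have ox: "ordinal x" using ordinal_mem b x by blast
    obtain c where c: "cardinal c" "lep x c" "lep c x" "elts c \<subseteq> elts x" using cardinal_least[OF ox] by blast
    have oc: "ordinal c" using c unfolding cardinal_def by blast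
    have cb: "c \<epsilon> b" using ordinal_subset[OF oc ox] c(4) x ordinal_trans[OF b(1)] by blast
    have "\<not> \<theta> \<epsilon> c" using b(3)[OF oc] c(1) cb mem_irrefl by (auto simp: elts_def)
    then have "elts c \<subseteq> elts \<theta>" using ordinal_not_mem infinite_cardinalD(2)[OF t] oc by blast
    then have "lep c \<theta>" by (intro lep_subset) (auto simp: elts_def)
    then show ?thesis using c lep_trans by blast
  qed
  ultimately show thesis using that[of b] b(2) b(3)[OF oM] M equinumerous_lep by blast
qed

text \<open>This is 2^{<k} \<le> k. For infinite x of cardinality c < k, GCH bounds the power set by
  the successor of c, which is at most k.\<close>

lemma pow_lep:
  assumes w: "is_omega w" and g: GCH and k: "infinite_cardinal k" and x: "x \<epsilon> k"
  shows "lep (pow x) k"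
proof -
  note kk = infinite_cardinalD[OF k]
  have ox: "ordinal x" using ordinal_mem kk x by blast
  show ?thesis
  proof (cases "finite (elts x)")
    case True
    then show ?thesis using lep_finite_ordinal[OF w finite_pow] kk by blast
  next
    case False
    obtain c where c: "cardinal c" "lep x c" "lep c x" "elts c \<subseteq> elts x" using cardinal_least[OF ox] by blast
    have oc: "ordinal c" using c unfolding cardinal_def by blast
    have ck: "c \<epsilon> k" using ordinal_subset[OF oc ox] c(4) x ordinal_trans[OF kk(2)] by blast
    have "infinite_cardinal c" using c False lep_finite infinite_cardinalI[OF w] by blast
    then obtain b where "elts b \<subseteq> elts k" "lep (pow c) b" using GCH_pow[OF w g _ kk(1) ck] by metis
    moreover from this have "lep b k" by (intro lep_subset) (auto simp: elts_def)
    ultimately show ?thesis using lep_trans lep_pow[OF c(2)] by blast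
  qed
qed

lemma cofinality_bounded:
  assumes cf: "cofinality a k" and a: "ordinal a" "emp \<epsilon> a" and n: "n \<epsilon> k" "lep d n"
    and F: "df1 F" "\<And>z. z \<epsilon> d \<Longrightarrow> F z \<epsilon> a"
  obtains x where "x \<epsilon> a" "\<And>z. z \<epsilon> d \<Longrightarrow> F z \<epsilon> x"
proof -
  obtain G where G: "df1 G" "\<And>u. u \<epsilon> d \<Longrightarrow> G u \<epsilon> n"
    "\<And>u v. u \<epsilon> d \<Longrightarrow> v \<epsilon> d \<Longrightarrow> G u = G v \<Longrightarrow> u = v" using lepE[OF n(2)] by metis
  define z where "z i = the0 (\<lambda>u. u \<epsilon> d \<and> G u = i)" for i
  have dz: "df1 z" unfolding df1_def z_def by (intro dfn df1_app[OF G(1)])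
  \<comment> \<open>F is moved from d to the ordinal n along G; indices outside the range of G get
    the dummy value \<open>emp\<close>, which must therefore belong to a.\<close>
  define H where "H i = (if z i \<epsilon> d then F (z i) else emp)" for i
  have dH: "df1 H" unfolding df1_def H_def by (intro dfn df1_app[OF F(1)] df1_app[OF dz])
  have "fun_into (lam H n) n a" by (rule fun_into_lam[OF dH]) (use F a in \<open>auto simp: H_def\<close>)
  moreover have "\<not> cofinal_function (lam H n) n a" using cf n unfolding cofinality_def by (auto simp: elts_def)
  ultimately obtain x where x: "x \<epsilon> a" "\<And>i y. maps (lam H n) i y \<Longrightarrow> \<not> (x = y \<or> x \<epsilon> y)"
    unfolding cofinal_function_def by (auto simp: mem_elts)
  have "F u \<epsilon> x" if u: "u \<epsilon> d" for u
  proof -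
    have "z (G u) = u" unfolding z_def using u G by (intro the0_eq) auto
    then have "maps (lam H n) (G u) (F u)" using G u by (simp add: maps_lam[OF dH] H_def)
    then show ?thesis using x(2) ordinal_linear[of x "F u"] ordinal_mem[OF a(1)] x(1) F(2)[OF u] by blast
  qed
  then show thesis using that x by blast
qed

definition small :: "'v \<Rightarrow> 'v \<Rightarrow> bool" where "small M x \<longleftrightarrow> (\<exists>n. n \<epsilon> M \<and> lep x n)"

lemma small_lep: "small M y \<Longrightarrow> lep x y \<Longrightarrow> small M x"
  unfolding small_def using lep_trans by blast

lemma small_subset: "small M y \<Longrightarrow> (\<And>u. u \<epsilon> x \<Longrightarrow> u \<epsilon> y) \<Longrightarrow> small M x"
  using small_lep lep_subset by blast

lemma infinite_cardinal_limit: "is_omega w \<Longrightarrow> infinite_cardinal M \<Longrightarrow> x \<epsilon> M \<Longrightarrow> succ x \<epsilon> M"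
proof (rule ccontr)
  assume w: "is_omega w" and M: "infinite_cardinal M" and x: "x \<epsilon> M" "\<not> succ x \<epsilon> M"
  note m = infinite_cardinalD[OF M]
  have ox: "ordinal x" using ordinal_mem m x by blast
  have "elts M \<subseteq> elts (succ x)" using ordinal_not_mem[OF ordinal_succ[OF ox] m(2)] x by blast
  then have l: "lep M (succ x)" by (intro lep_subset) (auto simp: elts_def)
  then have "infinite (elts (succ x))" using lep_finite m by blast
  then have "infinite (elts x)" unfolding succ_def elts_ins by simp
  then have "lep M x" using lep_succ[OF w ox] l lep_trans by blast
  then show False using cardinal_not_lep m x by blast
qed

lemma small_finite:
  assumes w: "is_omega w" and M: "infinite_cardinal M" and f: "finite (elts x)" shows "small M x"
proof -
  obtain \<rho> F where r: "ordinal \<rho>" "df1 F" "\<And>u. u \<epsilon> \<rho> \<Longrightarrow> F u \<epsilon> x"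
    "\<And>u v. u \<epsilon> \<rho> \<Longrightarrow> v \<epsilon> \<rho> \<Longrightarrow> F u = F v \<Longrightarrow> u = v" "\<And>z. z \<epsilon> x \<Longrightarrow> \<exists>u. u \<epsilon> \<rho> \<and> F u = z"
    by (rule well_order[of x]) (rule that)
  have "finite (elts \<rho>)" using lep_finite[OF lepI[OF r(2-4)] f] by blast
  then have "\<rho> \<epsilon> M"
    using omega_iff_finite[OF w r(1)] infinite_ordinal_omega[OF w] infinite_cardinalD[OF M] by (auto simp: elts_def)
  then show ?thesis unfolding small_def using lep_onto[OF r(2,1,5)] by blast
qed

lemma small_un:
  assumes w: "is_omega w" and M: "infinite_cardinal M" and s: "small M x" "small M y"
  shows "small M (un x y)"
proof -
  note m = infinite_cardinalD[OF M]
  obtain a b where a: "a \<epsilon> M" "lep x a" "b \<epsilon> M" "lep y b" using s unfolding small_def by blast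
  have o: "ordinal a" "ordinal b" using ordinal_mem m a by blast+
  define c where "c = un a b"
  have c: "c \<epsilon> M" "ordinal c"
  proof -
    show "ordinal c" unfolding c_def using ordinal_un o by blast
    have "c = a \<or> c = b" unfolding c_def
      using ordinal_linear[OF o]
    proof (elim disjE)
      assume "a \<epsilon> b"
      then have "un a b = b" using ordinal_trans[OF o(2)] by (intro set_eqI) (auto simp: mem_un)
      then show "un a b = a \<or> un a b = b" ..
    next
      assume "b \<epsilon> a"
      then have "un a b = a" using ordinal_trans[OF o(1)] by (intro set_eqI) (auto simp: mem_un)
      then show "un a b = a \<or> un a b = b" ..
    next
      assume "a = b"
      then have "un a b = a" by (intro set_eqI) (auto simp: mem_un)
      then show "un a b = a \<or> un a b = b" ..
    qed
    then show "c \<epsilon> M" using a by auto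
  qed
  have l: "lep x c" "lep y c" using lep_trans[OF a(2) lep_subset[of a c]] lep_trans[OF a(4) lep_subset[of b c]]
    by (auto simp: c_def mem_un)
  show ?thesis
  proof (cases "finite (elts c)")
    case True
    then have "finite (elts (un x y))" using l lep_finite unfolding elts_un by blast
    then show ?thesis by (rule small_finite[OF w M])
  next
    case False
    then show ?thesis unfolding small_def using lep_un[OF w c(2) _ l] c by blast
  qed
qed

text \<open>M is a strong limit: 2^\<theta> is the successor of \<theta>, which is below M because M
  has cofinality k \<le> \<theta> and so is not that successor.\<close>

theorem small_pow:
  assumes w: "is_omega w" and g: GCH and M: "infinite_cardinal M" "cofinality M k" "k \<epsilon> M" "infinite (elts k)"
    and s: "small M x"
  shows "small M (pow x)"
proof -
  note m = infinite_cardinalD[OF M(1)]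
  \<comment> \<open>Joining k to x makes the cardinal \<theta> found next infinite and at least the
    cofinality of M.\<close>
  have "small M (un x k)" using small_un[OF w M(1) s] M(3) lep_refl unfolding small_def by blast
  then obtain n where n: "n \<epsilon> M" "lep (un x k) n" unfolding small_def by blast
  have on: "ordinal n" using ordinal_mem m n by blast
  obtain \<theta> where t: "cardinal \<theta>" "lep n \<theta>" "elts \<theta> \<subseteq> elts n" using cardinal_least[OF on] by metis
  have ot: "ordinal \<theta>" using t unfolding cardinal_def by blast
  have l: "lep x \<theta>" "lep k \<theta>"
    using lep_trans[OF n(2) t(2)] lep_trans lep_subset[of x "un x k"] lep_subset[of k "un x k"]
    by (auto simp: mem_un)
  have it: "infinite (elts \<theta>)" using lep_finite l M(4) by blast
  have tM: "\<theta> \<epsilon> M" using ordinal_subset[OF ot on] t(3) n ordinal_trans[OF m(2)] by blast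
  obtain b where b: "cardinal b" "\<theta> \<epsilon> b" "elts b \<subseteq> elts M" "lep (pow \<theta>) b"
    "\<And>x. x \<epsilon> b \<Longrightarrow> lep x \<theta>"
    using GCH_pow[OF w g infinite_cardinalI[OF w t(1) it] m(1) tM] by metis
  have "b \<noteq> M"
  proof
    assume bM: "b = M"
    obtain f where f: "cofinal_function f k M" using M(2) unfolding cofinality_def by blast
    have fi: "fun_into f k M" using f unfolding cofinal_function_def by blast
    \<comment> \<open>If M were the successor of \<theta>, it would be the union of k sets B i of
      size at most \<theta>; \<open>succ\<close> puts the cofinal values themselves into that
      union.\<close>
    define B where "B i = succ (app f i)" for i
    have dB: "df1 B" unfolding df1_def B_def by (intro dfn)
    have "lep (Un' (im B k)) \<theta>"
    proof (rule lep_Union[OF w ot it l(2) dB])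
      fix i assume "i \<epsilon> k"
      then have "B i \<epsilon> M" unfolding B_def using fun_into_app[OF fi] infinite_cardinal_limit[OF w M(1)] by blast
      then show "lep (B i) \<theta>" using b(5) bM by blast
    qed
    moreover have "x \<epsilon> Un' (im B k)" if x: "x \<epsilon> M" for x
    proof -
      obtain i y where i: "maps f i y" "x = y \<or> x \<epsilon> y"
        using f x unfolding cofinal_function_def Ball_def mem_elts by blast
      have "i \<epsilon> k" using fun_on_dom i fi unfolding fun_into_def by blast
      moreover from this have "y = app f i" using i fi fun_on_app unfolding fun_into_def by blast
      ultimately show ?thesis using i by (auto simp: mem_Un' mem_im[OF dB] B_def mem_succ)
    qed
    ultimately have "lep M \<theta>" using lep_trans lep_subset by blast
    then show False using cardinal_not_lep[OF m(1) tM] by blast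
  qed
  then have "b \<epsilon> M" using ordinal_subset[OF _ m(2), of b] b unfolding cardinal_def by blast
  then show ?thesis unfolding small_def using lep_trans[OF lep_pow[OF l(1)] b(4)] by blast
qed

end

section \<open>Induction and recursion along transitive closures\<close>

context zfc_model
begin

lemma tc_induct[case_names step]: assumes "\<And>x. (\<And>y. y \<epsilon> tc x \<Longrightarrow> Q y) \<Longrightarrow> Q x" shows "Q x"
proof -
  have "\<forall>y. y \<epsilon> tc x \<longrightarrow> Q y" for x
  proof (induction x rule: wf_induct)
    case (step x)
    have "Q y" if "y \<epsilon> tc x" for y
      using tc_eq[of x] that step assms unfolding set_eq_iff by (auto simp: elts_def)
    then show ?case by blast
  qed
  then show ?thesis using assms by blast
qed

text \<open>The name s in a member \<open>pr s p\<close> of a name lies several levels below it, so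
  recursion on names must see the values on the whole transitive closure. The auxiliary K x is the
  table of F on x and its closure, and it can be built by recursion on elements.\<close>

theorem tc_recursion:
  assumes H: "df2 H"
  obtains F where "df1 F" "\<And>x. F x = H x (lam F (tc x))"
proof -
  \<comment> \<open>Here f consists of the tables of the elements of x: its domain returns x, and
    the union of its values is the table on tc x.\<close>
  define R where "R f = ins (pr (im fstv f) (H (im fstv f) (Un' (im sndv f)))) (Un' (im sndv f))" for f
  have "df1 R" unfolding df1_def R_def by (intro dfn df2_app[OF H])
  then obtain K where K: "df1 K" "\<And>x. K x = R (lam K x)" using recursion by blast
  define F where "F x = app (K x) x" for x
  have dF: "df1 F" unfolding df1_def F_def by (intro dfn df1_app[OF K(1)])
  have 1: "im fstv (lam K x) = x" for x
    by (rule set_eqI) (auto simp: mem_im[OF df_fstv] mem_lam[OF K(1)])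
  have 2: "im sndv (lam K x) = im K x" for x
    by (rule set_eqI) (auto simp: mem_im[OF df_sndv] mem_im[OF K(1)] mem_lam[OF K(1)])
  have Kx: "K x = ins (pr x (H x (Un' (im K x)))) (Un' (im K x))" for x
    using K(2)[of x] unfolding R_def 1 2 .
  have tcn: "\<not> x \<epsilon> tc x" for x
    by (induction x rule: tc_induct) (metis trans_tc tc_eq mem_tc mem_elts UN_E UnE)
  have "K x = lam F (ins x (tc x)) \<and> F x = H x (lam F (tc x))" for x
  proof (induction x rule: wf_induct)
    case (step x)
    have U: "Un' (im K x) = lam F (tc x)"
    proof (rule set_eqI)
      fix z
      have "z \<epsilon> Un' (im K x) \<longleftrightarrow> (\<exists>y. y \<epsilon> x \<and> z \<epsilon> lam F (ins y (tc y)))"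
        unfolding mem_Un' mem_im[OF K(1)] using step by auto
      also have "\<dots> \<longleftrightarrow> (\<exists>u. u \<epsilon> tc x \<and> z = pr u (F u))"
        unfolding mem_lam[OF dF] using tc_eq[of x] unfolding set_eq_iff by (auto simp: elts_def mem_ins)
      finally show "z \<epsilon> Un' (im K x) \<longleftrightarrow> z \<epsilon> lam F (tc x)" unfolding mem_lam[OF dF] .
    qed
    have "F x = H x (lam F (tc x))"
    proof -
      have "app (K x) x = H x (lam F (tc x))" unfolding app_def using tcn[of x]
        by (intro the0_eq) (auto simp: Kx[of x] U mem_ins mem_lam[OF dF])
      then show ?thesis by (simp only: F_def[of x])
    qed
    then show ?case unfolding Kx[of x] U
      by (auto intro!: set_eqI simp: mem_ins mem_lam[OF dF])
  qed
  then show thesis using that dF by blast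
qed

end

section \<open>Forcing\<close>

locale forcing = zfc_model mem + W: set_struct mem'
  for mem :: "'v \<Rightarrow> 'v \<Rightarrow> bool" (infix "\<epsilon>" 50) and mem' :: "'w \<Rightarrow> 'w \<Rightarrow> bool" (infix "\<epsilon>\<^sub>G" 50) +
  fixes P :: 'v and G :: "'v set" and val :: "'v \<Rightarrow> 'w"
  assumes generic: "generic P reverse_inclusion G" and emp_P: "emp \<epsilon> P"
    and ext': "W.extensional"
    and val: "name P t \<Longrightarrow> W.elts (val t) = {val s | s p z. z \<epsilon> t \<and> is_opair z s p \<and> p \<in> G}"
    and val_surj: "\<exists>t. name P t \<and> x = val t"
begin

named_theorems fc

definition le :: "'v \<Rightarrow> 'v \<Rightarrow> bool" where "le p q \<longleftrightarrow> (\<forall>z. z \<epsilon> q \<longrightarrow> z \<epsilon> p)"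

lemma reverse_inclusion_iff: "reverse_inclusion p q \<longleftrightarrow> le p q"
  unfolding reverse_inclusion_def le_def by (auto simp: elts_def)

lemma dfn_le[dfn]: "dt t \<Longrightarrow> dt u \<Longrightarrow> dfn (\<lambda>e. le (t e) (u e))"
  by (rule dfn_sub2) (auto simp: le_def intro!: dfn)

lemma le_refl: "le p p" and le_trans: "le p q \<Longrightarrow> le q r \<Longrightarrow> le p r" and le_emp: "le p emp"
  unfolding le_def by (auto simp: not_mem_emp)

lemma G_P: "p \<in> G \<Longrightarrow> p \<epsilon> P" using generic unfolding generic_def by (auto simp: elts_def)

lemma G_up: "p \<in> G \<Longrightarrow> q \<epsilon> P \<Longrightarrow> le p q \<Longrightarrow> q \<in> G"
  using generic unfolding generic_def reverse_inclusion_iff Ball_def mem_elts by blast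

lemma G_common: "p \<in> G \<Longrightarrow> q \<in> G \<Longrightarrow> \<exists>r\<in>G. le r p \<and> le r q"
  using generic unfolding generic_def reverse_inclusion_iff by blast

lemma emp_G: "emp \<in> G"
proof -
  obtain p where "p \<in> G" using generic unfolding generic_def by blast
  then show ?thesis using G_up[OF _ emp_P le_emp] by blast
qed

text \<open>The only use of genericity.\<close>

lemma dichotomy:
  assumes "dfn (\<lambda>e. B (e 0))"
  shows "(\<exists>p\<in>G. B p) \<or> (\<exists>p\<in>G. \<forall>q. q \<epsilon> P \<longrightarrow> le q p \<longrightarrow> \<not> B q)"
proof -
  define D where "D = coll P (\<lambda>p. B p \<or> (\<forall>q. q \<epsilon> P \<longrightarrow> le q p \<longrightarrow> \<not> B q))"
  have mD: "p \<epsilon> D \<longleftrightarrow> p \<epsilon> P \<and> (B p \<or> (\<forall>q. q \<epsilon> P \<longrightarrow> le q p \<longrightarrow> \<not> B q))" for p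
    unfolding D_def by (rule mem_coll) (intro dfn assms dfn_sub1[OF assms])
  have "dense P reverse_inclusion D"
    unfolding dense_def reverse_inclusion_iff subset_eq Ball_def Bex_def mem_elts mD
    using le_refl le_trans by blast
  then have "G \<inter> elts D \<noteq> {}" using generic unfolding generic_def by blast
  then obtain p where "p \<in> G" "p \<epsilon> D" by (auto simp: elts_def)
  then show ?thesis using mD by blast
qed

text \<open>Fo may be smaller than the forcing relation of Q: it must be closed under strengthening
  and be met by G exactly when Q holds. With this freedom an existential quantifier is taken inside
  Fo unchanged.\<close>

definition forces :: "('v \<Rightarrow> (nat \<Rightarrow> 'v) \<Rightarrow> bool) \<Rightarrow> ((nat \<Rightarrow> 'v) \<Rightarrow> bool) \<Rightarrow> bool" where
  "forces Fo Q \<longleftrightarrow> dfn (\<lambda>e. Fo (e 0) (\<lambda>n. e (Suc n))) \<and>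
     (\<forall>p q e. Fo p e \<longrightarrow> q \<epsilon> P \<longrightarrow> le q p \<longrightarrow> Fo q e) \<and> (\<forall>e. Q e \<longleftrightarrow> (\<exists>p\<in>G. Fo p e))"

text \<open>The relations on \<open>V\<close> that are definable over \<open>(V, G)\<close> are those with a definable forcing
  relation; for negation this is the dichotomy above.\<close>

definition fcb :: "((nat \<Rightarrow> 'v) \<Rightarrow> bool) \<Rightarrow> bool" where "fcb Q \<longleftrightarrow> (\<exists>Fo. forces Fo Q)"

lemma fcbI:
  assumes "dfn (\<lambda>e. Fo (e 0) (\<lambda>n. e (Suc n)))"
    "\<And>p q e. Fo p e \<Longrightarrow> q \<epsilon> P \<Longrightarrow> le q p \<Longrightarrow> Fo q e" "\<And>e. Q e \<longleftrightarrow> (\<exists>p\<in>G. Fo p e)"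
  shows "fcb Q"
  unfolding fcb_def forces_def by (rule exI[of _ Fo]) (use assms in blast)

lemma fcbE:
  assumes "fcb Q"
  obtains Fo where "dfn (\<lambda>e. Fo (e 0) (\<lambda>n. e (Suc n)))"
    "\<And>p q e. Fo p e \<Longrightarrow> q \<epsilon> P \<Longrightarrow> le q p \<Longrightarrow> Fo q e" "\<And>e. Q e \<longleftrightarrow> (\<exists>p\<in>G. Fo p e)"
proof -
  obtain Fo where f: "forces Fo Q" using assms unfolding fcb_def by blast
  from f have a: "dfn (\<lambda>e. Fo (e 0) (\<lambda>n. e (Suc n)))" unfolding forces_def by (elim conjE)
  from f have b: "\<forall>p q e. Fo p e \<longrightarrow> q \<epsilon> P \<longrightarrow> le q p \<longrightarrow> Fo q e" unfolding forces_def by (elim conjE)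
  from f have c: "\<forall>e. Q e \<longleftrightarrow> (\<exists>p\<in>G. Fo p e)" unfolding forces_def by (elim conjE)
  show thesis by (rule that[OF a b[rule_format] c[rule_format]])
qed

lemma fc_dfn: assumes "dfn Q" shows "fcb Q"
  by (rule fcbI[of "\<lambda>p. Q"]) (use dfn_rename[OF assms, of Suc] emp_G in auto)

lemma fc_mem[fc]: "dt t \<Longrightarrow> dt u \<Longrightarrow> fcb (\<lambda>e. t e \<epsilon> u e)" by (rule fc_dfn, rule dfn_mem)
lemma fc_eq[fc]: "dt t \<Longrightarrow> dt u \<Longrightarrow> fcb (\<lambda>e. t e = u e)" by (rule fc_dfn, rule dfn_eq)

lemma fc_G[fc]: assumes "dt t" shows "fcb (\<lambda>e. t e \<in> G)"
proof (rule fcbI[of "\<lambda>p e. t e \<epsilon> P \<and> le p (t e)"])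
  show "dfn (\<lambda>e. t (\<lambda>n. e (Suc n)) \<epsilon> P \<and> le (e 0) (t (\<lambda>n. e (Suc n))))"
    by (intro dfn dt_shift[OF assms, of Suc])
  show "t e \<in> G \<longleftrightarrow> (\<exists>p\<in>G. t e \<epsilon> P \<and> le p (t e))" for e
    using G_up G_P le_refl by blast
qed (use le_trans in blast)

lemma fc_neg[fc]: assumes "fcb Q" shows "fcb (\<lambda>e. \<not> Q e)"
proof -
  obtain Fo where F: "dfn (\<lambda>e. Fo (e 0) (\<lambda>n. e (Suc n)))"
    "\<And>p q e. Fo p e \<Longrightarrow> q \<epsilon> P \<Longrightarrow> le q p \<Longrightarrow> Fo q e" "\<And>e. Q e \<longleftrightarrow> (\<exists>p\<in>G. Fo p e)"
    by (rule fcbE[OF assms]) (rule that)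
  show ?thesis
  proof (rule fcbI[of "\<lambda>p e. \<forall>q. q \<epsilon> P \<longrightarrow> le q p \<longrightarrow> \<not> Fo q e"])
    show "dfn (\<lambda>e. \<forall>q. q \<epsilon> P \<longrightarrow> le q (e 0) \<longrightarrow> \<not> Fo q (\<lambda>n. e (Suc n)))"
      by (intro dfn dfn_swap_under[OF F(1)])
    show "\<not> Q e \<longleftrightarrow> (\<exists>p\<in>G. \<forall>q. q \<epsilon> P \<longrightarrow> le q p \<longrightarrow> \<not> Fo q e)" for e
    proof
      assume "\<not> Q e"
      then show "\<exists>p\<in>G. \<forall>q. q \<epsilon> P \<longrightarrow> le q p \<longrightarrow> \<not> Fo q e"
        using dichotomy[OF dfn_inst[OF F(1)], of e] F(3) by blast
    next
      assume "\<exists>p\<in>G. \<forall>q. q \<epsilon> P \<longrightarrow> le q p \<longrightarrow> \<not> Fo q e"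
      then show "\<not> Q e" using F(2,3) G_common G_P by metis
    qed
  qed (use le_trans in blast)
qed

lemma fc_conj[fc]: assumes "fcb Q" "fcb R" shows "fcb (\<lambda>e. Q e \<and> R e)"
proof -
  obtain Fo where F: "dfn (\<lambda>e. Fo (e 0) (\<lambda>n. e (Suc n)))"
    "\<And>p q e. Fo p e \<Longrightarrow> q \<epsilon> P \<Longrightarrow> le q p \<Longrightarrow> Fo q e" "\<And>e. Q e \<longleftrightarrow> (\<exists>p\<in>G. Fo p e)"
    by (rule fcbE[OF assms(1)]) (rule that)
  obtain Fo' where F': "dfn (\<lambda>e. Fo' (e 0) (\<lambda>n. e (Suc n)))"
    "\<And>p q e. Fo' p e \<Longrightarrow> q \<epsilon> P \<Longrightarrow> le q p \<Longrightarrow> Fo' q e" "\<And>e. R e \<longleftrightarrow> (\<exists>p\<in>G. Fo' p e)"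
    by (rule fcbE[OF assms(2)]) (rule that)
  show ?thesis
  proof (rule fcbI[of "\<lambda>p e. Fo p e \<and> Fo' p e"])
    show "dfn (\<lambda>e. Fo (e 0) (\<lambda>n. e (Suc n)) \<and> Fo' (e 0) (\<lambda>n. e (Suc n)))"
      by (intro dfn F(1) F'(1))
    show "Q e \<and> R e \<longleftrightarrow> (\<exists>p\<in>G. Fo p e \<and> Fo' p e)" for e
      unfolding F(3) F'(3) using G_common G_P F(2) F'(2) by metis
  qed (use F(2) F'(2) in blast)
qed

lemma fc_ex[fc]:
  assumes "fcb (\<lambda>e. Q (e 0) (\<lambda>n. e (Suc n)))" shows "fcb (\<lambda>e. \<exists>x. Q x e)"
proof -
  obtain Fo where F: "dfn (\<lambda>e. Fo (e 0) (\<lambda>n. e (Suc n)))"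
    "\<And>p q e. Fo p e \<Longrightarrow> q \<epsilon> P \<Longrightarrow> le q p \<Longrightarrow> Fo q e"
    "\<And>e. Q (e 0) (\<lambda>n. e (Suc n)) \<longleftrightarrow> (\<exists>p\<in>G. Fo p e)"
    by (rule fcbE[OF assms]) (rule that)
  show ?thesis
  proof (rule fcbI[of "\<lambda>p e. \<exists>x. Fo p (case_nat x e)"])
    have "Fo (e 1) (\<lambda>n. e (case Suc n of 0 \<Rightarrow> 1 | Suc 0 \<Rightarrow> 0 | Suc (Suc n) \<Rightarrow> Suc (Suc n))) =
        Fo (e 1) (case_nat (e 0) (\<lambda>n. e (Suc (Suc n))))" for e
      by (rule arg_cong[of _ _ "Fo (e 1)"]) (auto split: nat.split)
    \<comment> \<open>The renaming exchanges the condition with the witness, which is to be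
      bound.\<close>
    then have "dfn (\<lambda>e. Fo (e 1) (case_nat (e 0) (\<lambda>n. e (Suc (Suc n)))))"
      using dfn_rename[OF F(1), of "\<lambda>n. case n of 0 \<Rightarrow> 1 | Suc 0 \<Rightarrow> 0 | Suc (Suc n) \<Rightarrow> Suc (Suc n)"]
      by simp
    then show "dfn (\<lambda>e. \<exists>x. Fo (e 0) (case_nat x (\<lambda>n. e (Suc n))))"
      by (intro dfn) simp
    show "(\<exists>x. Q x e) \<longleftrightarrow> (\<exists>p\<in>G. \<exists>x. Fo p (case_nat x e))" for e
    proof -
      have "Q x e \<longleftrightarrow> (\<exists>p\<in>G. Fo p (case_nat x e))" for x using F(3)[of "case_nat x e"] by simp
      then show ?thesis by blast
    qed
  qed (use F(2) in blast)
qed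

lemma fc_disj[fc]: "fcb Q \<Longrightarrow> fcb R \<Longrightarrow> fcb (\<lambda>e. Q e \<or> R e)"
  unfolding disj_conv_conj by (rule fc_neg, rule fc_conj; rule fc_neg)
lemma fc_imp[fc]: "fcb Q \<Longrightarrow> fcb R \<Longrightarrow> fcb (\<lambda>e. Q e \<longrightarrow> R e)"
  unfolding imp_conv_disj by (rule fc_disj, rule fc_neg)
lemma fc_iff[fc]: "fcb Q \<Longrightarrow> fcb R \<Longrightarrow> fcb (\<lambda>e. Q e \<longleftrightarrow> R e)"
  unfolding iff_conv_conj_imp by (rule fc_conj; rule fc_imp)
lemma fc_all[fc]: "fcb (\<lambda>e. Q (e 0) (\<lambda>n. e (Suc n))) \<Longrightarrow> fcb (\<lambda>e. \<forall>x. Q x e)"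
  using fc_neg[OF fc_ex[of "\<lambda>x e. \<not> Q x e", OF fc_neg]] by simp

lemma fc_sub: assumes "fcb (\<lambda>e. Q (e 0) (\<lambda>n. e (Suc n)))" "dt t" shows "fcb (\<lambda>e. Q (t e) e)"
proof -
  have "fcb (\<lambda>e. e 0 = t (\<lambda>n. e (Suc n)))" using assms(2) unfolding dt_def by (rule fc_dfn)
  then have "fcb (\<lambda>e. \<exists>x. x = t e \<and> Q x e)" using assms(1) by (intro fc_ex fc_conj)
  then show ?thesis by simp
qed

lemma fc_sub2:
  assumes "fcb (\<lambda>e. Q (e 0) (e 1))" "dt t" "dt u" shows "fcb (\<lambda>e. Q (t e) (u e))"
proof -
  have 1: "fcb (\<lambda>e. Q (t (\<lambda>n. e (Suc n))) (e 0))"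
    using fc_sub[of "\<lambda>x e. Q x (e 0)", OF _ dt_shift[OF assms(2), of Suc]] assms(1) by simp
  show ?thesis using fc_sub[of "\<lambda>x e. Q (t e) x", OF 1 assms(3)] .
qed

lemma fc_sub3:
  assumes "fcb (\<lambda>e. Q (e 0) (e 1) (e 2))" "dt t" "dt u" "dt v"
  shows "fcb (\<lambda>e. Q (t e) (u e) (v e))"
proof -
  have 0: "fcb (\<lambda>e. Q (e 0) (e (Suc 0)) (e (Suc (Suc 0))))"
    using assms(1) by (simp add: numeral_2_eq_2)
  have 1: "fcb (\<lambda>e. Q (t (\<lambda>n. e (Suc (Suc n)))) (e 0) (e 1))"
    using fc_sub[of "\<lambda>x e. Q x (e 0) (e 1)", OF _ dt_shift[OF assms(2), of "\<lambda>n. Suc (Suc n)"]] 0 by simp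
  have 2: "fcb (\<lambda>e. Q (t (\<lambda>n. e (Suc n))) (u (\<lambda>n. e (Suc n))) (e 0))"
    using fc_sub[of "\<lambda>x e. Q (t (\<lambda>n. e (Suc n))) x (e 0)", OF _ dt_shift[OF assms(3), of Suc]] 1 by simp
  show ?thesis using fc_sub[of "\<lambda>x e. Q (t e) (u e) x", OF 2 assms(4)] .
qed

section \<open>Names and their values, seen from inside the model\<close>

lemma pr_tc: "pr s p \<epsilon> x \<Longrightarrow> s \<epsilon> tc x"
  using mem_tc[of "pr s p" x] trans_tc[of "pr s p" x "sing s"] trans_tc[of "sing s" x s]
  unfolding pr_def by (auto simp: mem_simps)

lemma name_iff: "name P t \<longleftrightarrow> (\<forall>z. z \<epsilon> t \<longrightarrow> (\<exists>s p. z = pr s p \<and> name P s \<and> p \<epsilon> P))"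
  by (subst name.simps) (simp add: is_opair_fun)

text \<open>Being a name is an inductive notion of the metatheory; recursion defines its
  characteristic function inside the model, with \<open>succ emp\<close> for true.\<close>

lemma name_definable: obtains c where "df1 c" "\<And>t. name P t \<longleftrightarrow> c t = succ emp"
proof -
  define H where "H x g = (if \<forall>z. z \<epsilon> x \<longrightarrow> (\<exists>s p. z = pr s p \<and> p \<epsilon> P \<and> app g s = succ emp)
    then succ emp else emp)" for x g
  have "df2 H" unfolding df2_def H_def by (intro dfn)
  then obtain c where c: "df1 c" "\<And>x. c x = H x (lam c (tc x))" using tc_recursion by blast
  have s: "succ emp \<noteq> emp" using mem_succ[of emp emp] not_mem_emp by metis
  have cx: "c x = succ emp \<longleftrightarrow> (\<forall>z. z \<epsilon> x \<longrightarrow> (\<exists>s p. z = pr s p \<and> p \<epsilon> P \<and> c s = succ emp))" for x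
  proof -
    have "app (lam c (tc x)) s = c s" if "pr s p \<epsilon> x" for s p
      using app_lam[OF c(1)] pr_tc[OF that] by blast
    then show ?thesis using s c(2)[of x] unfolding H_def by (metis (no_types, lifting))
  qed
  have "name P t \<longleftrightarrow> c t = succ emp" for t
  proof (induction t rule: tc_induct)
    case (step t)
    then have "name P s \<longleftrightarrow> c s = succ emp" if "pr s p \<epsilon> t" for s p using pr_tc[OF that] by blast
    then show ?case unfolding cx[of t] name_iff[of t] by blast
  qed
  then show thesis using that c by blast
qed

lemma dfn_name[dfn]: "dt t \<Longrightarrow> dfn (\<lambda>e. name P (t e))"
proof -
  obtain c where c: "df1 c" "\<And>t. name P t \<longleftrightarrow> c t = succ emp" using name_definable by blast
  show "dt t \<Longrightarrow> ?thesis" unfolding c(2) by (intro dfn df1_app[OF c(1)])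
qed

lemma name_emp: "name P emp" by (subst name_iff) (simp add: not_mem_emp)

text \<open>Extending the valuation to all of \<open>V\<close> turns quantifiers over \<open>V[G]\<close> into quantifiers over \<open>V\<close>.\<close>

definition nm :: "'v \<Rightarrow> 'v" where "nm t = (if name P t then t else emp)"
definition V :: "'v \<Rightarrow> 'w" where "V t = val (nm t)"

lemma df_nm: "df1 nm" unfolding df1_def nm_def by (intro dfn)
lemmas dt_nm[dfn] = df1_app[OF df_nm]

lemma nm_name: "name P (nm t)" unfolding nm_def using name_emp by simp
lemma nm_nm: "nm (nm t) = nm t" unfolding nm_def by simp
lemma V_nm: "V (nm t) = V t" unfolding V_def nm_nm ..

lemma nm_memE: assumes "z \<epsilon> nm t" obtains s p where "z = pr s p" "nm s = s" "p \<epsilon> P" "s \<epsilon> tc t"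
proof -
  obtain s p where s: "z = pr s p" "name P s" "p \<epsilon> P"
    using nm_name[of t] assms unfolding name_iff[of "nm t"] by blast
  have "z \<epsilon> t" using assms not_mem_emp unfolding nm_def by (auto split: if_splits)
  then show thesis using that[of s p] s pr_tc[of s p t] by (simp add: nm_def)
qed

lemma nm_tc: "pr s p \<epsilon> nm t \<Longrightarrow> s \<epsilon> tc t" and nm_P: "pr s p \<epsilon> nm t \<Longrightarrow> p \<epsilon> P"
  by (elim nm_memE, simp)+

lemma mem_V: "x \<epsilon>\<^sub>G V t \<longleftrightarrow> (\<exists>s p. pr s p \<epsilon> nm t \<and> p \<in> G \<and> x = V s)"
proof -
  have "x \<epsilon>\<^sub>G V t \<longleftrightarrow> (\<exists>s p. pr s p \<epsilon> nm t \<and> p \<in> G \<and> x = val s)"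
    using val[OF nm_name, of t] unfolding V_def W.elts_def is_opair_fun by blast
  also have "\<dots> \<longleftrightarrow> (\<exists>s p. pr s p \<epsilon> nm t \<and> p \<in> G \<and> x = V s)"
    unfolding V_def by (metis nm_memE pr_inject)
  finally show ?thesis .
qed

lemma V_surj: obtains t where "x = V t"
proof -
  obtain t where "name P t" "x = val t" using val_surj by blast
  then show thesis using that[of t] by (simp add: V_def nm_def)
qed

lemma ext'I: "(\<And>z. z \<epsilon>\<^sub>G x \<longleftrightarrow> z \<epsilon>\<^sub>G y) \<Longrightarrow> x = y"
  using ext' unfolding W.extensional_def W.elts_def by blast

text \<open>\<open>Feq p s t\<close> is \<open>p \<tturnstile> s = t\<close>, given as the greatest bisimulation.  Being coinductive, it is
  definable without a recursion on names.\<close>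

definition half :: "('v \<Rightarrow> 'v \<Rightarrow> 'v \<Rightarrow> bool) \<Rightarrow> 'v \<Rightarrow> 'v \<Rightarrow> 'v \<Rightarrow> bool" where
  "half R p s t \<longleftrightarrow> (\<forall>u q r. pr u q \<epsilon> nm s \<longrightarrow> r \<epsilon> P \<longrightarrow> le r p \<longrightarrow> le r q \<longrightarrow>
     (\<exists>r' v q'. r' \<epsilon> P \<and> le r' r \<and> le r' q' \<and> pr v q' \<epsilon> nm t \<and> R r' u v))"

definition bis :: "'v \<Rightarrow> bool" where
  "bis X \<longleftrightarrow> (\<forall>p s t. pr p (pr s t) \<epsilon> X \<longrightarrow>
     half (\<lambda>p s t. pr p (pr s t) \<epsilon> X) p s t \<and> half (\<lambda>p t s. pr p (pr s t) \<epsilon> X) p t s)"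

definition Feq :: "'v \<Rightarrow> 'v \<Rightarrow> 'v \<Rightarrow> bool" where
  "Feq p s t \<longleftrightarrow> (\<exists>X. bis X \<and> pr p (pr s t) \<epsilon> X)"

lemma dfn_bis[dfn]: "dt t \<Longrightarrow> dfn (\<lambda>e. bis (t e))"
  by (rule dfn_sub1) (auto simp: bis_def half_def intro!: dfn)

lemma dfn_Feq[dfn]: "dt t \<Longrightarrow> dt u \<Longrightarrow> dt v \<Longrightarrow> dfn (\<lambda>e. Feq (t e) (u e) (v e))"
  by (rule dfn_sub3) (auto simp: Feq_def intro!: dfn)

lemma half_mono: "half R p s t \<Longrightarrow> (\<And>p u v q q'. pr u q \<epsilon> nm s \<Longrightarrow> pr v q' \<epsilon> nm t \<Longrightarrow> p \<epsilon> P \<Longrightarrow> R p u v \<Longrightarrow> R' p u v) \<Longrightarrow> half R' p s t"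
  unfolding half_def by blast

text \<open>A bisimulation remains one when a triple with a stronger condition is added, since
  \<open>half\<close> quantifies over the conditions below.\<close>

lemma Feq_mono: assumes "Feq p s t" "q \<epsilon> P" "le q p" shows "Feq q s t"
proof -
  obtain X where X: "bis X" "pr p (pr s t) \<epsilon> X" using assms(1) unfolding Feq_def by blast
  have "bis (ins (pr q (pr s t)) X)" unfolding bis_def
  proof (intro allI impI)
    fix p' s' t' assume "pr p' (pr s' t') \<epsilon> ins (pr q (pr s t)) X"
    then consider "p' = q" "s' = s" "t' = t" | "pr p' (pr s' t') \<epsilon> X" by (auto simp: mem_ins)
    then have "half (\<lambda>p s t. pr p (pr s t) \<epsilon> X) p' s' t' \<and> half (\<lambda>p t s. pr p (pr s t) \<epsilon> X) p' t' s'"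
    proof cases
      case 1
      have "half (\<lambda>p s t. pr p (pr s t) \<epsilon> X) p s t \<and> half (\<lambda>p t s. pr p (pr s t) \<epsilon> X) p t s"
        using X unfolding bis_def by blast
      then show ?thesis unfolding 1 half_def using le_trans assms(3) by blast
    qed (use X in \<open>auto simp: bis_def\<close>)
    then show "half (\<lambda>p s' t'. pr p (pr s' t') \<epsilon> ins (pr q (pr s t)) X) p' s' t' \<and>
      half (\<lambda>p t' s'. pr p (pr s' t') \<epsilon> ins (pr q (pr s t)) X) p' t' s'"
      by (elim conjE, intro conjI) (erule half_mono, simp add: mem_ins)+
  qed
  then show ?thesis unfolding Feq_def by (metis mem_ins)
qed

lemma Feq_unfold: "Feq p s t \<Longrightarrow> half Feq p s t \<and> half (\<lambda>p t s. Feq p s t) p t s"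
  unfolding Feq_def bis_def half_def by blast

text \<open>\<open>Feq\<close> ranges over all names, whereas a bisimulation has to be a set; so
  \<open>Feq\<close> is cut down to a transitive set T that contains s and t and hence all names
  occurring in them.\<close>

lemma Feq_intro: assumes h: "half Feq p s t" "half (\<lambda>p t s. Feq p s t) p t s" shows "Feq p s t"
proof -
  define T where "T = tc (up s t)"
  have T: "s \<epsilon> T" "t \<epsilon> T" "\<And>u v. u \<epsilon> T \<Longrightarrow> v \<epsilon> tc u \<Longrightarrow> v \<epsilon> T"
  proof -
    show "s \<epsilon> T" "t \<epsilon> T" using mem_tc by (auto simp: T_def mem_up)
    have "elts (tc u) \<subseteq> elts T" if "u \<epsilon> T" for u
    proof -
      have "transitive T" using tc_props unfolding T_def is_tc_def by blast
      moreover have "elts u \<subseteq> elts T" using that \<open>transitive T\<close> unfolding transitive_def by (auto simp: elts_def)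
      ultimately show ?thesis using tc_props[of u] unfolding is_tc_def by blast
    qed
    then show "\<And>u v. u \<epsilon> T \<Longrightarrow> v \<epsilon> tc u \<Longrightarrow> v \<epsilon> T" by (auto simp: elts_def)
  qed
  define X where "X = coll (prod' P (prod' T T)) (\<lambda>z. Feq (fstv z) (fstv (sndv z)) (sndv (sndv z)))"
  have mX: "pr p (pr s t) \<epsilon> X \<longleftrightarrow> p \<epsilon> P \<and> s \<epsilon> T \<and> t \<epsilon> T \<and> Feq p s t" for p s t
    unfolding X_def by (subst mem_coll) (auto intro!: dfn)
  let ?Y = "ins (pr p (pr s t)) X"
  have "bis ?Y" unfolding bis_def
  proof (intro allI impI)
    fix p' s' t' assume "pr p' (pr s' t') \<epsilon> ?Y"
    then have a: "s' \<epsilon> T" "t' \<epsilon> T" "half Feq p' s' t'" "half (\<lambda>p t s. Feq p s t) p' t' s'"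
      using h T(1,2) Feq_unfold by (auto simp: mem_ins mX)
    have b: "pr r (pr u v) \<epsilon> ?Y" if "pr u q \<epsilon> nm s'" "pr v q' \<epsilon> nm t'" "r \<epsilon> P" "Feq r u v" for r u v q q'
      using that nm_tc T(3)[OF a(1)] T(3)[OF a(2)] by (auto simp: mem_ins mX)
    show "half (\<lambda>p s' t'. pr p (pr s' t') \<epsilon> ?Y) p' s' t' \<and> half (\<lambda>p t' s'. pr p (pr s' t') \<epsilon> ?Y) p' t' s'"
      by (intro conjI; rule half_mono[OF a(3)] half_mono[OF a(4)]; rule b)
  qed
  then show ?thesis unfolding Feq_def by (metis mem_ins)
qed

text \<open>Below p and q, the conditions that match u with an element of t are dense, so G contains
  one.\<close>

lemma half_generic:
  assumes R: "dfn (\<lambda>e. R (e 0) (e 1) (e 2))" and h: "half R p s t" "p \<in> G"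
    and u: "pr u q \<epsilon> nm s" "q \<in> G"
  shows "\<exists>v q' r. r \<in> G \<and> pr v q' \<epsilon> nm t \<and> q' \<in> G \<and> R r u v"
proof -
  define B where "B r' \<longleftrightarrow> (\<exists>v q'. le r' q' \<and> pr v q' \<epsilon> nm t \<and> R r' u v)" for r'
  have "dfn (\<lambda>e. B (e 0))" unfolding B_def by (intro dfn dfn_sub3[OF R])
  then consider r where "r \<in> G" "B r" | r where "r \<in> G" "\<forall>q. q \<epsilon> P \<longrightarrow> le q r \<longrightarrow> \<not> B q"
    using dichotomy[of B] by blast
  then show ?thesis
  proof cases
    case 1
    then show ?thesis using G_up nm_P unfolding B_def by blast
  next
    case 2
    obtain r1 where r1: "r1 \<in> G" "le r1 p" "le r1 q" using G_common h(2) u(2) by blast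
    obtain r2 where r2: "r2 \<in> G" "le r2 r1" "le r2 r" using G_common r1(1) 2(1) by blast
    have "\<exists>r' v q'. r' \<epsilon> P \<and> le r' r2 \<and> le r' q' \<and> pr v q' \<epsilon> nm t \<and> R r' u v"
      using h(1) u(1) G_P[OF r2(1)] r1 r2 le_trans unfolding half_def by blast
    then show ?thesis using 2(2) r2(3) le_trans unfolding B_def by blast
  qed
qed

lemma Feq_sound: "Feq p s t \<Longrightarrow> p \<in> G \<Longrightarrow> V s = V t"
proof (induction s arbitrary: p t rule: tc_induct)
  case (step s)
  have h: "half Feq p s t" "half (\<lambda>p t s. Feq p s t) p t s" using Feq_unfold step.prems by auto
  have IH: "V u = V v" if "pr u q \<epsilon> nm s" "r \<in> G" "Feq r u v" for u v q r
    using step.IH nm_tc that by blast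
  have d: "dfn (\<lambda>e. Feq (e 0) (e 1) (e 2))" "dfn (\<lambda>e. Feq (e 0) (e 2) (e 1))" by (intro dfn)+
  show ?case
  proof (rule ext'I)
    fix z
    show "z \<epsilon>\<^sub>G V s \<longleftrightarrow> z \<epsilon>\<^sub>G V t"
    proof
      assume "z \<epsilon>\<^sub>G V s"
      then obtain u q where u: "pr u q \<epsilon> nm s" "q \<in> G" "z = V u" unfolding mem_V by blast
      show "z \<epsilon>\<^sub>G V t"
        using half_generic[OF d(1) h(1) step.prems(2) u(1,2)] IH[OF u(1)] u(3) unfolding mem_V by blast
    next
      assume "z \<epsilon>\<^sub>G V t"
      then obtain u q where u: "pr u q \<epsilon> nm t" "q \<in> G" "z = V u" unfolding mem_V by blast
      show "z \<epsilon>\<^sub>G V s"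
        using half_generic[OF d(2) h(2) step.prems(2) u(1,2)] IH u(3) unfolding mem_V by metis
    qed
  qed
qed

text \<open>A generic condition that does not force \<open>s = t\<close> can be extended to one exhibiting an element
  of one side that is forced to be outside the other.\<close>

lemma Feq_complete: "V s = V t \<Longrightarrow> \<exists>p\<in>G. Feq p s t"
proof (induction s arbitrary: t rule: tc_induct)
  case (step s)
  \<comment> \<open>B says that p itself witnesses a failure of \<open>half\<close>; with R as a
    parameter both inclusions are treated at once.\<close>
  define B where "B R p s t \<longleftrightarrow> (\<exists>u q. pr u q \<epsilon> nm s \<and> le p q \<and>
    (\<forall>r' v q'. r' \<epsilon> P \<longrightarrow> le r' p \<longrightarrow> le r' q' \<longrightarrow> pr v q' \<epsilon> nm t \<longrightarrow> \<not> R r' u v))"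
    for R :: "'v \<Rightarrow> 'v \<Rightarrow> 'v \<Rightarrow> bool" and p s t
  have noB: False if b: "B R p s t" "p \<in> G" "V s = V t"
    and R: "\<And>u v q q'. pr u q \<epsilon> nm s \<Longrightarrow> pr v q' \<epsilon> nm t \<Longrightarrow> V u = V v \<Longrightarrow> \<exists>p\<in>G. R p u v"
    "\<And>p q u v. R p u v \<Longrightarrow> q \<epsilon> P \<Longrightarrow> le q p \<Longrightarrow> R q u v" for R p s t
  proof -
    obtain u q where u: "pr u q \<epsilon> nm s" "le p q"
      "\<And>r' v q'. r' \<epsilon> P \<Longrightarrow> le r' p \<Longrightarrow> le r' q' \<Longrightarrow> pr v q' \<epsilon> nm t \<Longrightarrow> \<not> R r' u v"
      using b(1) unfolding B_def by blast
    have "q \<in> G" using G_up[OF b(2) nm_P[OF u(1)] u(2)] .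
    then have "V u \<epsilon>\<^sub>G V t" using u(1) b(3) mem_V by metis
    then obtain v q' where v: "pr v q' \<epsilon> nm t" "q' \<in> G" "V u = V v" unfolding mem_V by blast
    obtain p' where p': "p' \<in> G" "R p' u v" using R(1)[OF u(1) v(1,3)] by blast
    obtain r1 where r1: "r1 \<in> G" "le r1 p" "le r1 q'" using G_common b(2) v(2) by blast
    obtain r2 where r2: "r2 \<in> G" "le r2 r1" "le r2 p'" using G_common r1(1) p'(1) by blast
    have "R r2 u v" using R(2)[OF p'(2) G_P[OF r2(1)] r2(3)] .
    then show False using u(3)[OF G_P[OF r2(1)] _ _ v(1)] r1 r2 le_trans by blast
  qed
  have IH: "\<exists>p\<in>G. Feq p u v" if "pr u q \<epsilon> nm s" "V u = V v" for u v q
    using step.IH[OF nm_tc[OF that(1)] that(2)] .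
  let ?B = "\<lambda>p. B Feq p s t \<or> B (\<lambda>p t s. Feq p s t) p t s"
  have "dfn (\<lambda>e. ?B (e 0))" unfolding B_def by (intro dfn)
  then consider p where "p \<in> G" "?B p" | p where "p \<in> G" "\<forall>q. q \<epsilon> P \<longrightarrow> le q p \<longrightarrow> \<not> ?B q"
    using dichotomy[of ?B] by blast
  then show ?case
  proof cases
    case 1
    have "\<not> B Feq p s t" using noB[of Feq p s t] 1(1) step.prems IH Feq_mono by blast
    moreover have "\<not> B (\<lambda>p t s. Feq p s t) p t s"
      using noB[of "\<lambda>p t s. Feq p s t" p t s] 1(1) step.prems[symmetric] IH[OF _ sym] Feq_mono by blast
    ultimately show ?thesis using 1 by blast
  next
    case 2
    have "half Feq p s t" "half (\<lambda>p t s. Feq p s t) p t s"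
      unfolding half_def using 2(2) unfolding B_def by blast+
    then show ?thesis using 2(1) Feq_intro by blast
  qed
qed

lemma fc_Veq: "dt t \<Longrightarrow> dt u \<Longrightarrow> fcb (\<lambda>e. V (t e) = V (u e))"
proof (rule fc_sub2)
  show "fcb (\<lambda>e. V (e 0) = V (e 1))"
  proof (rule fcbI[of "\<lambda>p e. Feq p (e 0) (e 1)"])
    show "dfn (\<lambda>e. Feq (e 0) (e (Suc 0)) (e (Suc 1)))" by (intro dfn)
  qed (use Feq_mono Feq_sound Feq_complete in blast)+
qed

lemma fc_Vmem: "dt t \<Longrightarrow> dt u \<Longrightarrow> fcb (\<lambda>e. V (t e) \<epsilon>\<^sub>G V (u e))"
  by (rule fc_sub2) (auto simp: mem_V intro!: fc fc_Veq dfn)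

text \<open>Terms for elements of V[G], given by definable names. Every fixed element of V[G]
  qualifies through one of its names, so it may serve as a parameter.\<close>

definition wt :: "((nat \<Rightarrow> 'v) \<Rightarrow> 'w) \<Rightarrow> bool" where
  "wt t \<longleftrightarrow> (\<exists>t'. dt t' \<and> t = (\<lambda>e. V (t' e)))"

lemma wt_const[fc]: "wt (\<lambda>e. c)"
proof -
  obtain t where "c = V t" by (rule V_surj)
  then show ?thesis unfolding wt_def by (intro exI[of _ "\<lambda>e. t"]) (simp add: dfn)
qed

lemma wt_V[fc]: "dt t \<Longrightarrow> wt (\<lambda>e. V (t e))" unfolding wt_def by blast

lemma fc_mem'[fc]: "wt t \<Longrightarrow> wt u \<Longrightarrow> fcb (\<lambda>e. t e \<epsilon>\<^sub>G u e)"
  unfolding wt_def by (elim exE conjE) (simp add: fc_Vmem)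
lemma fc_eq'[fc]: "wt t \<Longrightarrow> wt u \<Longrightarrow> fcb (\<lambda>e. t e = u e)"
  unfolding wt_def by (elim exE conjE) (simp add: fc_Veq)

lemma fc_ex'[fc]: assumes "fcb (\<lambda>e. Q (V (e 0)) (\<lambda>n. e (Suc n)))" shows "fcb (\<lambda>e. \<exists>x::'w. Q x e)"
proof -
  have "(\<exists>x. Q x e) \<longleftrightarrow> (\<exists>t. Q (V t) e)" for e using V_surj by metis
  then show ?thesis using fc_ex[of "\<lambda>t. Q (V t)", OF assms] by simp
qed

lemma fc_all'[fc]: "fcb (\<lambda>e. Q (V (e 0)) (\<lambda>n. e (Suc n))) \<Longrightarrow> fcb (\<lambda>e. \<forall>x::'w. Q x e)"
  using fc_neg[OF fc_ex'[of "\<lambda>x e. \<not> Q x e", OF fc_neg]] by simp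

text \<open>The set is the value of the name { (t x, p) | x in a, Fo' p x }. It is the source of the
  functions built in V[G] (\<open>make_fun\<close>).\<close>

lemma comprehension:
  assumes t: "df1 t" and Q: "fcb (\<lambda>e. Q (e 0))"
  obtains y where "\<And>z. z \<epsilon>\<^sub>G y \<longleftrightarrow> (\<exists>x. x \<epsilon> a \<and> Q x \<and> z = V (t x))"
proof -
  obtain Fo where F: "dfn (\<lambda>e. Fo (e 0) (\<lambda>n. e (Suc n)))" "\<And>e. Q (e 0) \<longleftrightarrow> (\<exists>p\<in>G. Fo p e)"
    by (rule fcbE[OF Q]) (rule that)
  define Fo' where "Fo' p x = Fo p (\<lambda>n. x)" for p x
  have dFo: "dfn (\<lambda>e. Fo' (e 0) (e 1))"
    using dfn_rename[OF F(1), of "\<lambda>n. if n = 0 then 0 else 1"] unfolding Fo'_def by simp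
  have Q': "Q x \<longleftrightarrow> (\<exists>p\<in>G. Fo' p x)" for x using F(2)[of "\<lambda>n. x"] unfolding Fo'_def .
  define n where "n = coll (prod' (im (\<lambda>x. nm (t x)) a) P) (\<lambda>z. \<exists>x p. x \<epsilon> a \<and> z = pr (nm (t x)) p \<and> Fo' p x)"
  have dt': "df1 (\<lambda>x. nm (t x))" unfolding df1_def by (intro dfn df1_app[OF t])
  have mn: "z \<epsilon> n \<longleftrightarrow> (\<exists>x p. x \<epsilon> a \<and> p \<epsilon> P \<and> z = pr (nm (t x)) p \<and> Fo' p x)" for z
    unfolding n_def
    by (subst mem_coll) (auto simp: mem_prod' mem_im[OF dt'] intro!: dfn df1_app[OF t] dfn_sub2[OF dFo])
  have "name P n" by (subst name_iff) (use mn nm_name in auto)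
  then have "nm n = n" by (simp add: nm_def)
  then have "z \<epsilon>\<^sub>G V n \<longleftrightarrow> (\<exists>x. x \<epsilon> a \<and> Q x \<and> z = V (t x))" for z
  proof -
    assume nn: "nm n = n"
    show ?thesis unfolding mem_V nn mn Q'
    proof
      assume "\<exists>s p. (\<exists>x p'. x \<epsilon> a \<and> p' \<epsilon> P \<and> pr s p = pr (nm (t x)) p' \<and> Fo' p' x) \<and> p \<in> G \<and> z = V s"
      then show "\<exists>x. x \<epsilon> a \<and> (\<exists>p\<in>G. Fo' p x) \<and> z = V (t x)" using V_nm by auto
    next
      assume "\<exists>x. x \<epsilon> a \<and> (\<exists>p\<in>G. Fo' p x) \<and> z = V (t x)"
      then obtain x p where "x \<epsilon> a" "p \<in> G" "Fo' p x" "z = V (t x)" by blast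
      then show "\<exists>s p. (\<exists>x p'. x \<epsilon> a \<and> p' \<epsilon> P \<and> pr s p = pr (nm (t x)) p' \<and> Fo' p' x) \<and> p \<in> G \<and> z = V s"
        using V_nm[of "t x"] G_P by (intro exI[of _ "nm (t x)"] exI[of _ p]) auto
    qed
  qed
  then show thesis using that by blast
qed

section \<open>Canonical names and the inclusion of V in V[G]\<close>

lemma check_ex: obtains c where "df1 c" "\<And>x. c x = im (\<lambda>y. pr (c y) emp) x"
proof -
  have "df1 (\<lambda>f. im (\<lambda>z. pr (sndv z) emp) f)" unfolding df1_def by (intro dfn)
  then obtain F where F: "df1 F" "\<And>x. F x = im (\<lambda>z. pr (sndv z) emp) (lam F x)" using recursion by blast
  have d: "df1 (\<lambda>y. pr (F y) emp)" unfolding df1_def by (intro dfn df1_app[OF F(1)])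
  have d': "df1 (\<lambda>z. pr (sndv z) emp)" unfolding df1_def by (intro dfn)
  have "im (\<lambda>z. pr (sndv z) emp) (lam F x) = im (\<lambda>y. pr (F y) emp) x" for x
    by (rule set_eqI) (auto simp: mem_im[OF d] mem_im[OF d'] mem_lam[OF F(1)])
  then have "F x = im (\<lambda>y. pr (F y) emp) x" for x using F(2)[of x] by (rule trans[rotated])
  then show thesis by (rule that[OF F(1)])
qed

text \<open>Recursion yields the existence of a definable solution, hence \<open>SOME\<close>; the
  equation determines the operation.\<close>

definition chk :: "'v \<Rightarrow> 'v" where "chk = (SOME c. df1 c \<and> (\<forall>x. c x = im (\<lambda>y. pr (c y) emp) x))"

lemma chk: "df1 chk" "chk x = im (\<lambda>y. pr (chk y) emp) x"
proof -
  obtain c where "df1 c" "\<And>x. c x = im (\<lambda>y. pr (c y) emp) x" by (rule check_ex) (rule that)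
  then have "df1 c \<and> (\<forall>x. c x = im (\<lambda>y. pr (c y) emp) x)" by (intro conjI allI)
  then have *: "df1 chk \<and> (\<forall>x. chk x = im (\<lambda>y. pr (chk y) emp) x)"
    unfolding chk_def by (rule someI[where P = "\<lambda>c. df1 c \<and> (\<forall>x. c x = im (\<lambda>y. pr (c y) emp) x)"])
  show "df1 chk" by (rule conjunct1[OF *])
  show "chk x = im (\<lambda>y. pr (chk y) emp) x" by (rule spec[OF conjunct2[OF *]])
qed

lemmas dt_chk[dfn] = df1_app[OF chk(1)]

lemma mem_chk: "z \<epsilon> chk x \<longleftrightarrow> (\<exists>y. y \<epsilon> x \<and> z = pr (chk y) emp)"
  by (subst chk(2), subst mem_im) (auto simp: df1_def intro!: dfn)

lemma name_chk: "name P (chk x)"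
  by (induction x rule: wf_induct) (subst name_iff, auto simp: mem_chk emp_P)

definition j :: "'v \<Rightarrow> 'w" where "j x = V (chk x)"

lemma wt_j[fc]: "dt t \<Longrightarrow> wt (\<lambda>e. j (t e))" unfolding j_def by (intro fc dfn)

lemma mem_j: "z \<epsilon>\<^sub>G j x \<longleftrightarrow> (\<exists>y. y \<epsilon> x \<and> z = j y)"
  unfolding j_def mem_V using name_chk emp_G by (auto simp: nm_def mem_chk)

lemma j_inject[simp]: "j x = j y \<longleftrightarrow> x = y"
proof (induction x arbitrary: y rule: wf_induct)
  case (step x)
  show ?case
  proof
    assume e: "j x = j y"
    show "x = y"
    proof (rule set_eqI)
      fix z show "z \<epsilon> x \<longleftrightarrow> z \<epsilon> y" using step e mem_j by metis
    qed
  qed simp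
qed

lemma j_mem[simp]: "j x \<epsilon>\<^sub>G j y \<longleftrightarrow> x \<epsilon> y" by (auto simp: mem_j)

lemma ground_inclusion: "ground_inclusion mem mem' = j"
  unfolding ground_inclusion_def
proof (rule the_equality)
  show "\<forall>x. W.elts (j x) = j ` elts x" by (auto simp: W.elts_def elts_def mem_j)
next
  fix i assume i: "\<forall>x. W.elts (i x) = i ` elts x"
  have "i x = j x" for x
  proof (induction x rule: wf_induct)
    case (step x)
    show ?case
    proof (rule ext'I)
      fix z
      have "z \<epsilon>\<^sub>G i x \<longleftrightarrow> (\<exists>y. y \<epsilon> x \<and> z = i y)" using i[rule_format, of x] by (auto simp: W.elts_def elts_def)
      then show "z \<epsilon>\<^sub>G i x \<longleftrightarrow> z \<epsilon>\<^sub>G j x" using step unfolding mem_j by auto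
    qed
  qed
  then show "i = j" by (intro HOL.ext)
qed

end

section \<open>The poset of small partial functions\<close>

locale fn_poset = zfc_model mem for mem :: "'v \<Rightarrow> 'v \<Rightarrow> bool" (infix "\<epsilon>" 50) +
  fixes w \<kappa> \<mu> P :: 'v
  assumes w: "is_omega w" and gch: GCH and reg: "regular \<kappa>" and mu: "infinite_cardinal \<mu>"
    and cf: "cofinality \<mu> \<kappa>" and km: "\<kappa> \<epsilon> \<mu>" and Fn: "is_Fn P \<kappa> \<mu>"
begin

lemma k: "infinite_cardinal \<kappa>" and cfk: "cofinality \<kappa> \<kappa>"
  using reg unfolding regular_def by auto

lemmas kD = infinite_cardinalD[OF k] and muD = infinite_cardinalD[OF mu]

lemma emp_inf: "infinite_cardinal M \<Longrightarrow> emp \<epsilon> M"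
  using infinite_ordinal_omega[OF w] infinite_cardinalD[of M] omega_emp[OF w] by (auto simp: elts_def)

lemma k_trans: "x \<epsilon> \<kappa> \<Longrightarrow> y \<epsilon> x \<Longrightarrow> y \<epsilon> \<kappa>" using ordinal_trans[OF kD(2)] .
lemma k_succ: "x \<epsilon> \<kappa> \<Longrightarrow> succ x \<epsilon> \<kappa>" using infinite_cardinal_limit[OF w k] .

lemma small_Union:
  assumes a: "small \<kappa> a" and B: "df1 B" "\<And>x. x \<epsilon> a \<Longrightarrow> small \<kappa> (B x)"
  shows "small \<kappa> (Un' (im B a))"
proof -
  obtain n where n: "n \<epsilon> \<kappa>" "lep a n" using a unfolding small_def by blast
  define N where "N x = least (\<lambda>n. n \<epsilon> \<kappa> \<and> lep (B x) n)" for x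
  have dN: "df1 N" unfolding df1_def N_def by (intro dfn df1_app[OF B(1)])
  have N: "N x \<epsilon> \<kappa> \<and> lep (B x) (N x)" if x: "x \<epsilon> a" for x
  proof -
    obtain m where "m \<epsilon> \<kappa>" "lep (B x) m" using B(2)[OF x] unfolding small_def by blast
    then show ?thesis
      unfolding N_def using least_ordinal(2)[of m "\<lambda>n. n \<epsilon> \<kappa> \<and> lep (B x) n"] ordinal_mem[OF kD(2)] by blast
  qed
  obtain \<beta> where b: "\<beta> \<epsilon> \<kappa>" "\<And>x. x \<epsilon> a \<Longrightarrow> N x \<epsilon> \<beta>"
    using cofinality_bounded[OF cfk kD(2) emp_inf[OF k] n dN] N by blast
  have ob: "ordinal \<beta>" "ordinal n" using ordinal_mem[OF kD(2)] b n by blast+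
  define \<nu> where "\<nu> = un n \<beta>"
  have nu: "\<nu> \<epsilon> \<kappa>" "ordinal \<nu>"
  proof -
    show "ordinal \<nu>" unfolding \<nu>_def using ordinal_un ob by blast
    have "\<nu> = n \<or> \<nu> = \<beta>" unfolding \<nu>_def using ordinal_linear[OF ob]
      by (elim disjE) (auto intro!: set_eqI simp: mem_un dest: ordinal_trans[OF ob(1)] ordinal_trans[OF ob(2)])
    then show "\<nu> \<epsilon> \<kappa>" using b n by auto
  qed
  have 1: "lep a \<nu>" using lep_trans[OF n(2) lep_subset[of n \<nu>]] by (auto simp: \<nu>_def mem_un)
  have 2: "lep (B x) \<nu>" if x: "x \<epsilon> a" for x
    using lep_trans[OF conjunct2[OF N[OF x]] lep_subset[of "N x" \<nu>]] ordinal_trans[OF ob(1) b(2)[OF x]]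
    by (auto simp: \<nu>_def mem_un)
  show ?thesis
  \<comment> \<open>\<open>lep_Union\<close> wants an infinite bound; a finite \<nu>, the only case
    when \<kappa> = \<omega>, is left to finiteness in HOL.\<close>
  proof (cases "finite (elts \<nu>)")
    case True
    then have "finite (elts (Un' (im B a)))"
      unfolding elts_Un' elts_im[OF B(1)] using lep_finite[OF 1] lep_finite[OF 2] by (auto simp: mem_elts)
    then show ?thesis by (rule small_finite[OF w k])
  next
    case False
    show ?thesis unfolding small_def using lep_Union[OF w nu(2) False 1 B(1) 2] nu(1) by blast
  qed
qed

definition one :: 'v where "one = succ emp"
definition dom :: "'v \<Rightarrow> 'v" where "dom p = im fstv p"
definition restr :: "'v \<Rightarrow> 'v \<Rightarrow> 'v" where "restr p I = coll p (\<lambda>z. fstv z \<epsilon> I)"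
text \<open>For I inside \<mu> this is Fn(I, 2), with domains of size less than \<kappa>.\<close>

definition Fni :: "'v \<Rightarrow> 'v" where "Fni I = coll P (\<lambda>p. \<forall>x. x \<epsilon> dom p \<longrightarrow> x \<epsilon> I)"

lemma dt_dom[dfn]: "dt t \<Longrightarrow> dt (\<lambda>e. dom (t e))" unfolding dom_def by (intro dfn)

lemma df_restr: "df2 restr" unfolding df2_def restr_def by (intro dfn)
lemmas dt_restr[dfn] = df2_app[OF df_restr]

lemma df_Fni: "df1 Fni" unfolding df1_def Fni_def by (intro dfn)
lemmas dt_Fni[dfn] = df1_app[OF df_Fni]

lemma mem_restr: "z \<epsilon> restr p I \<longleftrightarrow> z \<epsilon> p \<and> fstv z \<epsilon> I"
  unfolding restr_def by (rule mem_coll) (intro dfn)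

lemma mem_Fni: "p \<epsilon> Fni I \<longleftrightarrow> p \<epsilon> P \<and> (\<forall>x. x \<epsilon> dom p \<longrightarrow> x \<epsilon> I)"
  unfolding Fni_def by (rule mem_coll) (intro dfn)

lemma one_ne: "one \<noteq> emp" "emp \<noteq> one"
proof -
  have "emp \<epsilon> one" unfolding one_def by (simp add: mem_succ)
  then show "one \<noteq> emp" "emp \<noteq> one" using not_mem_emp by auto
qed

text \<open>Reconciles \<open>is_Fn\<close>, which asks for a bijection, with \<open>small\<close>:
  a well-order of d has type below \<kappa>, for otherwise \<kappa> would embed into n.\<close>

lemma small_equinumerous: "small \<kappa> d \<longleftrightarrow> (\<exists>n\<in>elts \<kappa>. equinumerous d n)"
proof
  assume "small \<kappa> d"
  then obtain n where n: "n \<epsilon> \<kappa>" "lep d n" unfolding small_def by blast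
  obtain \<rho> F where r: "ordinal \<rho>" "df1 F" "\<And>u. u \<epsilon> \<rho> \<Longrightarrow> F u \<epsilon> d"
    "\<And>u v. u \<epsilon> \<rho> \<Longrightarrow> v \<epsilon> \<rho> \<Longrightarrow> F u = F v \<Longrightarrow> u = v" "\<And>z. z \<epsilon> d \<Longrightarrow> \<exists>u. u \<epsilon> \<rho> \<and> F u = z"
    by (rule well_order[of d]) (rule that)
  have l: "lep \<rho> d" "lep d \<rho>" by (rule lepI[OF r(2-4)], assumption+) (rule lep_onto[OF r(2,1,5)])
  have "\<rho> \<epsilon> \<kappa>"
  proof (rule ccontr)
    assume "\<not> \<rho> \<epsilon> \<kappa>"
    then have "elts \<kappa> \<subseteq> elts \<rho>" using ordinal_not_mem[OF r(1) kD(2)] by blast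
    then have "lep \<kappa> \<rho>" by (intro lep_subset) (auto simp: elts_def)
    then have "lep \<kappa> n" using l(1) n(2) lep_trans by blast
    then show False using cardinal_not_lep[OF kD(1) n(1)] by blast
  qed
  then show "\<exists>n\<in>elts \<kappa>. equinumerous d n" using lep_antisym l by (auto simp: elts_def)
qed (auto simp: small_def elts_def dest: equinumerous_lep)

lemma mem_P: "p \<epsilon> P \<longleftrightarrow> (\<forall>z. z \<epsilon> p \<longrightarrow> (\<exists>x i. z = pr x i \<and> x \<epsilon> \<mu> \<and> (i = emp \<or> i = one))) \<and>
    (\<forall>x i i'. pr x i \<epsilon> p \<longrightarrow> pr x i' \<epsilon> p \<longrightarrow> i = i') \<and> small \<kappa> (dom p)"
proof -
  have one: "(elts y = {} \<or> (\<exists>z. elts z = {} \<and> elts y = {z})) \<longleftrightarrow> y = emp \<or> y = one" for y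
  proof -
    have e: "elts z = {} \<longleftrightarrow> z = emp" for z using emp_iff[of z] by (auto simp: elts_def)
    have "elts y = {emp} \<longleftrightarrow> y = one"
      using extV[of y one] by (auto simp: one_def succ_def elts_ins elts_emp)
    then show ?thesis unfolding e by auto
  qed
  have d: "(\<exists>d. (\<forall>x. x \<epsilon> d \<longleftrightarrow> (\<exists>y. maps p x y)) \<and> (\<exists>n\<in>elts \<kappa>. equinumerous d n)) \<longleftrightarrow> small \<kappa> (dom p)"
    if "\<forall>z. z \<epsilon> p \<longrightarrow> (\<exists>x i. z = pr x i \<and> x \<epsilon> \<mu>)"
  proof -
    have "x \<epsilon> dom p \<longleftrightarrow> (\<exists>y. maps p x y)" for x
      using that unfolding dom_def mem_im[OF df_fstv] maps_iff by (metis fstv_pr)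
    then have "(\<forall>x. x \<epsilon> d \<longleftrightarrow> (\<exists>y. maps p x y)) \<longleftrightarrow> d = dom p" for d
      by (auto intro: set_eqI)
    then show ?thesis unfolding small_equinumerous by simp
  qed
  have "p \<epsilon> P \<longleftrightarrow> partial_fun_on p \<mu> \<and> (\<forall>x y. maps p x y \<longrightarrow> y = emp \<or> y = one) \<and>
      (\<exists>d. (\<forall>x. x \<epsilon> d \<longleftrightarrow> (\<exists>y. maps p x y)) \<and> (\<exists>n\<in>elts \<kappa>. equinumerous d n))"
    using Fn unfolding is_Fn_def one by blast
  also have "partial_fun_on p \<mu> \<longleftrightarrow> (\<forall>z. z \<epsilon> p \<longrightarrow> (\<exists>x i. z = pr x i \<and> x \<epsilon> \<mu>)) \<and>
    (\<forall>x i i'. pr x i \<epsilon> p \<longrightarrow> pr x i' \<epsilon> p \<longrightarrow> i = i')"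
    unfolding partial_fun_on_def maps_iff is_opair_fun Ball_def Bex_def mem_elts by blast
  finally have 1: "p \<epsilon> P \<longleftrightarrow> ((\<forall>z. z \<epsilon> p \<longrightarrow> (\<exists>x i. z = pr x i \<and> x \<epsilon> \<mu>)) \<and>
    (\<forall>x i i'. pr x i \<epsilon> p \<longrightarrow> pr x i' \<epsilon> p \<longrightarrow> i = i')) \<and> (\<forall>x y. pr x y \<epsilon> p \<longrightarrow> y = emp \<or> y = one) \<and>
    (\<exists>d. (\<forall>x. x \<epsilon> d \<longleftrightarrow> (\<exists>y. maps p x y)) \<and> (\<exists>n\<in>elts \<kappa>. equinumerous d n))"
    unfolding maps_iff[of p] .
  have 2: "(\<forall>z. z \<epsilon> p \<longrightarrow> (\<exists>x i. z = pr x i \<and> x \<epsilon> \<mu> \<and> (i = emp \<or> i = one))) \<longleftrightarrow>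
    (\<forall>z. z \<epsilon> p \<longrightarrow> (\<exists>x i. z = pr x i \<and> x \<epsilon> \<mu>)) \<and> (\<forall>x y. pr x y \<epsilon> p \<longrightarrow> y = emp \<or> y = one)"
    (is "?A \<longleftrightarrow> ?B \<and> ?C")
  proof
    assume a: ?A
    have "y = emp \<or> y = one" if "pr x y \<epsilon> p" for x y using a[rule_format, OF that] by simp
    then show "?B \<and> ?C" using a by blast
  qed blast
  show ?thesis
  proof (cases "\<forall>z. z \<epsilon> p \<longrightarrow> (\<exists>x i. z = pr x i \<and> x \<epsilon> \<mu>)")
    case True
    show ?thesis unfolding 1 2 d[OF True] by blast
  next
    case False
    then show ?thesis unfolding 1 2 by blast
  qed
qed

lemma P_pair: "p \<epsilon> P \<Longrightarrow> z \<epsilon> p \<Longrightarrow> \<exists>x i. z = pr x i \<and> x \<epsilon> \<mu> \<and> (i = emp \<or> i = one)"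
  and P_fun: "p \<epsilon> P \<Longrightarrow> pr x i \<epsilon> p \<Longrightarrow> pr x i' \<epsilon> p \<Longrightarrow> i = i'"
  and P_small: "p \<epsilon> P \<Longrightarrow> small \<kappa> (dom p)"
  unfolding mem_P by blast+

lemma mem_dom: "p \<epsilon> P \<Longrightarrow> x \<epsilon> dom p \<longleftrightarrow> (\<exists>i. pr x i \<epsilon> p)"
  unfolding dom_def mem_im[OF df_fstv] using P_pair by (metis fstv_pr)

lemma domI: "pr x i \<epsilon> p \<Longrightarrow> x \<epsilon> dom p"
  unfolding dom_def mem_im[OF df_fstv] by (metis fstv_pr)

lemma dom_mu: "p \<epsilon> P \<Longrightarrow> x \<epsilon> dom p \<Longrightarrow> x \<epsilon> \<mu>"
  using mem_dom P_pair by (metis pr_inject)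

lemma dom_mono: "(\<And>z. z \<epsilon> p \<Longrightarrow> z \<epsilon> q) \<Longrightarrow> x \<epsilon> dom p \<Longrightarrow> x \<epsilon> dom q"
  unfolding dom_def mem_im[OF df_fstv] by blast

lemma subset_P: "p \<epsilon> P \<Longrightarrow> (\<And>z. z \<epsilon> q \<Longrightarrow> z \<epsilon> p) \<Longrightarrow> q \<epsilon> P"
  using P_pair P_fun small_subset[OF P_small, of p "dom q"] dom_mono[of q p]
  by (subst mem_P) blast

lemma emp_P: "emp \<epsilon> P"
  by (subst mem_P)
    (auto simp: not_mem_emp dom_def elts_im[OF df_fstv] elts_emp intro: small_finite[OF w k])

lemma restr_P: "p \<epsilon> P \<Longrightarrow> restr p I \<epsilon> P"
  by (erule subset_P) (simp add: mem_restr)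

lemma restr_Fni: "p \<epsilon> P \<Longrightarrow> restr p I \<epsilon> Fni I"
  unfolding mem_Fni using restr_P[of p I] by (auto simp: mem_dom mem_restr)

lemma un_P:
  assumes "p \<epsilon> P" "q \<epsilon> P" "\<And>x i i'. pr x i \<epsilon> p \<Longrightarrow> pr x i' \<epsilon> q \<Longrightarrow> i = i'" shows "un p q \<epsilon> P"
proof -
  have "x \<epsilon> un (dom p) (dom q)" if "x \<epsilon> dom (un p q)" for x
    using that unfolding dom_def mem_im[OF df_fstv] mem_un by blast
  then have "small \<kappa> (dom (un p q))"
    using small_subset[OF small_un[OF w k P_small[OF assms(1)] P_small[OF assms(2)]]] by blast
  moreover have "i = i'" if "pr x i \<epsilon> un p q" "pr x i' \<epsilon> un p q" for x i i'
    using that assms(3)[of x i i'] assms(3)[of x i' i] P_fun[OF assms(1), of x i i'] P_fun[OF assms(2), of x i i']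
    unfolding mem_un by blast
  ultimately show ?thesis
    using P_pair[OF assms(1)] P_pair[OF assms(2)] by (subst mem_P) (auto simp: mem_un)
qed

text \<open>Inside I the condition r already contains p, and outside I it says nothing, so the two
  are compatible.\<close>

lemma amalgamate:
  assumes "p \<epsilon> P" "r \<epsilon> Fni I" "\<And>z. z \<epsilon> restr p I \<Longrightarrow> z \<epsilon> r" shows "un r p \<epsilon> P"
proof (rule un_P)
  show r: "r \<epsilon> P" using assms(2) mem_Fni by blast
  fix x i i' assume "pr x i \<epsilon> r" "pr x i' \<epsilon> p"
  moreover from this have "pr x i' \<epsilon> r"
    using assms(2,3) domI[of x i r] by (auto simp: mem_Fni mem_restr)
  ultimately show "i = i'" using P_fun[OF r] by blast
qed (rule assms)

lemma extend_P:
  assumes "p \<epsilon> P" "x \<epsilon> \<mu>" "\<not> x \<epsilon> dom p" "i = emp \<or> i = one" shows "ins (pr x i) p \<epsilon> P"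
proof -
  have s: "dom (sing (pr x i)) = sing x"
    by (rule set_eqI) (auto simp: dom_def mem_im[OF df_fstv] mem_sing)
  have "finite (elts (sing x))" by (simp add: sing_def elts_up)
  then have "small \<kappa> (sing x)" by (rule small_finite[OF w k])
  then have "sing (pr x i) \<epsilon> P" by (subst mem_P) (use assms in \<open>auto simp: mem_sing s\<close>)
  then show ?thesis unfolding ins_def
    by (rule un_P[OF _ assms(1)]) (use assms domI in \<open>auto simp: mem_sing\<close>)
qed

lemma small_le: "small \<kappa> x \<Longrightarrow> lep x \<kappa>"
  unfolding small_def using lep_trans lep_mem[OF kD(2)] by blast

text \<open>A condition with domain in \<open>I\<close> is coded by two bounded subsets of \<open>\<kappa>\<close>, and by GCH there are
  only \<open>\<kappa>\<close> of these.\<close>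

lemma Fni_lep: assumes I: "lep I \<kappa>" shows "lep (Fni I) \<kappa>"
proof -
  obtain g where g: "df1 g" "\<And>u. u \<epsilon> I \<Longrightarrow> g u \<epsilon> \<kappa>"
    "\<And>u v. u \<epsilon> I \<Longrightarrow> v \<epsilon> I \<Longrightarrow> g u = g v \<Longrightarrow> u = v" using lepE[OF I] by metis
  define L where "L \<xi> = coll (Fni I) (\<lambda>p. \<forall>x. x \<epsilon> dom p \<longrightarrow> g x \<epsilon> \<xi>)" for \<xi>
  have dL: "df1 L" unfolding df1_def L_def by (intro dfn df1_app[OF g(1)])
  have mL: "p \<epsilon> L \<xi> \<longleftrightarrow> p \<epsilon> Fni I \<and> (\<forall>x. x \<epsilon> dom p \<longrightarrow> g x \<epsilon> \<xi>)" for p \<xi>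
    unfolding L_def by (rule mem_coll) (intro dfn df1_app[OF g(1)])
  define D where "D p = coll (dom p) (\<lambda>x. pr x one \<epsilon> p)" for p
  have dD: "df1 D" unfolding df1_def D_def by (intro dfn)
  have mD: "x \<epsilon> D p \<longleftrightarrow> x \<epsilon> dom p \<and> pr x one \<epsilon> p" for x p
    unfolding D_def by (rule mem_coll) (intro dfn)
  have 1: "lep (L \<xi>) \<kappa>" if x: "\<xi> \<epsilon> \<kappa>" for \<xi>
  proof -
    have "lep (L \<xi>) (prod' (pow \<xi>) (pow \<xi>))"
    proof (rule lepI[of "\<lambda>p. pr (im g (dom p)) (im g (D p))"])
      show "df1 (\<lambda>p. pr (im g (dom p)) (im g (D p)))"
        unfolding df1_def by (intro dfn df1_app[OF g(1)] df1_app[OF dD])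
      show "pr (im g (dom p)) (im g (D p)) \<epsilon> prod' (pow \<xi>) (pow \<xi>)" if "p \<epsilon> L \<xi>" for p
        using that unfolding mL pr_mem_prod' mem_pow mem_im[OF g(1)] mD by auto
      fix p q assume pq: "p \<epsilon> L \<xi>" "q \<epsilon> L \<xi>"
        "pr (im g (dom p)) (im g (D p)) = pr (im g (dom q)) (im g (D q))"
      have P: "p \<epsilon> P" "q \<epsilon> P" and dI: "\<And>x. x \<epsilon> dom p \<Longrightarrow> x \<epsilon> I" "\<And>x. x \<epsilon> dom q \<Longrightarrow> x \<epsilon> I"
        using pq(1,2) unfolding mL mem_Fni by blast+
      have e: "im g (dom p) = im g (dom q)" "im g (D p) = im g (D q)" using pq(3) by auto
      have inj: "a = b" if "im g a = im g b" "\<And>x. x \<epsilon> a \<Longrightarrow> x \<epsilon> I" "\<And>x. x \<epsilon> b \<Longrightarrow> x \<epsilon> I" for a b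
      proof (rule set_eqI)
        fix x show "x \<epsilon> a \<longleftrightarrow> x \<epsilon> b"
          using that g(3) mem_im[OF g(1), of _ a] mem_im[OF g(1), of _ b] by metis
      qed
      have d: "dom p = dom q" using inj e(1) dI by blast
      have D: "D p = D q" using inj[OF e(2)] dI unfolding mD by blast
      have val: "pr x i \<epsilon> r \<longleftrightarrow> x \<epsilon> dom r \<and> (i = one \<and> x \<epsilon> D r \<or> i = emp \<and> \<not> x \<epsilon> D r)" if r: "r \<epsilon> P" for x i r
      proof
        assume a: "pr x i \<epsilon> r"
        then have "i = emp \<or> i = one" using P_pair[OF r a] by auto
        then show "x \<epsilon> dom r \<and> (i = one \<and> x \<epsilon> D r \<or> i = emp \<and> \<not> x \<epsilon> D r)"
          using a domI[OF a] P_fun[OF r a, of one] one_ne unfolding mD by auto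
      next
        assume a: "x \<epsilon> dom r \<and> (i = one \<and> x \<epsilon> D r \<or> i = emp \<and> \<not> x \<epsilon> D r)"
        then obtain i' where i': "pr x i' \<epsilon> r" using mem_dom[OF r] by blast
        then have "i' = emp \<or> i' = one" using P_pair[OF r i'] by auto
        then show "pr x i \<epsilon> r" using a i' unfolding mD by auto
      qed
      have sub: "z \<epsilon> q" if z: "z \<epsilon> p" "p \<epsilon> P" "q \<epsilon> P" "dom p = dom q" "D p = D q" for z p q
      proof -
        obtain x i where "z = pr x i" using P_pair z by blast
        then show ?thesis using z val[OF z(2), of x i] val[OF z(3), of x i] by auto
      qed
      show "p = q" using sub P d D by (intro set_eqI) metis
    qed
    also have "lep (prod' (pow \<xi>) (pow \<xi>)) (prod' \<kappa> \<kappa>)"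
      using lep_prod' pow_lep[OF w gch k x] by blast
    finally (lep_trans) show ?thesis using lep_square[OF w kD(2,3)] lep_trans by blast
  qed
  have "lep (Un' (im L \<kappa>)) \<kappa>" by (rule lep_Union[OF w kD(2,3) lep_refl dL 1])
  \<comment> \<open>The domain of p is short, so by regularity its image under g is bounded in
    \<kappa> and p belongs to some level.\<close>
  moreover have "p \<epsilon> Un' (im L \<kappa>)" if p: "p \<epsilon> Fni I" for p
  proof -
    obtain n where "n \<epsilon> \<kappa>" "lep (dom p) n" using p P_small unfolding mem_Fni small_def by blast
    then obtain \<xi> where "\<xi> \<epsilon> \<kappa>" "\<And>x. x \<epsilon> dom p \<Longrightarrow> g x \<epsilon> \<xi>"
      using cofinality_bounded[OF cfk kD(2) emp_inf[OF k] _ _ g(1)] g(2) p unfolding mem_Fni by blast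
    then show ?thesis using p by (auto simp: mem_Un' mem_im[OF dL] mL)
  qed
  ultimately show ?thesis using lep_trans lep_subset by blast
qed

text \<open>A stand-in for an elementary submodel of size \<kappa>: from a condition supported in I,
  the extensions chosen by e are again supported in I. Including dom p0 makes restriction to I
  preserve p0.\<close>

definition closed :: "('v \<Rightarrow> 'v \<Rightarrow> 'v) \<Rightarrow> 'v \<Rightarrow> 'v \<Rightarrow> 'v \<Rightarrow> bool" where
  "closed e K p0 I \<longleftrightarrow> lep I \<kappa> \<and> (\<forall>x. x \<epsilon> dom p0 \<longrightarrow> x \<epsilon> I) \<and>
     (\<forall>q i x. q \<epsilon> Fni I \<longrightarrow> i \<epsilon> K \<longrightarrow> x \<epsilon> dom (e q i) \<longrightarrow> x \<epsilon> I)"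

text \<open>Close off \<kappa> times. A condition supported in the union I has a domain of size less
  than \<kappa>, so by regularity it is supported in some stage F \<beta>, and its images lie in the
  next stage. \<open>Fni_lep\<close> keeps the stages of size at most \<kappa>.\<close>

lemma closure:
  assumes e: "df2 e" "\<And>q i. q \<epsilon> P \<Longrightarrow> i \<epsilon> K \<Longrightarrow> e q i \<epsilon> P" and K: "lep K \<kappa>" and p0: "p0 \<epsilon> P"
  shows "\<exists>I. I \<epsilon> pow \<mu> \<and> closed e K p0 I"
proof -
  define N where "N I = un I (Un' (im (\<lambda>q. Un' (im (\<lambda>i. dom (e q i)) K)) (Fni I)))" for I
  have dN: "df1 N" unfolding df1_def N_def by (intro dfn df2_app[OF e(1)])
  have d1: "df1 (\<lambda>i. dom (e q i))" for q unfolding df1_def by (intro dfn df2_app[OF e(1)])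
  have d2: "df1 (\<lambda>q. Un' (im (\<lambda>i. dom (e q i)) K))" unfolding df1_def by (intro dfn df2_app[OF e(1)])
  have mN: "x \<epsilon> N I \<longleftrightarrow> x \<epsilon> I \<or> (\<exists>q i. q \<epsilon> Fni I \<and> i \<epsilon> K \<and> x \<epsilon> dom (e q i))" for x I
  proof -
    have 1: "x \<epsilon> Un' (im (\<lambda>i. dom (e q i)) K) \<longleftrightarrow> (\<exists>i. i \<epsilon> K \<and> x \<epsilon> dom (e q i))" for q
      unfolding mem_Un' mem_im[OF d1] by blast
    have "x \<epsilon> Un' (im (\<lambda>q. Un' (im (\<lambda>i. dom (e q i)) K)) (Fni I)) \<longleftrightarrow>
      (\<exists>q. q \<epsilon> Fni I \<and> x \<epsilon> Un' (im (\<lambda>i. dom (e q i)) K))"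
      unfolding mem_Un'[of x "im (\<lambda>q. Un' (im (\<lambda>i. dom (e q i)) K)) (Fni I)"] mem_im[OF d2] by blast
    then show ?thesis unfolding N_def mem_un 1 by blast
  qed
  have lN: "lep (N I) \<kappa>" if I: "lep I \<kappa>" for I
    unfolding N_def
  proof (rule lep_un[OF w kD(2,3) I], rule lep_Union[OF w kD(2,3) Fni_lep[OF I] d2],
      rule lep_Union[OF w kD(2,3) K d1])
    show "lep (dom (e q i)) \<kappa>" if "q \<epsilon> Fni I" "i \<epsilon> K" for q i
      using small_le[OF P_small[OF e(2)]] that mem_Fni by blast
  qed
  define J where "J s = un (dom p0) (Un' (im N s))" for s
  have dJ: "df1 J" unfolding df1_def J_def by (intro dfn df1_app[OF dN])
  obtain F where F: "df1 F" "\<And>x. F x = J (im F x)" by (rule enumeration[OF dJ]) (rule that)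
  have mF: "x \<epsilon> F \<xi> \<longleftrightarrow> x \<epsilon> dom p0 \<or> (\<exists>\<eta>. \<eta> \<epsilon> \<xi> \<and> x \<epsilon> N (F \<eta>))" for x \<xi>
    unfolding F(2)[of \<xi>] J_def mem_un mem_Un' mem_im[OF dN] mem_im[OF F(1)] by blast
  have FF: "lep (F \<xi>) \<kappa> \<and> (\<forall>x. x \<epsilon> F \<xi> \<longrightarrow> x \<epsilon> \<mu>)" if "\<xi> \<epsilon> \<kappa>" for \<xi>
    using that
  proof (induction \<xi> rule: wf_induct)
    case (step \<xi>)
    have IH: "lep (F \<eta>) \<kappa>" "\<And>x. x \<epsilon> F \<eta> \<Longrightarrow> x \<epsilon> \<mu>" if "\<eta> \<epsilon> \<xi>" for \<eta>
      using step that k_trans by blast+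
    have "lep (im F \<xi>) \<xi>"
      by (rule lep_onto[OF F(1) ordinal_mem[OF kD(2) step.prems]]) (auto simp: mem_im[OF F(1)])
    then have "lep (im F \<xi>) \<kappa>" using lep_trans lep_mem[OF kD(2) step.prems] by blast
    then have "lep (Un' (im N (im F \<xi>))) \<kappa>"
      by (rule lep_Union[OF w kD(2,3) _ dN]) (use lN IH in \<open>auto simp: mem_im[OF F(1)]\<close>)
    then have "lep (F \<xi>) \<kappa>" unfolding F(2)[of \<xi>] J_def
      using lep_un[OF w kD(2,3) small_le[OF P_small[OF p0]]] by blast
    moreover have "x \<epsilon> \<mu>" if "x \<epsilon> F \<xi>" for x
    proof -
      consider "x \<epsilon> dom p0" | \<eta> where "\<eta> \<epsilon> \<xi>" "x \<epsilon> F \<eta>"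
        | q i where "q \<epsilon> P" "i \<epsilon> K" "x \<epsilon> dom (e q i)"
        using \<open>x \<epsilon> F \<xi>\<close> mF[of x \<xi>] mN mem_Fni by blast
      then show ?thesis by cases (use IH(2) dom_mu p0 e(2) in blast)+
    qed
    ultimately show ?case by blast
  qed
  define I where "I = Un' (im F \<kappa>)"
  have mI: "x \<epsilon> I \<longleftrightarrow> (\<exists>\<xi>. \<xi> \<epsilon> \<kappa> \<and> x \<epsilon> F \<xi>)" for x
    unfolding I_def mem_Un' mem_im[OF F(1)] by blast
  have "I \<epsilon> pow \<mu>" unfolding mem_pow mI using FF by blast
  moreover have "lep I \<kappa>" unfolding I_def by (rule lep_Union[OF w kD(2,3) lep_refl F(1)]) (use FF in blast)
  moreover have "x \<epsilon> I" if "x \<epsilon> dom p0" for x using that emp_inf[OF k] mF[of x emp] unfolding mI by blast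
  moreover have "x \<epsilon> I" if x: "q \<epsilon> Fni I" "i \<epsilon> K" "x \<epsilon> dom (e q i)" for q i x
  proof -
    \<comment> \<open>The stages at which the points of dom q enter are bounded, and the bound is
      \<beta>.\<close>
    define l where "l x = least (\<lambda>\<xi>. \<xi> \<epsilon> \<kappa> \<and> x \<epsilon> F \<xi>)" for x
    have dl: "df1 l" unfolding df1_def l_def by (intro dfn df1_app[OF F(1)])
    have l: "l x \<epsilon> \<kappa> \<and> x \<epsilon> F (l x)" if "x \<epsilon> I" for x
    proof -
      obtain \<xi> where "\<xi> \<epsilon> \<kappa>" "x \<epsilon> F \<xi>" using \<open>x \<epsilon> I\<close> mI by blast
      then show ?thesis unfolding l_def
        using least_ordinal(2)[of \<xi> "\<lambda>\<xi>. \<xi> \<epsilon> \<kappa> \<and> x \<epsilon> F \<xi>"] ordinal_mem[OF kD(2)] by blast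
    qed
    obtain n where "n \<epsilon> \<kappa>" "lep (dom q) n" using x(1) P_small unfolding mem_Fni small_def by blast
    then obtain \<beta> where b: "\<beta> \<epsilon> \<kappa>" "\<And>x. x \<epsilon> dom q \<Longrightarrow> l x \<epsilon> \<beta>"
      using cofinality_bounded[OF cfk kD(2) emp_inf[OF k] _ _ dl] l x(1) unfolding mem_Fni by blast
    have "y \<epsilon> F \<beta>" if "y \<epsilon> dom q" for y
      using l[of y] b(2)[OF that] x(1) that mF[of y \<beta>] mN mem_Fni by blast
    then have "q \<epsilon> Fni (F \<beta>)" using x(1) unfolding mem_Fni by blast
    then have "x \<epsilon> F (succ \<beta>)" using x mF[of x "succ \<beta>"] mN mem_succ by blast
    then show ?thesis using k_succ[OF b(1)] mI by blast
  qed
  ultimately show ?thesis unfolding closed_def by blast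
qed

text \<open>The supports are chosen inside the model, so that they form a definable function of
  a.\<close>

lemma closure_family:
  assumes E: "\<And>t u v. dt t \<Longrightarrow> dt u \<Longrightarrow> dt v \<Longrightarrow> dt (\<lambda>e. E (t e) (u e) (v e))"
    "\<And>a q i. a \<epsilon> A \<Longrightarrow> q \<epsilon> P \<Longrightarrow> i \<epsilon> K \<Longrightarrow> E a q i \<epsilon> P" and K: "lep K \<kappa>" and p0: "p0 \<epsilon> P"
  obtains I where "df1 I" "\<And>a. a \<epsilon> A \<Longrightarrow> I a \<epsilon> pow \<mu>" "\<And>a. a \<epsilon> A \<Longrightarrow> closed (E a) K p0 (I a)"
proof -
  define S where "S a = coll (pow \<mu>) (closed (E a) K p0)" for a
  have dS: "df1 S" unfolding df1_def S_def closed_def by (intro dfn E)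
  have mS: "I \<epsilon> S a \<longleftrightarrow> I \<epsilon> pow \<mu> \<and> closed (E a) K p0 I" for I a
    unfolding S_def by (rule mem_coll) (unfold closed_def, intro dfn E)
  obtain c where c: "\<And>x. x \<epsilon> im S A \<Longrightarrow> x \<noteq> emp \<Longrightarrow> app c x \<epsilon> x" using choice_function[of "im S A"] by blast
  have "app c (S a) \<epsilon> S a" if a: "a \<epsilon> A" for a
  proof (rule c)
    have "df2 (E a)" unfolding df2_def by (intro E dfn)
    then have "\<exists>I. I \<epsilon> pow \<mu> \<and> closed (E a) K p0 I" using closure E(2)[OF a] K p0 by blast
    then show "S a \<noteq> emp" unfolding emp_iff mS by blast
  qed (use a mem_im[OF dS] in blast)
  moreover have "df1 (\<lambda>a. app c (S a))" unfolding df1_def by (intro dfn df1_app[OF dS])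
  ultimately show thesis using that[of "\<lambda>a. app c (S a)"] mS by blast
qed

end

section \<open>Deciding values with small supports\<close>

context forcing
begin

text \<open>Fixing the environment to the constant x turns the witness relation into a binary
  predicate on conditions and elements; relations with more arguments are packed into pairs.\<close>

lemma fc1E:
  assumes "fcb (\<lambda>e. Q (e 0))"
  obtains F where "\<And>t u. dt t \<Longrightarrow> dt u \<Longrightarrow> dfn (\<lambda>e. F (t e) (u e))"
    "\<And>p q x. F p x \<Longrightarrow> q \<epsilon> P \<Longrightarrow> le q p \<Longrightarrow> F q x" "\<And>x. Q x \<longleftrightarrow> (\<exists>p\<in>G. F p x)"
proof -
  obtain Fo where Fo: "dfn (\<lambda>e. Fo (e 0) (\<lambda>n. e (Suc n)))"
    "\<And>p q e. Fo p e \<Longrightarrow> q \<epsilon> P \<Longrightarrow> le q p \<Longrightarrow> Fo q e" "\<And>e. Q (e 0) \<longleftrightarrow> (\<exists>p\<in>G. Fo p e)"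
    by (rule fcbE[OF assms]) (rule that)
  define F where "F p x = Fo p (\<lambda>n. x)" for p x
  have "dfn (\<lambda>e. F (e 0) (e 1))"
    using dfn_rename[OF Fo(1), of "\<lambda>n. if n = 0 then 0 else 1"] unfolding F_def by simp
  then have "dfn (\<lambda>e. F (t e) (u e))" if "dt t" "dt u" for t u using dfn_sub2 that by blast
  moreover have "Q x \<longleftrightarrow> (\<exists>p\<in>G. F p x)" for x using Fo(3)[of "\<lambda>n. x"] unfolding F_def .
  moreover have "F q x" if "F p x" "q \<epsilon> P" "le q p" for p q x using Fo(2) that unfolding F_def by blast
  ultimately show thesis using that by blast
qed

end

locale fn_forcing = fn_poset mem w \<kappa> \<mu> P + forcing mem mem' P G val
  for mem :: "'v \<Rightarrow> 'v \<Rightarrow> bool" (infix "\<epsilon>" 50) and mem' :: "'w \<Rightarrow> 'w \<Rightarrow> bool" (infix "\<epsilon>\<^sub>G" 50)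
  and w \<kappa> \<mu> P G val
begin

text \<open>\<open>E a q i\<close> is a pair of an extension of \<open>q\<close> and a value that it decides.\<close>

lemma support:
  assumes F: "\<And>t u. dt t \<Longrightarrow> dt u \<Longrightarrow> dfn (\<lambda>e. F (t e) (u e))"
    "\<And>p q x. F p x \<Longrightarrow> q \<epsilon> P \<Longrightarrow> le q p \<Longrightarrow> F q x" "\<And>x. Q x \<longleftrightarrow> (\<exists>p\<in>G. F p x)"
    and tot: "\<And>a i. a \<epsilon> A \<Longrightarrow> i \<epsilon> K \<Longrightarrow> \<exists>y. y \<epsilon> Y \<and> Q (pr a (pr i y))"
    and K: "lep K \<kappa>" and Y: "emp \<epsilon> Y"
  obtains p0 I E where "p0 \<in> G" "df1 I" "\<And>a. a \<epsilon> A \<Longrightarrow> I a \<epsilon> pow \<mu>" "\<And>a. a \<epsilon> A \<Longrightarrow> lep (I a) \<kappa>"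
    "\<And>t u v. dt t \<Longrightarrow> dt u \<Longrightarrow> dt v \<Longrightarrow> dt (\<lambda>e. E (t e) (u e) (v e))"
    "\<And>a q i. q \<epsilon> P \<Longrightarrow> sndv (E a q i) \<epsilon> Y"
    "\<And>a i p. a \<epsilon> A \<Longrightarrow> i \<epsilon> K \<Longrightarrow> p \<epsilon> P \<Longrightarrow> le p p0 \<Longrightarrow>
       fstv (E a (restr p (I a)) i) \<epsilon> Fni (I a) \<and> le (un (fstv (E a (restr p (I a)) i)) p) p \<and>
       un (fstv (E a (restr p (I a)) i)) p \<epsilon> P \<and>
       F (fstv (E a (restr p (I a)) i)) (pr a (pr i (sndv (E a (restr p (I a)) i))))"
proof -
  \<comment> \<open>B q holds if, for some a and i, no extension of q decides a value in Y. No
    member of G satisfies it, so G has a member p0 below which every condition can be extended to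
    decide.\<close>
  define B where "B q \<longleftrightarrow> (\<exists>a i. a \<epsilon> A \<and> i \<epsilon> K \<and>
    (\<forall>r y. r \<epsilon> P \<longrightarrow> le r q \<longrightarrow> y \<epsilon> Y \<longrightarrow> \<not> F r (pr a (pr i y))))" for q
  have "dfn (\<lambda>e. B (e 0))" unfolding B_def by (intro dfn F(1))
  moreover have "\<not> B q" if q: "q \<in> G" for q
  proof
    assume "B q"
    then obtain a i where ai: "a \<epsilon> A" "i \<epsilon> K"
      "\<And>r y. r \<epsilon> P \<Longrightarrow> le r q \<Longrightarrow> y \<epsilon> Y \<Longrightarrow> \<not> F r (pr a (pr i y))" unfolding B_def by blast
    obtain y where y: "y \<epsilon> Y" "Q (pr a (pr i y))" using tot ai(1,2) by blast
    obtain p where p: "p \<in> G" "F p (pr a (pr i y))" using y(2) F(3) by blast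
    obtain r where r: "r \<in> G" "le r p" "le r q" using G_common p(1) q by blast
    show False using ai(3)[OF G_P[OF r(1)] r(3) y(1)] F(2)[OF p(2) G_P[OF r(1)] r(2)] by blast
  qed
  ultimately obtain p0 where p0: "p0 \<in> G" "\<And>q. q \<epsilon> P \<Longrightarrow> le q p0 \<Longrightarrow> \<not> B q"
    using dichotomy[of B] by blast
  obtain c where c: "\<And>x. x \<epsilon> pow (prod' P Y) \<Longrightarrow> x \<noteq> emp \<Longrightarrow> app c x \<epsilon> x"
    using choice_function[of "pow (prod' P Y)"] by blast
  define S where "S a q i = coll (prod' P Y) (\<lambda>z. le (fstv z) q \<and> F (fstv z) (pr a (pr i (sndv z))))" for a q i
  have dS: "dt (\<lambda>e. S (t e) (u e) (v e))" if "dt t" "dt u" "dt v" for t u v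
    unfolding S_def by (intro dfn F(1) that that[THEN dt_shift])
  have mS: "z \<epsilon> S a q i \<longleftrightarrow> z \<epsilon> prod' P Y \<and> le (fstv z) q \<and> F (fstv z) (pr a (pr i (sndv z)))" for z a q i
    unfolding S_def by (rule mem_coll) (intro dfn F(1))
  \<comment> \<open>The default \<open>pr q emp\<close> keeps E total with values in P and Y, which
    is why Y contains \<open>emp\<close>.\<close>
  define E where "E a q i = (if S a q i = emp then pr q emp else app c (S a q i))" for a q i
  have dE: "dt (\<lambda>e. E (t e) (u e) (v e))" if "dt t" "dt u" "dt v" for t u v
    unfolding E_def by (intro dfn dS that)
  have ES: "E a q i \<epsilon> S a q i" if "S a q i \<noteq> emp" for a q i
    using c[OF _ that] that unfolding E_def by (simp add: mem_pow mS)
  have E1: "fstv (E a q i) \<epsilon> P \<and> sndv (E a q i) \<epsilon> Y" if "q \<epsilon> P" for a q i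
  proof (cases "S a q i = emp")
    case False
    then show ?thesis using ES[OF False] unfolding mS mem_prod' by auto
  qed (simp add: E_def that Y)
  obtain I where I: "df1 I" "\<And>a. a \<epsilon> A \<Longrightarrow> I a \<epsilon> pow \<mu>"
    "\<And>a. a \<epsilon> A \<Longrightarrow> closed (\<lambda>q i. fstv (E a q i)) K p0 (I a)"
  proof (rule closure_family[of "\<lambda>a q i. fstv (E a q i)" A K p0])
    show "dt (\<lambda>e. fstv (E (t e) (u e) (v e)))" if "dt t" "dt u" "dt v" for t u v
      by (intro dfn dE that)
    show "fstv (E a q i) \<epsilon> P" if "q \<epsilon> P" for a q i using E1[OF that] by blast
  qed (use that K G_P[OF p0(1)] in blast)+
  have main: "fstv (E a (restr p (I a)) i) \<epsilon> Fni (I a) \<and> le (un (fstv (E a (restr p (I a)) i)) p) p \<and>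
       un (fstv (E a (restr p (I a)) i)) p \<epsilon> P \<and>
       F (fstv (E a (restr p (I a)) i)) (pr a (pr i (sndv (E a (restr p (I a)) i))))"
    if a: "a \<epsilon> A" "i \<epsilon> K" "p \<epsilon> P" "le p p0" for a i p
  proof -
    let ?q = "restr p (I a)"
    have q: "?q \<epsilon> P" "?q \<epsilon> Fni (I a)" using restr_P restr_Fni a(3) by blast+
    have cl: "\<And>x. x \<epsilon> dom p0 \<Longrightarrow> x \<epsilon> I a"
      "\<And>q i x. q \<epsilon> Fni (I a) \<Longrightarrow> i \<epsilon> K \<Longrightarrow> x \<epsilon> dom (fstv (E a q i)) \<Longrightarrow> x \<epsilon> I a"
      using I(3)[OF a(1)] unfolding closed_def by blast+
    \<comment> \<open>The domain of p0 lies in I a, so the restriction of p still extends p0 and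
      hence can be extended to decide.\<close>
    have "le ?q p0" unfolding le_def
    proof (intro allI impI)
      fix z assume z: "z \<epsilon> p0"
      then obtain x b where "z = pr x b" using P_pair G_P[OF p0(1)] by blast
      then show "z \<epsilon> ?q" using z a(4) cl(1)[OF domI[of x b p0]] unfolding mem_restr le_def by simp
    qed
    then have "\<not> B ?q" using p0(2)[OF q(1)] by blast
    then obtain r y where "r \<epsilon> P" "le r ?q" "y \<epsilon> Y" "F r (pr a (pr i y))" using a(1,2) unfolding B_def by blast
    then have "pr r y \<epsilon> S a ?q i" unfolding mS by simp
    then have "S a ?q i \<noteq> emp" using not_mem_emp by metis
    from ES[OF this] have s: "le (fstv (E a ?q i)) ?q" "F (fstv (E a ?q i)) (pr a (pr i (sndv (E a ?q i))))"
      unfolding mS by blast+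
    have f: "fstv (E a ?q i) \<epsilon> Fni (I a)" unfolding mem_Fni using E1[OF q(1)] cl(2)[OF q(2) a(2)] by blast
    show ?thesis using f s amalgamate[OF a(3) f] unfolding le_def by (auto simp: mem_un)
  qed
  show thesis
    by (rule that[of p0 I E]) (use p0(1) I(1,2) I(3)[unfolded closed_def] dE E1 main in blast)+
qed

text \<open>Each value is some \<open>sndv (E a q i)\<close> with q in Fn(I a, 2); there are only
  \<kappa> < l such pairs (q, i), so regularity of l bounds the values in V. This is the covering
  property that usually comes from the \<kappa>^+-chain condition.\<close>

lemma cover:
  assumes l: "infinite_cardinal l" "cofinality l l" "\<kappa> \<epsilon> l" and K: "lep K \<kappa>"
    and Q: "fcb (\<lambda>e. Q (e 0))"
    and tot: "\<And>a i. a \<epsilon> A \<Longrightarrow> i \<epsilon> K \<Longrightarrow> \<exists>y. y \<epsilon> l \<and> Q (pr a (pr i y))"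
    and un: "\<And>a i y y'. Q (pr a (pr i y)) \<Longrightarrow> Q (pr a (pr i y')) \<Longrightarrow> y = y'"
  obtains b where "df1 b" "\<And>a. a \<epsilon> A \<Longrightarrow> b a \<epsilon> l"
    "\<And>a i y. a \<epsilon> A \<Longrightarrow> i \<epsilon> K \<Longrightarrow> Q (pr a (pr i y)) \<Longrightarrow> y \<epsilon> b a"
proof -
  obtain F where F: "\<And>t u. dt t \<Longrightarrow> dt u \<Longrightarrow> dfn (\<lambda>e. F (t e) (u e))"
    "\<And>p q x. F p x \<Longrightarrow> q \<epsilon> P \<Longrightarrow> le q p \<Longrightarrow> F q x" "\<And>x. Q x \<longleftrightarrow> (\<exists>p\<in>G. F p x)"
    by (rule fc1E[OF Q]) (rule that)
  obtain p0 I E where p0: "p0 \<in> G" and I: "df1 I" "\<And>a. a \<epsilon> A \<Longrightarrow> I a \<epsilon> pow \<mu>" "\<And>a. a \<epsilon> A \<Longrightarrow> lep (I a) \<kappa>"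
    and dE: "\<And>t u v. dt t \<Longrightarrow> dt u \<Longrightarrow> dt v \<Longrightarrow> dt (\<lambda>e. E (t e) (u e) (v e))"
    and EY: "\<And>a q i. q \<epsilon> P \<Longrightarrow> sndv (E a q i) \<epsilon> l"
    and E: "\<And>a i p. a \<epsilon> A \<Longrightarrow> i \<epsilon> K \<Longrightarrow> p \<epsilon> P \<Longrightarrow> le p p0 \<Longrightarrow>
       fstv (E a (restr p (I a)) i) \<epsilon> Fni (I a) \<and> le (un (fstv (E a (restr p (I a)) i)) p) p \<and>
       un (fstv (E a (restr p (I a)) i)) p \<epsilon> P \<and>
       F (fstv (E a (restr p (I a)) i)) (pr a (pr i (sndv (E a (restr p (I a)) i))))"
    by (rule support[OF F tot K emp_inf[OF l(1)]]) (assumption | rule that)+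
  \<comment> \<open>U q says that q decides two values at one place. No member of G does, so some p1
    in G excludes it for all its extensions.\<close>
  define U where "U q \<longleftrightarrow> (\<exists>a i y y'. y \<noteq> y' \<and> F q (pr a (pr i y)) \<and> F q (pr a (pr i y')))" for q
  have "dfn (\<lambda>e. U (e 0))" unfolding U_def by (intro dfn F(1))
  moreover have "\<not> U q" if "q \<in> G" for q using un F(3) that unfolding U_def by blast
  ultimately obtain p1 where p1: "p1 \<in> G" "\<And>q. q \<epsilon> P \<Longrightarrow> le q p1 \<Longrightarrow> \<not> U q"
    using dichotomy[of U] by blast
  define b where "b a = least (\<lambda>\<beta>. \<beta> \<epsilon> l \<and> (\<forall>q i. q \<epsilon> Fni (I a) \<longrightarrow> i \<epsilon> K \<longrightarrow> sndv (E a q i) \<epsilon> \<beta>))" for a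
  have db: "df1 b" unfolding df1_def b_def by (intro dfn dE df1_app[OF I(1)])
  note lD = infinite_cardinalD[OF l(1)]
  have b: "b a \<epsilon> l \<and> (\<forall>q i. q \<epsilon> Fni (I a) \<longrightarrow> i \<epsilon> K \<longrightarrow> sndv (E a q i) \<epsilon> b a)" if a: "a \<epsilon> A" for a
  proof -
    let ?d = "prod' (Fni (I a)) K"
    have "lep ?d \<kappa>"
      using lep_prod'[OF Fni_lep[OF I(3)[OF a]] K] lep_square[OF w kD(2,3)] lep_trans by blast
    moreover have "df1 (\<lambda>z. sndv (E a (fstv z) (sndv z)))" unfolding df1_def by (intro dfn dE)
    moreover have "sndv (E a (fstv z) (sndv z)) \<epsilon> l" if "z \<epsilon> ?d" for z
      using that EY unfolding mem_prod' mem_Fni by auto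
    ultimately obtain \<beta> where be: "\<beta> \<epsilon> l" "\<And>z. z \<epsilon> ?d \<Longrightarrow> sndv (E a (fstv z) (sndv z)) \<epsilon> \<beta>"
      using cofinality_bounded[OF l(2) lD(2) emp_inf[OF l(1)] l(3), of ?d "\<lambda>z. sndv (E a (fstv z) (sndv z))"]
      by blast
    have "sndv (E a q i) \<epsilon> \<beta>" if "q \<epsilon> Fni (I a)" "i \<epsilon> K" for q i using be(2)[of "pr q i"] that by simp
    then show ?thesis unfolding b_def
      using least_ordinal(2)[of \<beta> "\<lambda>\<beta>. \<beta> \<epsilon> l \<and> (\<forall>q i. q \<epsilon> Fni (I a) \<longrightarrow> i \<epsilon> K \<longrightarrow> sndv (E a q i) \<epsilon> \<beta>)"]
        be(1) ordinal_mem[OF lD(2)] by blast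
  qed
  have "y \<epsilon> b a" if a: "a \<epsilon> A" "i \<epsilon> K" and q: "Q (pr a (pr i y))" for a i y
  proof -
    obtain p where p: "p \<in> G" "F p (pr a (pr i y))" using q F(3) by blast
    obtain r1 where r1: "r1 \<in> G" "le r1 p" "le r1 p0" using G_common p(1) p0 by blast
    obtain r where r: "r \<in> G" "le r r1" "le r p1" using G_common r1(1) p1(1) by blast
    have rP: "r \<epsilon> P" "le r p0" "le r p" using G_P r le_trans r1 by blast+
    \<comment> \<open>The chosen extension of this restriction is compatible with r. Their union
      decides both y and the chosen value, and below p1 these agree.\<close>
    let ?q = "restr r (I a)" let ?z = "E a ?q i"
    have e: "fstv ?z \<epsilon> Fni (I a)" "le (un (fstv ?z) r) r" "un (fstv ?z) r \<epsilon> P" "F (fstv ?z) (pr a (pr i (sndv ?z)))"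
      using E[OF a rP(1,2)] by blast+
    have "le (un (fstv ?z) r) (fstv ?z)" unfolding le_def by (simp add: mem_un)
    then have "F (un (fstv ?z) r) (pr a (pr i (sndv ?z)))" using F(2)[OF e(4,3)] by blast
    moreover have "F (un (fstv ?z) r) (pr a (pr i y))"
      using F(2)[OF p(2) e(3)] le_trans[OF e(2) rP(3)] by blast
    moreover have "\<not> U (un (fstv ?z) r)" using p1(2)[OF e(3)] le_trans[OF e(2) r(3)] by blast
    ultimately have "y = sndv ?z" unfolding U_def by blast
    then show ?thesis using b[OF a(1)] restr_Fni[OF rP(1)] a(2) by blast
  qed
  then show thesis using that db b by blast
qed

text \<open>As \<open>P\<close> is \<open>\<kappa>\<close>-closed, all values of a short function can be decided by a single condition.\<close>

lemma short_bounded: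
  assumes \<gamma>: "\<gamma> \<epsilon> \<kappa>" and Q: "fcb (\<lambda>e. Q (e 0))"
    and un: "\<And>x y y'. Q (pr x y) \<Longrightarrow> Q (pr x y') \<Longrightarrow> y = y'"
  shows "\<exists>\<delta>. \<delta> \<epsilon> \<kappa> \<and> (\<forall>x y. x \<epsilon> \<gamma> \<longrightarrow> y \<epsilon> \<kappa> \<longrightarrow> Q (pr x y) \<longrightarrow> y \<epsilon> \<delta>)"
proof -
  obtain F where F: "\<And>t u. dt t \<Longrightarrow> dt u \<Longrightarrow> dfn (\<lambda>e. F (t e) (u e))"
    "\<And>p q x. F p x \<Longrightarrow> q \<epsilon> P \<Longrightarrow> le q p \<Longrightarrow> F q x" "\<And>x. Q x \<longleftrightarrow> (\<exists>p\<in>G. F p x)"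
    by (rule fc1E[OF Q]) (rule that)
  \<comment> \<open>The second alternative allows for places x at which the function has no
    value.\<close>
  define B where "B p \<longleftrightarrow> (\<forall>x. x \<epsilon> \<gamma> \<longrightarrow> (\<exists>y. y \<epsilon> \<kappa> \<and> F p (pr x y)) \<or>
    (\<forall>q y. q \<epsilon> P \<longrightarrow> le q p \<longrightarrow> y \<epsilon> \<kappa> \<longrightarrow> \<not> F q (pr x y)))" for p
  have dB: "dfn (\<lambda>e. B (e 0))" unfolding B_def by (intro dfn F(1))
  have og: "ordinal \<gamma>" using ordinal_mem[OF kD(2) \<gamma>] .
  have dense: "\<exists>q. q \<epsilon> P \<and> le q p0 \<and> B q" if p0: "p0 \<epsilon> P" for p0
  proof -
    obtain c where c: "\<And>x. x \<epsilon> pow P \<Longrightarrow> x \<noteq> emp \<Longrightarrow> app c x \<epsilon> x" using choice_function[of "pow P"] by blast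
    define S where "S \<xi> u = coll P (\<lambda>r. le r u \<and> (\<exists>y. y \<epsilon> \<kappa> \<and> F r (pr \<xi> y)))" for \<xi> u
    have dS: "dt (\<lambda>e. S (t e) (u e))" if "dt t" "dt u" for t u
    proof (rule dt_sub2[OF _ that])
      show "dt (\<lambda>e. S (e 0) (e 1))" unfolding S_def by (intro dfn F(1))
    qed
    have mS: "r \<epsilon> S \<xi> u \<longleftrightarrow> r \<epsilon> P \<and> le r u \<and> (\<exists>y. y \<epsilon> \<kappa> \<and> F r (pr \<xi> y))" for r \<xi> u
      unfolding S_def by (rule mem_coll) (intro dfn F(1))
    define N where "N \<xi> u = (if S \<xi> u = emp then u else app c (S \<xi> u))" for \<xi> u
    have dN: "dt (\<lambda>e. N (t e) (u e))" if "dt t" "dt u" for t u unfolding N_def by (intro dfn dS that)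
    have N: "N \<xi> u \<epsilon> P \<and> le (N \<xi> u) u \<and> (S \<xi> u \<noteq> emp \<longrightarrow> (\<exists>y. y \<epsilon> \<kappa> \<and> F (N \<xi> u) (pr \<xi> y)))" if "u \<epsilon> P" for \<xi> u
    proof (cases "S \<xi> u = emp")
      case True
      then show ?thesis using that le_refl by (simp add: N_def)
    next
      case False
      have "app c (S \<xi> u) \<epsilon> S \<xi> u" by (rule c[OF _ False]) (simp add: mem_pow mS)
      then show ?thesis unfolding mS using False by (simp add: N_def)
    qed
    have "df1 (\<lambda>f. N (im fstv f) (un p0 (Un' (im sndv f))))" unfolding df1_def by (intro dfn dN)
    then obtain H where H: "df1 H" "\<And>x. H x = N (im fstv (lam H x)) (un p0 (Un' (im sndv (lam H x))))"
      using recursion by blast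
    \<comment> \<open>u \<xi> is the union of p0 and the earlier conditions; stage \<xi> extends it
      to decide a value at \<xi>, if that is possible.\<close>
    define u where "u \<xi> = un p0 (Un' (im H \<xi>))" for \<xi>
    have Hx: "H \<xi> = N \<xi> (u \<xi>)" for \<xi>
    proof -
      have "im fstv (lam H \<xi>) = \<xi>" "im sndv (lam H \<xi>) = im H \<xi>"
        by (rule set_eqI; auto simp: mem_im[OF df_fstv] mem_im[OF df_sndv] mem_lam[OF H(1)] mem_im[OF H(1)])+
      then show ?thesis using H(2)[of \<xi>] unfolding u_def by simp
    qed
    have mu': "z \<epsilon> u \<xi> \<longleftrightarrow> z \<epsilon> p0 \<or> (\<exists>\<eta>. \<eta> \<epsilon> \<xi> \<and> z \<epsilon> H \<eta>)" for z \<xi>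
      unfolding u_def mem_un mem_Un' mem_im[OF H(1)] by blast
    have uP: "u \<xi> \<epsilon> P" if "\<xi> \<epsilon> \<kappa>" for \<xi>
      using that
    proof (induction \<xi> rule: wf_induct)
      case (step \<xi>)
      have ox: "ordinal \<xi>" using ordinal_mem[OF kD(2) step.prems] .
      have IH: "u \<eta> \<epsilon> P" "H \<eta> \<epsilon> P" "le (H \<eta>) (u \<eta>)" if "\<eta> \<epsilon> \<xi>" for \<eta>
        using step.IH[OF that k_trans[OF step.prems that]] N unfolding Hx[of \<eta>] by blast+
      have p0H: "z \<epsilon> H \<eta>" if "z \<epsilon> p0" "\<eta> \<epsilon> \<xi>" for z \<eta> using IH(3)[OF that(2)] that(1) mu' unfolding le_def by blast
      have chain: "z \<epsilon> H \<eta>" if "z \<epsilon> H \<zeta>" "\<zeta> \<epsilon> \<eta>" "\<eta> \<epsilon> \<xi>" for z \<zeta> \<eta>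
        using IH(3)[OF that(3)] that(1,2) mu' unfolding le_def by blast
      \<comment> \<open>The conditions form a chain, so two elements of the union lie in one common
        member; this makes the union a function.\<close>
      have tog: "z \<epsilon> p0 \<and> z' \<epsilon> p0 \<or> (\<exists>\<eta>. \<eta> \<epsilon> \<xi> \<and> z \<epsilon> H \<eta> \<and> z' \<epsilon> H \<eta>)" if zz: "z \<epsilon> u \<xi>" "z' \<epsilon> u \<xi>" for z z'
      proof -
        consider "z \<epsilon> p0" "z' \<epsilon> p0" | \<eta> where "z \<epsilon> p0" "\<eta> \<epsilon> \<xi>" "z' \<epsilon> H \<eta>" | \<eta> where "z' \<epsilon> p0" "\<eta> \<epsilon> \<xi>" "z \<epsilon> H \<eta>"
          | \<eta> \<zeta> where "\<eta> \<epsilon> \<xi>" "z \<epsilon> H \<eta>" "\<zeta> \<epsilon> \<xi>" "z' \<epsilon> H \<zeta>" using zz mu' by blast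
        then show ?thesis
        proof cases
          case 4
          then show ?thesis using ordinal_linear[of \<eta> \<zeta>] ordinal_mem[OF ox] chain by blast
        qed (use p0H in blast)+
      qed
      show ?case
      proof (subst mem_P, intro conjI allI impI)
        show "\<exists>x i. z = pr x i \<and> x \<epsilon> \<mu> \<and> (i = emp \<or> i = one)" if "z \<epsilon> u \<xi>" for z
          using that P_pair[OF p0] P_pair[OF IH(2)] unfolding mu' by blast
        show "i = i'" if "pr x i \<epsilon> u \<xi>" "pr x i' \<epsilon> u \<xi>" for x i i'
          using tog[OF that] P_fun[OF p0] P_fun[OF IH(2)] by blast
        have dd: "df1 (\<lambda>\<eta>. dom (H \<eta>))" unfolding df1_def by (intro dfn df1_app[OF H(1)])
        have "small \<kappa> \<xi>" unfolding small_def using step.prems lep_refl by blast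
        then have "small \<kappa> (Un' (im (\<lambda>\<eta>. dom (H \<eta>)) \<xi>))"
          using small_Union[OF _ dd] P_small[OF IH(2)] by blast
        then have "small \<kappa> (un (dom p0) (Un' (im (\<lambda>\<eta>. dom (H \<eta>)) \<xi>)))"
          using small_un[OF w k P_small[OF p0]] by blast
        moreover have "x \<epsilon> un (dom p0) (Un' (im (\<lambda>\<eta>. dom (H \<eta>)) \<xi>))" if "x \<epsilon> dom (u \<xi>)" for x
        proof -
          have 1: "x \<epsilon> Un' (im (\<lambda>\<eta>. dom (H \<eta>)) \<xi>) \<longleftrightarrow> (\<exists>\<eta>. \<eta> \<epsilon> \<xi> \<and> x \<epsilon> dom (H \<eta>))"
            unfolding mem_Un' mem_im[OF dd] by blast
          show ?thesis using that unfolding mem_un 1 unfolding dom_def mem_im[OF df_fstv] mu' by blast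
        qed
        ultimately show "small \<kappa> (dom (u \<xi>))" using small_subset by blast
      qed
    qed
    have q: "u \<gamma> \<epsilon> P" using uP \<gamma> by blast
    have "B (u \<gamma>)" unfolding B_def
    proof (intro allI impI)
      fix x assume x: "x \<epsilon> \<gamma>"
      have ux: "u x \<epsilon> P" using uP k_trans[OF \<gamma> x] by blast
      have lH: "le (u \<gamma>) (H x)" unfolding le_def mu' using x by blast
      show "(\<exists>y. y \<epsilon> \<kappa> \<and> F (u \<gamma>) (pr x y)) \<or> (\<forall>q y. q \<epsilon> P \<longrightarrow> le q (u \<gamma>) \<longrightarrow> y \<epsilon> \<kappa> \<longrightarrow> \<not> F q (pr x y))"
      proof (cases "S x (u x) = emp")
        case True
        have "\<not> F r (pr x y)" if "r \<epsilon> P" "le r (u \<gamma>)" "y \<epsilon> \<kappa>" for r y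
        proof
          assume "F r (pr x y)"
          moreover have "le r (u x)" using that(2) lH N[OF ux, of x] unfolding Hx[of x] by (blast intro: le_trans)
          ultimately have "r \<epsilon> S x (u x)" using that mS by blast
          then show False using True not_mem_emp by metis
        qed
        then show ?thesis by blast
      next
        case False
        then obtain y where "y \<epsilon> \<kappa>" "F (H x) (pr x y)" using N[OF ux, of x] unfolding Hx[of x] by blast
        then show ?thesis using F(2) q lH by blast
      qed
    qed
    moreover have "le (u \<gamma>) p0" unfolding le_def mu' by blast
    ultimately show ?thesis using q by blast
  qed
  obtain p where p: "p \<in> G" "B p" using dichotomy[OF dB] dense G_P by blast
  define Y where "Y x = least (\<lambda>y. y \<epsilon> \<kappa> \<and> F p (pr x y))" for x
  \<comment> \<open>\<open>emp\<close> stands in where p decides no value, to give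
    \<open>cofinality_bounded\<close> a total function into \<kappa>.\<close>
  define Y' where "Y' x = (if \<exists>y. y \<epsilon> \<kappa> \<and> F p (pr x y) then Y x else emp)" for x
  have dY: "df1 Y'" unfolding df1_def Y'_def Y_def by (intro dfn F(1))
  have Y: "Y x \<epsilon> \<kappa> \<and> F p (pr x (Y x))" if ex: "\<exists>y. y \<epsilon> \<kappa> \<and> F p (pr x y)" for x
  proof -
    obtain y where "y \<epsilon> \<kappa>" "F p (pr x y)" using ex by blast
    then show ?thesis unfolding Y_def
      using least_ordinal(2)[of y "\<lambda>y. y \<epsilon> \<kappa> \<and> F p (pr x y)"] ordinal_mem[OF kD(2)] by blast
  qed
  have "Y' x \<epsilon> \<kappa>" for x unfolding Y'_def using Y emp_inf[OF k] by auto
  then obtain \<delta> where d: "\<delta> \<epsilon> \<kappa>" "\<And>x. x \<epsilon> \<gamma> \<Longrightarrow> Y' x \<epsilon> \<delta>"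
    using cofinality_bounded[OF cfk kD(2) emp_inf[OF k] \<gamma> lep_refl dY] by blast
  have "y \<epsilon> \<delta>" if xy: "x \<epsilon> \<gamma>" "y \<epsilon> \<kappa>" "Q (pr x y)" for x y
  proof -
    obtain p' where p': "p' \<in> G" "F p' (pr x y)" using xy(3) F(3) by blast
    obtain r where r: "r \<in> G" "le r p" "le r p'" using G_common p(1) p'(1) by blast
    have "F r (pr x y)" using F(2)[OF p'(2) G_P[OF r(1)] r(3)] .
    then have ex: "\<exists>y. y \<epsilon> \<kappa> \<and> F p (pr x y)" using p(2) xy r(2) G_P[OF r(1)] unfolding B_def by blast
    then have "Q (pr x (Y x))" using Y F(3) p(1) by blast
    then have "y = Y' x" using un[OF xy(3)] ex unfolding Y'_def by simp
    then show ?thesis using d(2) xy(1) by blast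
  qed
  then show ?thesis using d(1) by blast
qed

end

section \<open>Stationary sets in the extension\<close>

context forcing
begin

section \<open>Notions of V[G] as relations definable over (V, G)\<close>

lemma Wmem: "x \<in> W.elts a \<longleftrightarrow> x \<epsilon>\<^sub>G a" by (simp add: W.elts_def)

lemma Welts_eq: "W.elts u = A \<longleftrightarrow> (\<forall>y. y \<epsilon>\<^sub>G u \<longleftrightarrow> y \<in> A)"
  by (auto simp: W.elts_def)

lemma fc_wsub3:
  assumes "fcb (\<lambda>e. R (V (e 0)) (V (e 1)) (V (e 2)))" "wt t" "wt u" "wt v"
  shows "fcb (\<lambda>e. R (t e) (u e) (v e))"
proof -
  obtain t' u' v' where d: "dt t'" "dt u'" "dt v'" and "t = (\<lambda>e. V (t' e))" "u = (\<lambda>e. V (u' e))" "v = (\<lambda>e. V (v' e))"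
    using assms(2-4) unfolding wt_def by blast
  then show ?thesis using fc_sub3[of "\<lambda>x y z. R (V x) (V y) (V z)", OF assms(1) d] by simp
qed

lemma fc_wsub2:
  assumes "fcb (\<lambda>e. R (V (e 0)) (V (e 1)))" "wt t" "wt u" shows "fcb (\<lambda>e. R (t e) (u e))"
proof -
  obtain t' u' where d: "dt t'" "dt u'" and "t = (\<lambda>e. V (t' e))" "u = (\<lambda>e. V (u' e))"
    using assms(2-3) unfolding wt_def by blast
  then show ?thesis using fc_sub2[of "\<lambda>x y. R (V x) (V y)", OF assms(1) d] by simp
qed

lemma fc_wsub1:
  assumes "fcb (\<lambda>e. R (V (e 0)))" "wt t" shows "fcb (\<lambda>e. R (t e))"
  using fc_wsub2[of "\<lambda>x y. R x", OF assms(1) assms(2,2)] .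

lemma is_opair_iff': "W.is_opair z x y \<longleftrightarrow> (\<exists>u v. (\<forall>a. a \<epsilon>\<^sub>G u \<longleftrightarrow> a = x) \<and>
    (\<forall>a. a \<epsilon>\<^sub>G v \<longleftrightarrow> a = x \<or> a = y) \<and> (\<forall>a. a \<epsilon>\<^sub>G z \<longleftrightarrow> a = u \<or> a = v))"
  unfolding W.is_opair_def Welts_eq by auto

lemma fc_is_opair'[fc]: "wt t \<Longrightarrow> wt u \<Longrightarrow> wt v \<Longrightarrow> fcb (\<lambda>e. W.is_opair (t e) (u e) (v e))"
  by (rule fc_wsub3) (auto simp: is_opair_iff' intro!: fc dfn)

lemma fc_maps'[fc]: "wt t \<Longrightarrow> wt u \<Longrightarrow> wt v \<Longrightarrow> fcb (\<lambda>e. W.maps (t e) (u e) (v e))"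
  by (rule fc_wsub3) (auto simp: W.maps_def Bex_def Wmem intro!: fc dfn)

lemma fc_transitive'[fc]: "wt t \<Longrightarrow> fcb (\<lambda>e. W.transitive (t e))"
  by (rule fc_wsub1) (auto simp: W.transitive_def Ball_def subset_eq Wmem intro!: fc dfn)

lemma fc_ordinal'[fc]: "wt t \<Longrightarrow> fcb (\<lambda>e. W.ordinal (t e))"
  by (rule fc_wsub1) (auto simp: W.ordinal_def Ball_def Wmem intro!: fc dfn)

lemma limit_ordinal_iff': "W.limit_ordinal a \<longleftrightarrow>
    W.ordinal a \<and> (\<exists>x. x \<epsilon>\<^sub>G a) \<and> (\<forall>x. x \<epsilon>\<^sub>G a \<longrightarrow> (\<exists>y. y \<epsilon>\<^sub>G a \<and> x \<epsilon>\<^sub>G y))"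
  unfolding W.limit_ordinal_def by (auto simp: W.elts_def)

lemma fc_limit_ordinal'[fc]: "wt t \<Longrightarrow> fcb (\<lambda>e. W.limit_ordinal (t e))"
  by (rule fc_wsub1) (auto simp: limit_ordinal_iff' intro!: fc dfn)

lemma unbounded_in_iff': "W.unbounded_in c d \<longleftrightarrow>
    (\<forall>x. x \<epsilon>\<^sub>G d \<longrightarrow> (\<exists>y. y \<epsilon>\<^sub>G c \<and> y \<epsilon>\<^sub>G d \<and> x \<epsilon>\<^sub>G y))"
  unfolding W.unbounded_in_def by (auto simp: W.elts_def)

lemma fc_unbounded_in'[fc]: "wt t \<Longrightarrow> wt u \<Longrightarrow> fcb (\<lambda>e. W.unbounded_in (t e) (u e))"
  by (rule fc_wsub2) (auto simp: unbounded_in_iff' intro!: fc dfn)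

lemma club_iff': "W.club c l \<longleftrightarrow> (\<forall>x. x \<epsilon>\<^sub>G c \<longrightarrow> x \<epsilon>\<^sub>G l) \<and> W.unbounded_in c l \<and>
    (\<forall>d. d \<epsilon>\<^sub>G l \<longrightarrow> W.limit_ordinal d \<and> W.unbounded_in c d \<longrightarrow> d \<epsilon>\<^sub>G c)"
  unfolding W.club_def by (auto simp: W.elts_def)

lemma fc_club'[fc]: "wt t \<Longrightarrow> wt u \<Longrightarrow> fcb (\<lambda>e. W.club (t e) (u e))"
  by (rule fc_wsub2) (auto simp: club_iff' intro!: fc dfn)

lemma stationary_iff': "W.stationary a l \<longleftrightarrow> (\<forall>x. x \<epsilon>\<^sub>G a \<longrightarrow> x \<epsilon>\<^sub>G l) \<and>
    (\<forall>c. W.club c l \<longrightarrow> (\<exists>x. x \<epsilon>\<^sub>G a \<and> x \<epsilon>\<^sub>G c))"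
  unfolding W.stationary_def by (auto simp: W.elts_def)

lemma fc_stationary'[fc]: "wt t \<Longrightarrow> wt u \<Longrightarrow> fcb (\<lambda>e. W.stationary (t e) (u e))"
  by (rule fc_wsub2) (auto simp: stationary_iff' intro!: fc dfn)

section \<open>Pairs, functions, and subsets of ground model sets in V[G]\<close>

lemma mem_V_name: "name P t \<Longrightarrow> x \<epsilon>\<^sub>G V t \<longleftrightarrow> (\<exists>s p. pr s p \<epsilon> t \<and> p \<in> G \<and> x = V s)"
  unfolding mem_V by (simp add: nm_def)

definition upn :: "'v \<Rightarrow> 'v \<Rightarrow> 'v" where "upn s t = up (pr (nm s) emp) (pr (nm t) emp)"
definition opn :: "'v \<Rightarrow> 'v \<Rightarrow> 'v" where "opn s t = upn (upn s s) (upn s t)"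

lemma dt_upn[dfn]: "dt t \<Longrightarrow> dt u \<Longrightarrow> dt (\<lambda>e. upn (t e) (u e))" unfolding upn_def by (intro dfn)
lemma dt_opn[dfn]: "dt t \<Longrightarrow> dt u \<Longrightarrow> dt (\<lambda>e. opn (t e) (u e))" unfolding opn_def by (intro dfn)

lemma mem_upn: "z \<epsilon>\<^sub>G V (upn s t) \<longleftrightarrow> z = V s \<or> z = V t"
proof -
  have "name P (upn s t)" unfolding upn_def
    by (subst name_iff) (use nm_name emp_P in \<open>auto simp: mem_up\<close>)
  then have "z \<epsilon>\<^sub>G V (upn s t) \<longleftrightarrow> (\<exists>s' p. pr s' p \<epsilon> upn s t \<and> p \<in> G \<and> z = V s')" by (rule mem_V_name)
  then show ?thesis unfolding upn_def mem_up pr_inject using emp_G V_nm by metis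
qed

lemma is_opair_opn: "W.is_opair (V (opn s t)) (V s) (V t)"
  unfolding is_opair_iff' opn_def
  by (rule exI[of _ "V (upn s s)"], rule exI[of _ "V (upn s t)"]) (auto simp: mem_upn)

lemma pair_ex': obtains e where "W.elts e = {x, y}"
proof -
  obtain s t where "x = V s" "y = V t" using V_surj by metis
  then have "W.elts (V (upn s t)) = {x, y}" by (auto simp: W.elts_def mem_upn)
  then show thesis by (rule that)
qed

lemma is_opair_inj': "W.is_opair z x y \<Longrightarrow> W.is_opair z x' y' \<Longrightarrow> x = x' \<and> y = y'"
  unfolding W.is_opair_def by (smt (verit) doubleton_eq_iff insert_absorb2)

text \<open>A function in V[G] is described by a relation R between arguments and elements N of a
  ground model set, with values named by h N. The set Ns bounds the values so that
  \<open>comprehension\<close> applies; several N may be related to one argument if their values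
  agree.\<close>

lemma make_fun:
  assumes h: "df1 h" and R: "fcb (\<lambda>e. R (V (e 0)) (e 1))"
    and ex: "\<And>x. x \<epsilon>\<^sub>G X \<Longrightarrow> \<exists>N. N \<epsilon> Ns \<and> R x N"
    and un: "\<And>x N N'. x \<epsilon>\<^sub>G X \<Longrightarrow> N \<epsilon> Ns \<Longrightarrow> N' \<epsilon> Ns \<Longrightarrow> R x N \<Longrightarrow> R x N' \<Longrightarrow> V (h N) = V (h N')"
  obtains f where "W.fun_on f X"
    "\<And>x y. W.maps f x y \<longleftrightarrow> x \<epsilon>\<^sub>G X \<and> (\<exists>N. N \<epsilon> Ns \<and> R x N \<and> y = V (h N))"
proof -
  obtain tX where tX: "X = V tX" by (rule V_surj)
  \<comment> \<open>Every element of X is the value of a first coordinate of the name tX, so these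
    pairs include all candidates.\<close>
  define a where "a = prod' (im fstv (nm tX)) Ns"
  have d1: "df1 (\<lambda>z. opn (fstv z) (h (sndv z)))" unfolding df1_def by (intro dfn df1_app[OF h])
  have d2: "fcb (\<lambda>e. V (fstv (e 0)) \<epsilon>\<^sub>G X \<and> R (V (fstv (e 0))) (sndv (e 0)))"
    by (intro fc dfn fc_sub2[OF R])
  obtain f where f: "\<And>z. z \<epsilon>\<^sub>G f \<longleftrightarrow> (\<exists>x. x \<epsilon> a \<and> (V (fstv x) \<epsilon>\<^sub>G X \<and> R (V (fstv x)) (sndv x)) \<and>
      z = V (opn (fstv x) (h (sndv x))))"
    by (rule comprehension[OF d1 d2, of a]) (rule that)
  have f': "z \<epsilon>\<^sub>G f \<longleftrightarrow> (\<exists>s N. s \<epsilon> im fstv (nm tX) \<and> N \<epsilon> Ns \<and> V s \<epsilon>\<^sub>G X \<and> R (V s) N \<and> z = V (opn s (h N)))" for z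
    unfolding f a_def mem_prod' by fastforce
  have s: "\<exists>s. s \<epsilon> im fstv (nm tX) \<and> x = V s" if "x \<epsilon>\<^sub>G X" for x
    using that unfolding tX mem_V mem_im[OF df_fstv] by (metis fstv_pr)
  have m: "W.maps f x y \<longleftrightarrow> x \<epsilon>\<^sub>G X \<and> (\<exists>N. N \<epsilon> Ns \<and> R x N \<and> y = V (h N))" for x y
  proof
    assume "W.maps f x y"
    then obtain s N where "N \<epsilon> Ns" "V s \<epsilon>\<^sub>G X" "R (V s) N" "W.is_opair (V (opn s (h N))) x y"
      unfolding W.maps_def Bex_def Wmem f' by blast
    moreover from this have "x = V s \<and> y = V (h N)" using is_opair_opn is_opair_inj' by blast
    ultimately show "x \<epsilon>\<^sub>G X \<and> (\<exists>N. N \<epsilon> Ns \<and> R x N \<and> y = V (h N))" by blast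
  next
    assume a: "x \<epsilon>\<^sub>G X \<and> (\<exists>N. N \<epsilon> Ns \<and> R x N \<and> y = V (h N))"
    then obtain t where "t \<epsilon> im fstv (nm tX)" "x = V t" using s by blast
    then show "W.maps f x y" unfolding W.maps_def Bex_def Wmem f' using a is_opair_opn by blast
  qed
  have "W.fun_on f X" unfolding W.fun_on_def W.partial_fun_on_def m Ball_def Bex_def Wmem
  proof (intro conjI allI impI)
    fix z assume "z \<epsilon>\<^sub>G f"
    then obtain s N where "V s \<epsilon>\<^sub>G X" "z = V (opn s (h N))" unfolding f' by blast
    then show "\<exists>x. x \<epsilon>\<^sub>G X \<and> (\<exists>y. W.is_opair z x y)" using is_opair_opn by blast
  qed (use ex un in blast)+
  then show thesis using that m by blast
qed

lemma fun_into'D: "W.fun_into f a b \<Longrightarrow> x \<epsilon>\<^sub>G a \<Longrightarrow> \<exists>y. y \<epsilon>\<^sub>G b \<and> W.maps f x y"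
  unfolding W.fun_into_def W.fun_on_def Ball_def Wmem by blast

lemma maps'_unique: "W.fun_on f a \<Longrightarrow> W.maps f x y \<Longrightarrow> W.maps f x y' \<Longrightarrow> y = y'"
  unfolding W.fun_on_def W.partial_fun_on_def by blast

lemma maps'_dom: "W.fun_on f a \<Longrightarrow> W.maps f x y \<Longrightarrow> x \<epsilon>\<^sub>G a"
  unfolding W.fun_on_def W.partial_fun_on_def W.maps_def Ball_def Bex_def Wmem
  using is_opair_inj' by metis

lemma bijection'D:
  assumes "W.bijection f a b"
  shows "W.fun_on f a" "\<And>x. x \<epsilon>\<^sub>G a \<Longrightarrow> \<exists>y. y \<epsilon>\<^sub>G b \<and> W.maps f x y"
    "\<And>y. y \<epsilon>\<^sub>G b \<Longrightarrow> \<exists>x. x \<epsilon>\<^sub>G a \<and> W.maps f x y" "\<And>x y. W.maps f x y \<Longrightarrow> y \<epsilon>\<^sub>G b"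
    "\<And>x x' y. W.maps f x y \<Longrightarrow> W.maps f x' y \<Longrightarrow> x = x'"
proof -
  have f: "W.fun_into f a b" "\<forall>y. y \<epsilon>\<^sub>G b \<longrightarrow> (\<exists>!x. W.maps f x y)"
    using assms unfolding W.bijection_def Ball_def Wmem by blast+
  show on: "W.fun_on f a" using f(1) unfolding W.fun_into_def by blast
  show "\<exists>y. y \<epsilon>\<^sub>G b \<and> W.maps f x y" if "x \<epsilon>\<^sub>G a" for x using fun_into'D[OF f(1) that] .
  show "\<exists>x. x \<epsilon>\<^sub>G a \<and> W.maps f x y" if "y \<epsilon>\<^sub>G b" for y
  proof -
    obtain x where "W.maps f x y" using f(2) \<open>y \<epsilon>\<^sub>G b\<close> by (blast elim: ex1E)
    then show ?thesis using maps'_dom[OF on] by blast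
  qed
  show b: "\<And>x y. W.maps f x y \<Longrightarrow> y \<epsilon>\<^sub>G b" using f(1) unfolding W.fun_into_def by blast
  show "x = x'" if "W.maps f x y" "W.maps f x' y" for x x' y using f(2) b that by (blast elim: ex1E)
qed

text \<open>\<open>hat N\<close> is the name \<open>{(\<xi>\<^sup>\<or>, p) | (\<xi>, p) \<in> N}\<close>; these are enough for subsets of ground model sets.\<close>

definition hat :: "'v \<Rightarrow> 'v" where "hat N = im (\<lambda>z. pr (chk (fstv z)) (sndv z)) N"

lemma dt_hat[dfn]: "dt t \<Longrightarrow> dt (\<lambda>e. hat (t e))" unfolding hat_def by (intro dfn)

lemma mem_hat: assumes "N \<epsilon> pow (prod' a P)"
  shows "x \<epsilon>\<^sub>G V (hat N) \<longleftrightarrow> (\<exists>\<xi> p. pr \<xi> p \<epsilon> N \<and> p \<in> G \<and> x = j \<xi>)"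
proof -
  have d: "df1 (\<lambda>z. pr (chk (fstv z)) (sndv z))" unfolding df1_def by (intro dfn)
  have N: "\<exists>\<xi> p. z = pr \<xi> p \<and> p \<epsilon> P" if "z \<epsilon> N" for z
    using assms that unfolding mem_pow mem_prod' by blast
  have m: "z \<epsilon> hat N \<longleftrightarrow> (\<exists>\<xi> p. pr \<xi> p \<epsilon> N \<and> z = pr (chk \<xi>) p)" for z
    unfolding hat_def mem_im[OF d]
  proof
    assume "\<exists>x. x \<epsilon> N \<and> z = pr (chk (fstv x)) (sndv x)"
    then show "\<exists>\<xi> p. pr \<xi> p \<epsilon> N \<and> z = pr (chk \<xi>) p" using N by fastforce
  next
    assume "\<exists>\<xi> p. pr \<xi> p \<epsilon> N \<and> z = pr (chk \<xi>) p"
    then obtain \<xi> p where "pr \<xi> p \<epsilon> N" "z = pr (chk \<xi>) p" by blast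
    then show "\<exists>x. x \<epsilon> N \<and> z = pr (chk (fstv x)) (sndv x)" by (intro exI[of _ "pr \<xi> p"]) simp
  qed
  have "name P (hat N)"
  proof (subst name_iff, intro allI impI)
    fix z assume "z \<epsilon> hat N"
    then obtain \<xi> p where z: "pr \<xi> p \<epsilon> N" "z = pr (chk \<xi>) p" unfolding m by blast
    then have "p \<epsilon> P" using N[OF z(1)] by simp
    then show "\<exists>s p. z = pr s p \<and> name P s \<and> p \<epsilon> P" using name_chk z by blast
  qed
  then show ?thesis unfolding mem_V_name[OF \<open>name P (hat N)\<close>] m j_def pr_inject by blast
qed

text \<open>The name consists of the pairs (x, p) for which p is a witness, as in
  \<open>fcb\<close>, that x belongs to y. Hence the subsets of j a in V[G] are indexed by a set of
  V, which can be well-ordered there.\<close>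

lemma hat_surj:
  assumes "\<And>x. x \<epsilon>\<^sub>G y \<Longrightarrow> x \<epsilon>\<^sub>G j a" shows "\<exists>N. N \<epsilon> pow (prod' a P) \<and> y = V (hat N)"
proof -
  have "fcb (\<lambda>e. j (e 0) \<epsilon>\<^sub>G y)" by (intro fc dfn)
  then obtain F where F: "\<And>t u. dt t \<Longrightarrow> dt u \<Longrightarrow> dfn (\<lambda>e. F (t e) (u e))"
    "\<And>x. j x \<epsilon>\<^sub>G y \<longleftrightarrow> (\<exists>p\<in>G. F p x)" by (rule fc1E) (rule that)
  define N where "N = coll (prod' a P) (\<lambda>z. F (sndv z) (fstv z))"
  have mN: "z \<epsilon> N \<longleftrightarrow> z \<epsilon> prod' a P \<and> F (sndv z) (fstv z)" for z
    unfolding N_def by (rule mem_coll) (intro dfn F(1))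
  have N: "N \<epsilon> pow (prod' a P)" unfolding mem_pow mN by blast
  have "y = V (hat N)"
  proof (rule ext'I)
    fix x show "x \<epsilon>\<^sub>G y \<longleftrightarrow> x \<epsilon>\<^sub>G V (hat N)"
      unfolding mem_hat[OF N] mN pr_mem_prod' fstv_pr sndv_pr using assms[of x] F(2) G_P mem_j by metis
  qed
  then show ?thesis using N by blast
qed

lemma j_ordinal: assumes "ordinal x" shows "W.ordinal (j x)"
proof -
  have t: "W.transitive (j x)" if "transitive x" for x
    using that unfolding transitive_iff W.transitive_def by (auto simp: Wmem mem_j)
  show ?thesis using assms unfolding ordinal_def W.ordinal_def Ball_def Wmem mem_j mem_elts
    using t by blast
qed

lemma j_limit_ordinal: "limit_ordinal x \<Longrightarrow> W.limit_ordinal (j x)"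
  unfolding limit_ordinal_iff' limit_ordinal_iff mem_j using j_ordinal j_mem mem_succ by blast

end

section \<open>Closure points of ground model functions\<close>

context fn_poset
begin

text \<open>\<delta> is the supremum of \<omega> stages, each containing the b-values of the earlier
  ones. It stays below l because l is regular and \<omega> \<le> \<kappa> < l.\<close>

lemma closure_point:
  assumes l: "infinite_cardinal l" "cofinality l l" "\<kappa> \<epsilon> l" and b: "df1 b" "\<And>x. x \<epsilon> l \<Longrightarrow> b x \<epsilon> l"
  obtains \<delta> where "\<delta> \<epsilon> l" "limit_ordinal \<delta>" "\<And>x. x \<epsilon> \<delta> \<Longrightarrow> b x \<epsilon> \<delta>"
proof -
  note lD = infinite_cardinalD[OF l(1)]
  note bounded = cofinality_bounded[OF l(2) lD(2) emp_inf[OF l(1)]]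
  have lsucc: "succ x \<epsilon> l" if "x \<epsilon> l" for x using infinite_cardinal_limit[OF w l(1) that] .
  have ow: "ordinal w" using omega_ordinal[OF w] .
  have wl: "w \<epsilon> l"
    using infinite_ordinal_omega[OF w kD(2)] kD(3) ordinal_subset[OF ow kD(2)] l(3) ordinal_trans[OF lD(2)] by blast
  \<comment> \<open>\<open>succ emp\<close> makes the stages nonempty, \<open>succ (b x)\<close>
    puts b x into the next stage, and \<open>succ (succ x)\<close> puts in succ x, which makes
    \<delta> a limit.\<close>
  define K where "K s = un (succ emp) (Un' (im (\<lambda>x. un (succ (b x)) (succ (succ x))) (Un' s)))" for s
  have dK: "df1 K" unfolding df1_def K_def by (intro dfn df1_app[OF b(1)])
  obtain F where F: "df1 F" "\<And>x. F x = K (im F x)" by (rule enumeration[OF dK]) (rule that)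
  have d: "df1 (\<lambda>x. un (succ (b x)) (succ (succ x)))" unfolding df1_def by (intro dfn df1_app[OF b(1)])
  have mF: "y \<epsilon> F n \<longleftrightarrow> y = emp \<or> (\<exists>m x. m \<epsilon> n \<and> x \<epsilon> F m \<and> (y \<epsilon> succ (b x) \<or> y \<epsilon> succ (succ x)))" for y n
  proof -
    have "x \<epsilon> Un' (im F n) \<longleftrightarrow> (\<exists>m. m \<epsilon> n \<and> x \<epsilon> F m)" for x unfolding mem_Un' mem_im[OF F(1)] by blast
    then have "y \<epsilon> Un' (im (\<lambda>x. un (succ (b x)) (succ (succ x))) (Un' (im F n))) \<longleftrightarrow>
      (\<exists>m x. m \<epsilon> n \<and> x \<epsilon> F m \<and> (y \<epsilon> succ (b x) \<or> y \<epsilon> succ (succ x)))"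
      unfolding mem_Un'[of y] mem_im[OF d] mem_un[symmetric] by blast
    then show ?thesis using F(2)[of n] by (simp add: K_def mem_un mem_succ[of y emp] not_mem_emp)
  qed
  have Fl: "F n \<epsilon> l" if "n \<epsilon> w" for n
    using that
  proof (induction n rule: wf_induct)
    case (step n)
    have IH: "F m \<epsilon> l" if "m \<epsilon> n" for m using step that ordinal_trans[OF ow] by blast
    have nl: "n \<epsilon> l" using step.prems ordinal_trans[OF lD(2) wl] by blast
    obtain \<beta> where be: "\<beta> \<epsilon> l" "\<And>m. m \<epsilon> n \<Longrightarrow> F m \<epsilon> \<beta>" using bounded[OF nl lep_refl F(1)] IH by blast
    have ob: "ordinal \<beta>" using ordinal_mem[OF lD(2) be(1)] .
    obtain \<gamma> where ga: "\<gamma> \<epsilon> l" "\<And>x. x \<epsilon> \<beta> \<Longrightarrow> b x \<epsilon> \<gamma>"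
      using bounded[OF be(1) lep_refl b(1)] b(2) ordinal_trans[OF lD(2) be(1)] by blast
    have og: "ordinal \<gamma>" using ordinal_mem[OF lD(2) ga(1)] .
    have x: "ordinal x \<and> b x \<epsilon> \<gamma> \<and> succ x \<epsilon> succ \<beta> \<and> x \<epsilon> l" if "m \<epsilon> n" "x \<epsilon> F m" for m x
    proof -
      have xb: "x \<epsilon> \<beta>" using ordinal_trans[OF ob be(2)[OF that(1)] that(2)] .
      then have ox: "ordinal x" using ordinal_mem[OF ob] by blast
      have "succ x \<epsilon> succ \<beta>"
        using ordinal_linear[OF ordinal_succ[OF ox] ordinal_succ[OF ob]] xb mem_succ mem_irrefl mem_asym
          ordinal_trans[OF ob] by metis
      then show ?thesis using ox ga(2)[OF xb] xb ordinal_trans[OF lD(2) be(1)] by blast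
    qed
    have o: "ordinal (F n)"
    proof (rule ordinalI)
      fix y assume "y \<epsilon> F n"
      then consider "y = emp" | m x where "m \<epsilon> n" "x \<epsilon> F m" "y \<epsilon> succ (b x) \<or> y \<epsilon> succ (succ x)"
        unfolding mF[of y n] by blast
      note c = this
      show "ordinal y"
        using c
      proof cases
        case 2
        then have "ordinal (succ (b x))" "ordinal (succ (succ x))"
          using x[OF 2(1,2)] ordinal_mem[OF og] ordinal_succ by blast+
        then show ?thesis using 2(3) ordinal_mem by blast
      qed (simp add: ordinal_emp)
      fix z assume z: "z \<epsilon> y"
      show "z \<epsilon> F n"
        using c
      proof cases
        case 2
        then have "ordinal (succ (b x))" "ordinal (succ (succ x))"
          using x[OF 2(1,2)] ordinal_mem[OF og] ordinal_succ by blast+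
        then have "z \<epsilon> succ (b x) \<or> z \<epsilon> succ (succ x)" using 2(3) z ordinal_trans by blast
        then show ?thesis unfolding mF[of z n] using 2 by blast
      qed (use z not_mem_emp in blast)
    qed
    \<comment> \<open>\<beta> exceeds the earlier stages and \<gamma> the values of b on \<beta>, so
      \<epsilon>' is an ordinal below l that includes stage n.\<close>
    define \<epsilon>' where "\<epsilon>' = un (succ \<gamma>) (succ (succ \<beta>))"
    have oe: "ordinal \<epsilon>'" unfolding \<epsilon>'_def using ordinal_un ordinal_succ og ob by blast
    have "\<epsilon>' = succ \<gamma> \<or> \<epsilon>' = succ (succ \<beta>)"
    proof -
      have o2: "ordinal (succ \<gamma>)" "ordinal (succ (succ \<beta>))" using ordinal_succ og ob by blast+
      show ?thesis unfolding \<epsilon>'_def using ordinal_linear[OF o2]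
        by (elim disjE) (auto intro!: set_eqI simp: mem_un dest: ordinal_trans[OF o2(1)] ordinal_trans[OF o2(2)])
    qed
    then have el: "\<epsilon>' \<epsilon> l" using lsucc ga(1) be(1) by auto
    have "elts (F n) \<subseteq> elts \<epsilon>'"
    proof
      fix y assume "y \<in> elts (F n)"
      then consider "y = emp" | m x where "m \<epsilon> n" "x \<epsilon> F m" "y \<epsilon> succ (b x) \<or> y \<epsilon> succ (succ x)"
        unfolding mem_elts mF[of y n] by blast
      then have "y \<epsilon> \<epsilon>'"
      proof cases
        case 1
        have "\<gamma> \<epsilon> \<epsilon>'" by (simp add: \<epsilon>'_def mem_un mem_succ)
        then show ?thesis using ordinal_emp_mem[OF oe] 1 by blast
      next
        case 2
        have "b x \<epsilon> \<gamma>" "succ x \<epsilon> succ \<beta>" using x[OF 2(1,2)] by blast+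
        then show ?thesis using 2(3) ordinal_trans[OF og] ordinal_trans[OF ordinal_succ[OF ob]]
          unfolding \<epsilon>'_def mem_un mem_succ[of y "b x"] mem_succ[of y "succ x"] mem_succ[of y \<gamma>] mem_succ[of y "succ \<beta>"]
          by blast
      qed
      then show "y \<in> elts \<epsilon>'" by (simp add: mem_elts)
    qed
    then show ?case using ordinal_subset[OF o oe] el ordinal_trans[OF lD(2) el] by blast
  qed
  define \<delta> where "\<delta> = Un' (im F w)"
  have md: "x \<epsilon> \<delta> \<longleftrightarrow> (\<exists>n. n \<epsilon> w \<and> x \<epsilon> F n)" for x unfolding \<delta>_def mem_Un' mem_im[OF F(1)] by blast
  have oF: "ordinal (F n)" if "n \<epsilon> w" for n using ordinal_mem[OF lD(2) Fl[OF that]] .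
  have od: "ordinal \<delta>" unfolding \<delta>_def using ordinal_Un' oF mem_im[OF F(1)] by metis
  obtain \<beta> where be: "\<beta> \<epsilon> l" "\<And>n. n \<epsilon> w \<Longrightarrow> F n \<epsilon> \<beta>" using bounded[OF wl lep_refl F(1)] Fl by blast
  have ob: "ordinal \<beta>" using ordinal_mem[OF lD(2) be(1)] .
  have "x \<epsilon> \<beta>" if "x \<epsilon> \<delta>" for x using that be(2) ordinal_trans[OF ob] unfolding md by blast
  then have "elts \<delta> \<subseteq> elts \<beta>" by (auto simp: mem_elts)
  then have "\<delta> \<epsilon> l" using ordinal_subset[OF od ob] be(1) ordinal_trans[OF lD(2) be(1)] by blast
  moreover have "emp \<epsilon> \<delta>" unfolding md using mF[of emp emp] omega_emp[OF w] by blast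
  moreover have "b x \<epsilon> \<delta> \<and> succ x \<epsilon> \<delta>" if x: "x \<epsilon> \<delta>" for x
  proof -
    obtain n where n: "n \<epsilon> w" "x \<epsilon> F n" using x md by blast
    then have "b x \<epsilon> F (succ n)" "succ x \<epsilon> F (succ n)"
      using mF[of "b x" "succ n"] mF[of "succ x" "succ n"] mem_succ by blast+
    then show ?thesis unfolding md using omega_succ[OF w n(1)] by blast
  qed
  ultimately show thesis using that[of \<delta>] od limit_ordinal_iff by blast
qed

end

context fn_forcing
begin

text \<open>Otherwise choose for each piece a club avoiding it, by the least name in a well-order of \<open>V\<close>, and let
  \<open>b\<close> be a ground model function bounding the next elements of all these clubs.  A closure point
  of \<open>b\<close> then belongs to every club, hence to no piece.\<close>

theorem pigeonhole:
  assumes l: "infinite_cardinal l" "cofinality l l" "\<kappa> \<epsilon> l" and T: "lep T \<kappa>"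
    and n: "df1 n" "\<And>t. t \<epsilon> T \<Longrightarrow> n t \<epsilon> pow (prod' l P)"
    and cov: "\<And>\<xi>. \<xi> \<epsilon> l \<Longrightarrow> \<exists>t. t \<epsilon> T \<and> j \<xi> \<epsilon>\<^sub>G V (hat (n t))"
  shows "\<exists>t. t \<epsilon> T \<and> W.stationary (V (hat (n t))) (j l)"
proof (rule ccontr)
  assume neg: "\<not> ?thesis"
  note lD = infinite_cardinalD[OF l(1)]
  define bad where "bad t N \<longleftrightarrow> W.club (V (hat N)) (j l) \<and> \<not> (\<exists>x. x \<epsilon>\<^sub>G V (hat (n t)) \<and> x \<epsilon>\<^sub>G V (hat N))" for t N
  have fbad: "fcb (\<lambda>e. bad (t e) (u e))" if "dt t" "dt u" for t u
    by (rule fc_sub2[OF _ that]) (unfold bad_def, intro fc dfn df1_app[OF n(1)])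
  have ex: "\<exists>N. N \<epsilon> pow (prod' l P) \<and> bad t N" if t: "t \<epsilon> T" for t
  proof -
    have "x \<epsilon>\<^sub>G j l" if "x \<epsilon>\<^sub>G V (hat (n t))" for x
      using that n(2)[OF t] unfolding mem_hat[OF n(2)[OF t]] mem_pow mem_j by (metis pr_mem_prod')
    then obtain C where C: "W.club C (j l)" "\<not> (\<exists>x. x \<epsilon>\<^sub>G V (hat (n t)) \<and> x \<epsilon>\<^sub>G C)"
      using neg t unfolding stationary_iff' by blast
    then obtain N where "N \<epsilon> pow (prod' l P)" "C = V (hat N)" using hat_surj[of C l] unfolding club_iff' by blast
    then show ?thesis using C unfolding bad_def by blast
  qed
  obtain \<rho> f where r: "ordinal \<rho>" "df1 f" "\<And>u. u \<epsilon> \<rho> \<Longrightarrow> f u \<epsilon> pow (prod' l P)"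
    "\<And>u v. u \<epsilon> \<rho> \<Longrightarrow> v \<epsilon> \<rho> \<Longrightarrow> f u = f v \<Longrightarrow> u = v" "\<And>z. z \<epsilon> pow (prod' l P) \<Longrightarrow> \<exists>u. u \<epsilon> \<rho> \<and> f u = z"
    by (rule well_order[of "pow (prod' l P)"]) (rule that)
  define sel where "sel t i \<longleftrightarrow> i \<epsilon> \<rho> \<and> bad t (f i) \<and> (\<forall>i'. i' \<epsilon> i \<longrightarrow> \<not> bad t (f i'))" for t i
  have fsel: "fcb (\<lambda>e. sel (t e) (u e))" if "dt t" "dt u" for t u
    by (rule fc_sub2[OF _ that]) (unfold sel_def, intro fc fbad dfn df1_app[OF r(2)])
  have selu: "i = i'" if "sel t i" "sel t i'" for t i i'
    using that ordinal_linear ordinal_mem[OF r(1)] unfolding sel_def by blast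
  have sele: "\<exists>i. sel t i" if t: "t \<epsilon> T" for t
  proof -
    obtain i where i: "i \<epsilon> \<rho>" "bad t (f i)" using ex[OF t] r(5) by metis
    obtain i' where "i' \<epsilon> \<rho> \<and> bad t (f i')" "\<forall>z. z \<epsilon> i' \<longrightarrow> \<not> (z \<epsilon> \<rho> \<and> bad t (f z))"
      using wf_min[of "\<lambda>i. i \<epsilon> \<rho> \<and> bad t (f i)"] i by blast
    then show ?thesis unfolding sel_def using ordinal_trans[OF r(1)] by blast
  qed
  \<comment> \<open>The first element past x of the club selected for t. Packed into the relation Q
    on triples, it meets the hypotheses of \<open>cover\<close>.\<close>
  define nxt where "nxt x t y \<longleftrightarrow> (\<exists>i. sel t i \<and> y \<epsilon> l \<and> x \<epsilon> y \<and> j y \<epsilon>\<^sub>G V (hat (f i)) \<and>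
    (\<forall>y'. y' \<epsilon> y \<longrightarrow> x \<epsilon> y' \<longrightarrow> \<not> j y' \<epsilon>\<^sub>G V (hat (f i))))" for x t y
  define Q where "Q z \<longleftrightarrow> nxt (fstv z) (fstv (sndv z)) (sndv (sndv z))" for z
  have fQ: "fcb (\<lambda>e. Q (e 0))" unfolding Q_def nxt_def by (intro fc fsel dfn df1_app[OF r(2)])
  have Qp: "Q (pr x (pr t y)) \<longleftrightarrow> nxt x t y" for x t y by (simp add: Q_def)
  have tot: "\<exists>y. y \<epsilon> l \<and> nxt x t y" if x: "x \<epsilon> l" and t: "t \<epsilon> T" for x t
  proof -
    obtain i where i: "sel t i" using sele[OF t] by blast
    then have "W.unbounded_in (V (hat (f i))) (j l)" unfolding sel_def bad_def club_iff' by blast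
    then obtain y where "y \<epsilon> l" "j y \<epsilon>\<^sub>G V (hat (f i))" "x \<epsilon> y"
      using x unfolding unbounded_in_iff' by (metis j_mem mem_j)
    then obtain y' where "y' \<epsilon> l \<and> j y' \<epsilon>\<^sub>G V (hat (f i)) \<and> x \<epsilon> y'"
      "\<forall>z. z \<epsilon> y' \<longrightarrow> \<not> (z \<epsilon> l \<and> j z \<epsilon>\<^sub>G V (hat (f i)) \<and> x \<epsilon> z)"
      using wf_min[of "\<lambda>y. y \<epsilon> l \<and> j y \<epsilon>\<^sub>G V (hat (f i)) \<and> x \<epsilon> y"] by blast
    then show ?thesis unfolding nxt_def using i ordinal_trans[OF lD(2)] by blast
  qed
  have un: "y = y'" if "nxt x t y" "nxt x t y'" for x t y y'
    using that selu ordinal_linear ordinal_mem[OF lD(2)] unfolding nxt_def by metis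
  obtain b where b: "df1 b" "\<And>a. a \<epsilon> l \<Longrightarrow> b a \<epsilon> l"
    "\<And>a i y. a \<epsilon> l \<Longrightarrow> i \<epsilon> T \<Longrightarrow> Q (pr a (pr i y)) \<Longrightarrow> y \<epsilon> b a"
  proof (rule cover[OF l T fQ, of l])
    show "\<exists>y. y \<epsilon> l \<and> Q (pr a (pr i y))" if "a \<epsilon> l" "i \<epsilon> T" for a i using tot[OF that] unfolding Qp .
    show "y = y'" if "Q (pr a (pr i y))" "Q (pr a (pr i y'))" for a i y y' using un that unfolding Qp .
  qed (rule that)
  obtain \<delta> where d: "\<delta> \<epsilon> l" "limit_ordinal \<delta>" "\<And>x. x \<epsilon> \<delta> \<Longrightarrow> b x \<epsilon> \<delta>"
    by (rule closure_point[OF l b(1,2)]) (assumption, rule that)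
  have od: "ordinal \<delta>" using d(2) unfolding limit_ordinal_def by blast
  obtain t where t: "t \<epsilon> T" "j \<delta> \<epsilon>\<^sub>G V (hat (n t))" using cov[OF d(1)] by blast
  obtain i where i: "sel t i" using sele[OF t(1)] by blast
  have "W.unbounded_in (V (hat (f i))) (j \<delta>)"
    unfolding unbounded_in_iff'
  proof (intro allI impI)
    fix x' assume "x' \<epsilon>\<^sub>G j \<delta>"
    then obtain x where x: "x \<epsilon> \<delta>" "x' = j x" unfolding mem_j by blast
    have xl: "x \<epsilon> l" using ordinal_trans[OF lD(2) d(1) x(1)] .
    obtain y where y: "nxt x t y" using tot[OF xl t(1)] by blast
    then have "y \<epsilon> b x" using b(3)[OF xl t(1)] unfolding Qp by blast
    then have "y \<epsilon> \<delta>" using ordinal_trans[OF od d(3)[OF x(1)]] by blast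
    moreover have "x \<epsilon> y" "j y \<epsilon>\<^sub>G V (hat (f i))" using y selu[OF i] unfolding nxt_def by blast+
    ultimately show "\<exists>y. y \<epsilon>\<^sub>G V (hat (f i)) \<and> y \<epsilon>\<^sub>G j \<delta> \<and> x' \<epsilon>\<^sub>G y"
      unfolding x(2) by (intro exI[of _ "j y"]) simp
  qed
  \<comment> \<open>The next club elements past points of \<delta> stay below \<delta>, so \<delta>
    is a limit of the club and belongs to it, whereas the piece t containing \<delta> is disjoint
    from the club.\<close>
  then have "j \<delta> \<epsilon>\<^sub>G V (hat (f i))"
    using i j_limit_ordinal[OF d(2)] d(1) unfolding sel_def bad_def club_iff' by simp
  then show False using i t(2) unfolding sel_def bad_def by blast
qed

end

section \<open>List colourings of the complete bipartite graph\<close>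

context fn_forcing
begin

section \<open>Failure of colourings from stationary lists\<close>

lemma complete_bipartite'E:
  assumes "W.complete_bipartite X Fe (j \<mu>)"
  obtains A B gA gB where "W.bijection gA A (j \<mu>)" "W.bijection gB B (j \<mu>)"
    "\<And>x. \<not> (x \<epsilon>\<^sub>G A \<and> x \<epsilon>\<^sub>G B)" "\<And>x. x \<epsilon>\<^sub>G X \<longleftrightarrow> x \<epsilon>\<^sub>G A \<or> x \<epsilon>\<^sub>G B"
    "\<And>e. e \<epsilon>\<^sub>G Fe \<longleftrightarrow> (\<exists>a b. a \<epsilon>\<^sub>G A \<and> b \<epsilon>\<^sub>G B \<and> W.elts e = {a, b})"
proof -
  obtain A B where *: "W.equinumerous A (j \<mu>)" "W.equinumerous B (j \<mu>)" "W.elts A \<inter> W.elts B = {}"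
    "W.elts X = W.elts A \<union> W.elts B"
    "\<forall>e. e \<epsilon>\<^sub>G Fe \<longleftrightarrow> (\<exists>a\<in>W.elts A. \<exists>b\<in>W.elts B. W.elts e = {a, b})"
    using assms unfolding W.complete_bipartite_def by blast
  obtain gA gB where g: "W.bijection gA A (j \<mu>)" "W.bijection gB B (j \<mu>)"
    using *(1,2) unfolding W.equinumerous_def by blast
  show thesis
  proof (rule that[OF g])
    show "\<not> (x \<epsilon>\<^sub>G A \<and> x \<epsilon>\<^sub>G B)" for x using *(3) by (auto simp: W.elts_def)
    show "x \<epsilon>\<^sub>G X \<longleftrightarrow> x \<epsilon>\<^sub>G A \<or> x \<epsilon>\<^sub>G B" for x using *(4) unfolding set_eq_iff Un_iff Wmem by blast
    show "e \<epsilon>\<^sub>G Fe \<longleftrightarrow> (\<exists>a b. a \<epsilon>\<^sub>G A \<and> b \<epsilon>\<^sub>G B \<and> W.elts e = {a, b})" for e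
      using *(5) unfolding Bex_def Wmem by blast
  qed
qed

text \<open>Kuratowski pairs lie in the double power set of the union of a and b, and \<mu> is a
  strong limit.\<close>

lemma small_prod':
  assumes "small \<mu> a" "small \<mu> b" shows "small \<mu> (prod' a b)"
proof -
  have sp: "small \<mu> x \<Longrightarrow> small \<mu> (pow x)" for x
    using small_pow[OF w gch mu cf km kD(3)] .
  have "small \<mu> (pow (pow (un a b)))" using sp small_un[OF w mu assms] by blast
  then show ?thesis
    by (rule small_subset) (auto simp: mem_prod' mem_pow pr_def sing_def mem_up mem_un)
qed

text \<open>The sets L i have size below \<mu> because \<mu> is a strong limit, and they increase
  with i, so \<open>greedy\<close> bounds the size of their union by \<mu>.\<close>

lemma enumerate_bounded_names:
  assumes l: "l \<epsilon> \<mu>"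
  obtains n where "df1 n" "\<And>\<alpha>. n \<alpha> \<epsilon> pow (prod' l P)"
    "\<And>i N. i \<epsilon> \<mu> \<Longrightarrow> N \<epsilon> pow (prod' l (Fni i)) \<Longrightarrow> \<exists>\<alpha>. \<alpha> \<epsilon> \<mu> \<and> n \<alpha> = N"
proof -
  define L where "L i = pow (prod' l (Fni i))" for i
  have dL: "df1 L" unfolding df1_def L_def by (intro dfn)
  have sp: "small \<mu> x \<Longrightarrow> small \<mu> (pow x)" for x
    using small_pow[OF w gch mu cf km kD(3)] .
  have sm: "small \<mu> i" if "i \<epsilon> \<mu>" for i unfolding small_def using that lep_refl by blast
  have small: "\<not> lep \<mu> (L i)" if i: "i \<epsilon> \<mu>" for i
  proof
    assume lm: "lep \<mu> (L i)"
    have "finite (elts (up emp one))" by (simp add: elts_up)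
    then have "small \<mu> (pow (prod' i (up emp one)))"
      using sp small_prod'[OF sm[OF i] small_finite[OF w mu]] by blast
    then have "small \<mu> (Fni i)"
    proof (rule small_subset)
      fix p assume p: "p \<epsilon> Fni i"
      have "z \<epsilon> prod' i (up emp one)" if z: "z \<epsilon> p" for z
      proof -
        obtain x b where "z = pr x b" "b = emp \<or> b = one" using P_pair[OF _ z] p mem_Fni by blast
        then show ?thesis using p z domI[of x b p] by (auto simp: mem_Fni mem_up)
      qed
      then show "p \<epsilon> pow (prod' i (up emp one))" by (simp add: mem_pow)
    qed
    then have "small \<mu> (L i)" unfolding L_def using sp small_prod'[OF sm[OF l]] by blast
    then obtain m where "m \<epsilon> \<mu>" "lep (L i) m" unfolding small_def by blast
    then show False using cardinal_not_lep[OF muD(1)] lm lep_trans by blast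
  qed
  have "lep (Un' (im L \<mu>)) \<mu>"
  proof (rule greedy[OF dL muD(2) muD(2) _ _ small])
    show "\<exists>i. i \<epsilon> \<mu> \<and> y \<epsilon> L i" if "y \<epsilon> Un' (im L \<mu>)" for y
      using that unfolding mem_Un' mem_im[OF dL] by blast
    fix i i' x assume i: "i \<epsilon> i'" "i' \<epsilon> \<mu>" and x: "x \<epsilon> L i"
    have "p \<epsilon> Fni i'" if "p \<epsilon> Fni i" for p
      using that ordinal_trans[OF ordinal_mem[OF muD(2) i(2)]] i(1) unfolding mem_Fni by blast
    then show "x \<epsilon> L i'" using x unfolding L_def mem_pow mem_prod' by blast
  qed
  then obtain g where g: "df1 g" "\<And>u. u \<epsilon> Un' (im L \<mu>) \<Longrightarrow> g u \<epsilon> \<mu>"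
    "\<And>u v. u \<epsilon> Un' (im L \<mu>) \<Longrightarrow> v \<epsilon> Un' (im L \<mu>) \<Longrightarrow> g u = g v \<Longrightarrow> u = v" by (rule lepE) (rule that)
  have mU: "N \<epsilon> Un' (im L \<mu>) \<longleftrightarrow> (\<exists>i. i \<epsilon> \<mu> \<and> N \<epsilon> L i)" for N
    unfolding mem_Un' mem_im[OF dL] by blast
  have LP: "N \<epsilon> pow (prod' l P)" if "N \<epsilon> L i" for N i
    using that unfolding L_def mem_pow mem_prod' mem_Fni by blast
  define n' where "n' \<alpha> = the0 (\<lambda>N. N \<epsilon> Un' (im L \<mu>) \<and> g N = \<alpha>)" for \<alpha>
  \<comment> \<open>Ordinals that number no name are sent to \<open>emp\<close>, so that every n
    \<alpha> is a name for a subset of l.\<close>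
  define n where "n \<alpha> = (if n' \<alpha> \<epsilon> pow (prod' l P) then n' \<alpha> else emp)" for \<alpha>
  show thesis
  proof (rule that[of n])
    show "df1 n" unfolding df1_def n_def n'_def by (intro dfn df1_app[OF g(1)] df1_app[OF dL])
    show "n \<alpha> \<epsilon> pow (prod' l P)" for \<alpha> unfolding n_def by (auto simp: mem_pow not_mem_emp)
    fix i N assume i: "i \<epsilon> \<mu>" and N: "N \<epsilon> pow (prod' l (Fni i))"
    then have NL: "N \<epsilon> L i" by (simp add: L_def)
    then have NU: "N \<epsilon> Un' (im L \<mu>)" using i mU by blast
    have "n' (g N) = N" unfolding n'_def by (rule the0_eq) (use NU g(3) in auto)
    then have "n (g N) = N" unfolding n_def using LP[OF NL] by simp
    then show "\<exists>\<alpha>. \<alpha> \<epsilon> \<mu> \<and> n \<alpha> = N" using g(2)[OF NU] by blast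
  qed
qed

lemma cofinal_index:
  obtains f where "\<And>i. i \<epsilon> \<kappa> \<Longrightarrow> app f i \<epsilon> \<mu>" "\<And>x. x \<epsilon> \<mu> \<Longrightarrow> \<exists>i. i \<epsilon> \<kappa> \<and> (x = app f i \<or> x \<epsilon> app f i)"
proof -
  obtain f where f: "cofinal_function f \<kappa> \<mu>" using cf unfolding cofinality_def by blast
  have fi: "fun_into f \<kappa> \<mu>" using f unfolding cofinal_function_def by blast
  show thesis
  proof (rule that[of f])
    show "app f i \<epsilon> \<mu>" if "i \<epsilon> \<kappa>" for i using fun_into_app[OF fi that] by blast
    fix x assume x: "x \<epsilon> \<mu>"
    obtain i y where i: "maps f i y" "x = y \<or> x \<epsilon> y"
      using f x unfolding cofinal_function_def Ball_def mem_elts by blast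
    have "i \<epsilon> \<kappa>" using fun_on_dom i fi unfolding fun_into_def by blast
    moreover from this have "y = app f i" using i fi fun_on_app unfolding fun_into_def by blast
    ultimately show "\<exists>i. i \<epsilon> \<kappa> \<and> (x = app f i \<or> x \<epsilon> app f i)" using i(2) by blast
  qed
qed

lemma dom_bounded: assumes "p \<epsilon> P" obtains x where "x \<epsilon> \<mu>" "\<And>y. y \<epsilon> dom p \<Longrightarrow> y \<epsilon> x"
proof -
  obtain n where "n \<epsilon> \<kappa>" "lep (dom p) n" using P_small[OF assms] unfolding small_def by blast
  moreover have "df1 (\<lambda>x. x)" unfolding df1_def by (intro dfn)
  ultimately show thesis
    using cofinality_bounded[OF cf muD(2) emp_inf[OF mu], of n "dom p" "\<lambda>x. x"] dom_mu[OF assms] that by blast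
qed

text \<open>Supplies the default list in \<open>not_SList\<close>: j l meets every club because
  unbounded subsets of it are nonempty.\<close>

lemma stationary_self: "infinite_cardinal l \<Longrightarrow> W.stationary (j l) (j l)"
  unfolding stationary_iff' club_iff' unbounded_in_iff' using emp_inf[of l] j_mem by blast

theorem not_SList:
  assumes l: "infinite_cardinal l" "cofinality l l" "\<kappa> \<epsilon> l" "l \<epsilon> \<mu>"
    and cb: "W.complete_bipartite X Fe (j \<mu>)"
  shows "\<not> W.SList X Fe (j l)"
proof
  assume SL: "W.SList X Fe (j l)"
  obtain A B gA gB where gA: "W.bijection gA A (j \<mu>)" and gB: "W.bijection gB B (j \<mu>)"
    and AB: "\<And>x. \<not> (x \<epsilon>\<^sub>G A \<and> x \<epsilon>\<^sub>G B)" and X: "\<And>x. x \<epsilon>\<^sub>G X \<longleftrightarrow> x \<epsilon>\<^sub>G A \<or> x \<epsilon>\<^sub>G B"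
    and Fe: "\<And>e. e \<epsilon>\<^sub>G Fe \<longleftrightarrow> (\<exists>a b. a \<epsilon>\<^sub>G A \<and> b \<epsilon>\<^sub>G B \<and> W.elts e = {a, b})"
    by (rule complete_bipartite'E[OF cb]) (rule that)
  note a = bijection'D[OF gA] and b = bijection'D[OF gB]
  obtain n where n: "df1 n" "\<And>\<alpha>. n \<alpha> \<epsilon> pow (prod' l P)"
    "\<And>i N. i \<epsilon> \<mu> \<Longrightarrow> N \<epsilon> pow (prod' l (Fni i)) \<Longrightarrow> \<exists>\<alpha>. \<alpha> \<epsilon> \<mu> \<and> n \<alpha> = N"
    by (rule enumerate_bounded_names[OF l(4)]) (rule that)
  \<comment> \<open>A name for all of j l, the list of a vertex whose number \<alpha> does not name
    a stationary set.\<close>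
  define full where "full = prod' l (sing emp)"
  have full: "full \<epsilon> pow (prod' l P)" unfolding full_def mem_pow mem_prod' mem_sing using emp_P by blast
  have Vfull: "V (hat full) = j l"
    by (rule ext'I, unfold mem_hat[OF full]) (use emp_G in \<open>auto simp: full_def mem_j mem_sing\<close>)
  \<comment> \<open>Both sides are numbered by \<mu>, so each stationary set with a bounded name is
    a list on A and also on B.\<close>
  define num where "num x \<alpha> \<longleftrightarrow> x \<epsilon>\<^sub>G A \<and> W.maps gA x (j \<alpha>) \<or> x \<epsilon>\<^sub>G B \<and> W.maps gB x (j \<alpha>)" for x \<alpha>
  have num: "\<alpha> = \<alpha>'" if "num x \<alpha>" "num x \<alpha>'" for x \<alpha> \<alpha>'
    using that AB maps'_unique[OF a(1)] maps'_unique[OF b(1)] j_inject unfolding num_def by blast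
  define st where "st \<alpha> \<longleftrightarrow> W.stationary (V (hat (n \<alpha>))) (j l)" for \<alpha>
  define R where "R x N \<longleftrightarrow> (\<exists>\<alpha>. \<alpha> \<epsilon> \<mu> \<and> num x \<alpha> \<and> (st \<alpha> \<and> N = n \<alpha> \<or> \<not> st \<alpha> \<and> N = full))" for x N
  have "df1 hat" unfolding df1_def by (intro dfn)
  moreover have "fcb (\<lambda>e. R (V (e 0)) (e 1))" unfolding R_def num_def st_def by (intro fc dfn df1_app[OF n(1)])
  moreover have "\<exists>N. N \<epsilon> pow (prod' l P) \<and> R x N" if x: "x \<epsilon>\<^sub>G X" for x
  proof -
    have "\<exists>\<alpha>. \<alpha> \<epsilon> \<mu> \<and> num x \<alpha>" using x X a(2) b(2) unfolding num_def mem_j by metis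
    then show ?thesis unfolding R_def using n(2) full by blast
  qed
  moreover have "V (hat N) = V (hat N')" if "R x N" "R x N'" for x N N'
    using that num unfolding R_def by metis
  ultimately obtain L where L: "W.fun_on L X"
    "\<And>x y. W.maps L x y \<longleftrightarrow> x \<epsilon>\<^sub>G X \<and> (\<exists>N. N \<epsilon> pow (prod' l P) \<and> R x N \<and> y = V (hat N))"
    by (rule make_fun[of hat R X "pow (prod' l P)"]) (assumption+, rule that)
  have "W.stationary S (j l)" if "W.maps L v S" for v S
    using that stationary_self[OF l(1)] Vfull unfolding L(2) R_def st_def by metis
  then have "W.colourable_from X Fe L" using SL L(1) unfolding W.SList_def by blast
  then obtain c where c: "W.good X Fe c" "\<And>v S x. W.maps L v S \<Longrightarrow> W.maps c v x \<Longrightarrow> x \<epsilon>\<^sub>G S"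
    unfolding W.colourable_from_def by blast
  have con: "W.fun_on c X" and cE: "\<And>e v w x. e \<epsilon>\<^sub>G Fe \<Longrightarrow> W.elts e = {v, w} \<Longrightarrow> W.maps c v x \<Longrightarrow> \<not> W.maps c w x"
    using c(1) unfolding W.good_def by blast+
  define Q where "Q \<xi> \<longleftrightarrow> (\<exists>v. v \<epsilon>\<^sub>G A \<and> W.maps c v (j \<xi>))" for \<xi>
  have fQ: "fcb (\<lambda>e. Q (e 0))" unfolding Q_def by (intro fc dfn)
  obtain F where F: "\<And>t u. dt t \<Longrightarrow> dt u \<Longrightarrow> dfn (\<lambda>e. F (t e) (u e))" "\<And>x. Q x \<longleftrightarrow> (\<exists>p\<in>G. F p x)"
    by (rule fc1E[OF fQ]) (rule that)
  obtain F' where F': "\<And>t u. dt t \<Longrightarrow> dt u \<Longrightarrow> dfn (\<lambda>e. F' (t e) (u e))" "\<And>x. \<not> Q x \<longleftrightarrow> (\<exists>p\<in>G. F' p x)"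
    by (rule fc1E[OF fc_neg[OF fQ]]) (rule that)
  obtain f where f: "\<And>i. i \<epsilon> \<kappa> \<Longrightarrow> app f i \<epsilon> \<mu>" "\<And>x. x \<epsilon> \<mu> \<Longrightarrow> \<exists>i. i \<epsilon> \<kappa> \<and> (x = app f i \<or> x \<epsilon> app f i)"
    by (rule cofinal_index) (rule that)
  \<comment> \<open>The second coordinate records whether the condition puts the colour among those
    used on A or outside them.\<close>
  define T where "T = prod' \<kappa> (up emp one)"
  \<comment> \<open>Confining the conditions to Fn(f i, 2) makes the name of the piece one of those
    enumerated by n.\<close>
  define m where "m t = coll (prod' l P) (\<lambda>z. sndv z \<epsilon> Fni (app f (fstv t)) \<and>
    (sndv t = emp \<and> F (sndv z) (fstv z) \<or> sndv t = one \<and> F' (sndv z) (fstv z)))" for t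
  have dm: "df1 m" unfolding df1_def m_def by (intro dfn F(1) F'(1))
  have mm: "pr \<xi> p \<epsilon> m (pr i \<epsilon>') \<longleftrightarrow> \<xi> \<epsilon> l \<and> p \<epsilon> Fni (app f i) \<and> (\<epsilon>' = emp \<and> F p \<xi> \<or> \<epsilon>' = one \<and> F' p \<xi>)" for \<xi> p i \<epsilon>'
    unfolding m_def by (subst mem_coll) (auto simp: mem_Fni intro!: dfn F(1) F'(1))
  have mP: "m t \<epsilon> pow (prod' l P)" "m t \<epsilon> pow (prod' l (Fni (app f (fstv t))))" for t
  proof -
    have "z \<epsilon> m t \<Longrightarrow> z \<epsilon> prod' l P \<and> sndv z \<epsilon> Fni (app f (fstv t))" for z
      unfolding m_def by (subst (asm) mem_coll) (auto intro!: dfn F(1) F'(1))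
    then show "m t \<epsilon> pow (prod' l P)" "m t \<epsilon> pow (prod' l (Fni (app f (fstv t))))"
      unfolding mem_pow mem_prod' by fastforce+
  qed
  have lT: "lep T \<kappa>"
  proof -
    have "lep (up emp one) \<kappa>" by (rule lep_finite_ordinal[OF w _ kD(2,3)]) (simp add: elts_up)
    then show ?thesis unfolding T_def using lep_prod'[OF lep_refl] lep_square[OF w kD(2,3)] lep_trans by blast
  qed
  have cov: "\<exists>t. t \<epsilon> T \<and> j \<xi> \<epsilon>\<^sub>G V (hat (m t))" if xi: "\<xi> \<epsilon> l" for \<xi>
  proof -
    obtain p \<epsilon>' where p: "p \<in> G" "\<epsilon>' = emp \<and> F p \<xi> \<or> \<epsilon>' = one \<and> F' p \<xi>" using F(2) F'(2) by metis
    obtain x where x: "x \<epsilon> \<mu>" "\<And>y. y \<epsilon> dom p \<Longrightarrow> y \<epsilon> x" by (rule dom_bounded[OF G_P[OF p(1)]]) (rule that)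
    obtain i where i: "i \<epsilon> \<kappa>" "x = app f i \<or> x \<epsilon> app f i" using f(2)[OF x(1)] by blast
    have "p \<epsilon> Fni (app f i)" unfolding mem_Fni
      using G_P[OF p(1)] x(2) i(2) ordinal_trans[OF ordinal_mem[OF muD(2) f(1)[OF i(1)]]] by blast
    then have "pr \<xi> p \<epsilon> m (pr i \<epsilon>')" unfolding mm using xi p(2) by blast
    moreover have "pr i \<epsilon>' \<epsilon> T" unfolding T_def using i(1) p(2) by (auto simp: mem_up)
    ultimately show ?thesis unfolding mem_hat[OF mP(1)] using p(1) by blast
  qed
  obtain t where t: "t \<epsilon> T" "W.stationary (V (hat (m t))) (j l)"
    using pigeonhole[OF l(1-3) lT dm mP(1) cov] by blast
  obtain i \<epsilon>' where ie: "t = pr i \<epsilon>'" "i \<epsilon> \<kappa>" using t(1) unfolding T_def mem_prod' by blast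
  obtain \<alpha> where al: "\<alpha> \<epsilon> \<mu>" "n \<alpha> = m t" using n(3)[OF f(1)[OF ie(2)], of "m t"] mP(2)[of t] ie(1) by auto
  have st: "st \<alpha>" using t(2) al(2) unfolding st_def by simp
  obtain u where u: "u \<epsilon>\<^sub>G A" "W.maps gA u (j \<alpha>)" using a(3) al(1) j_mem by blast
  obtain v where v: "v \<epsilon>\<^sub>G B" "W.maps gB v (j \<alpha>)" using b(3) al(1) j_mem by blast
  have "R u (m t)" "R v (m t)" unfolding R_def num_def using u v al st by metis+
  then have Luv: "W.maps L u (V (hat (m t)))" "W.maps L v (V (hat (m t)))"
    unfolding L(2) X using u v mP(1) by blast+
  obtain x y where xy: "W.maps c u x" "W.maps c v y"
    using con u(1) v(1) X unfolding W.fun_on_def Ball_def Wmem by metis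
  have xS: "x \<epsilon>\<^sub>G V (hat (m t))" and yS: "y \<epsilon>\<^sub>G V (hat (m t))" using c(2) Luv xy by blast+
  obtain \<xi> p where x: "pr \<xi> p \<epsilon> m t" "p \<in> G" "x = j \<xi>" using xS unfolding mem_hat[OF mP(1)] by blast
  obtain \<eta> q where y: "pr \<eta> q \<epsilon> m t" "q \<in> G" "y = j \<eta>" using yS unfolding mem_hat[OF mP(1)] by blast
  show False
  proof (cases "\<epsilon>' = emp")
    case True
    then have "F q \<eta>" using y(1) one_ne unfolding ie(1) mm by auto
    then obtain u' where u': "u' \<epsilon>\<^sub>G A" "W.maps c u' y" using F(2) y(2,3) unfolding Q_def by blast
    obtain e where e: "W.elts e = {u', v}" by (rule pair_ex') (rule that)
    then have "e \<epsilon>\<^sub>G Fe" unfolding Fe using u'(1) v(1) by blast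
    then show False using cE[OF _ e u'(2)] xy(2) by blast
  next
    case False
    then have "F' p \<xi>" using x(1) unfolding ie(1) mm by auto
    then have "\<not> Q \<xi>" using F'(2) x(2) by blast
    then show False unfolding Q_def using u(1) xy(1) x(3) by blast
  qed
qed

section \<open>Colourings from lists of size \<kappa>\<close>

lemma unbounded_section:
  assumes S: "\<And>x. x \<epsilon>\<^sub>G S \<Longrightarrow> x \<epsilon>\<^sub>G j \<kappa>" "W.equinumerous S (j \<kappa>)" and i: "i \<epsilon> \<kappa>"
  shows "\<exists>\<beta>. \<beta> \<epsilon> \<kappa> \<and> \<not> \<beta> \<epsilon> i \<and> j \<beta> \<epsilon>\<^sub>G S"
proof (rule ccontr)
  assume n: "\<not> ?thesis"
  \<comment> \<open>If S lay inside i < \<kappa>, the bijection h would be a function on part of i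
    with range \<kappa>, against \<open>short_bounded\<close>.\<close>
  obtain h where h: "W.bijection h S (j \<kappa>)" using S(2) unfolding W.equinumerous_def by blast
  note b = bijection'D[OF h]
  define Q where "Q z \<longleftrightarrow> W.maps h (j (fstv z)) (j (sndv z))" for z
  have "fcb (\<lambda>e. Q (e 0))" unfolding Q_def by (intro fc dfn)
  moreover have "y = y'" if "Q (pr x y)" "Q (pr x y')" for x y y'
    using maps'_unique[OF b(1)] that unfolding Q_def fstv_pr sndv_pr by (metis j_inject)
  ultimately obtain \<delta> where d: "\<delta> \<epsilon> \<kappa>" "\<And>x y. x \<epsilon> i \<Longrightarrow> y \<epsilon> \<kappa> \<Longrightarrow> Q (pr x y) \<Longrightarrow> y \<epsilon> \<delta>"
    using short_bounded[OF i] by blast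
  obtain s where s: "s \<epsilon>\<^sub>G S" "W.maps h s (j \<delta>)" using b(3) d(1) j_mem by blast
  obtain x where x: "x \<epsilon> \<kappa>" "s = j x" using S(1)[OF s(1)] unfolding mem_j by blast
  have "x \<epsilon> i" using n x s(1) by blast
  then have "\<delta> \<epsilon> \<delta>" using d(2)[OF _ d(1)] s(2) x(2) unfolding Q_def by simp
  then show False using mem_irrefl by blast
qed

text \<open>The variable x has two roles: as a bound of the domain of a condition, which h \<beta>
  must exceed, and as the number of a vertex, whose support h \<beta> must miss.\<close>

definition avoids :: "('v \<Rightarrow> 'v) \<Rightarrow> ('v \<Rightarrow> 'v) \<Rightarrow> bool" where
  "avoids h I \<longleftrightarrow> (\<forall>x. x \<epsilon> \<mu> \<longrightarrow> (\<exists>i. i \<epsilon> \<kappa> \<and>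
     (\<forall>\<beta>. \<beta> \<epsilon> \<kappa> \<longrightarrow> \<not> \<beta> \<epsilon> i \<longrightarrow> h \<beta> \<epsilon> \<mu> \<and> \<not> h \<beta> \<epsilon> x \<and> \<not> h \<beta> \<epsilon> I x)))"

text \<open>The supports depend on R alone and h enters afterwards, so h can be built to avoid them.
  Given p, a colour \<beta> \<ge> i is decided by a condition inside the support; for large i the
  point h \<beta> is outside the support and outside dom p, so its value can still be set to
  \<epsilon>'.\<close>

lemma dense_split:
  assumes R: "fcb (\<lambda>e. R (e 0) (e 1))"
    and unb: "\<And>\<alpha> i. \<alpha> \<epsilon> \<mu> \<Longrightarrow> i \<epsilon> \<kappa> \<Longrightarrow> \<exists>\<beta>. \<beta> \<epsilon> \<kappa> \<and> \<not> \<beta> \<epsilon> i \<and> R \<alpha> \<beta>"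
  obtains I where "df1 I" "\<And>\<alpha>. \<alpha> \<epsilon> \<mu> \<Longrightarrow> lep (I \<alpha>) \<kappa>"
    "\<And>h \<epsilon>' \<alpha>. df1 h \<Longrightarrow> avoids h I \<Longrightarrow>
      \<alpha> \<epsilon> \<mu> \<Longrightarrow> \<epsilon>' = emp \<or> \<epsilon>' = one \<Longrightarrow> \<exists>\<beta> q. \<beta> \<epsilon> \<kappa> \<and> R \<alpha> \<beta> \<and> q \<in> G \<and> pr (h \<beta>) \<epsilon>' \<epsilon> q"
proof -
  define Q1 where "Q1 z \<longleftrightarrow> R (fstv z) (sndv (sndv z))" for z
  have "fcb (\<lambda>e. Q1 (e 0))" unfolding Q1_def by (intro fc_sub2[OF R] dfn)
  then obtain F1 where F1: "\<And>t u. dt t \<Longrightarrow> dt u \<Longrightarrow> dfn (\<lambda>e. F1 (t e) (u e))"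
    "\<And>p q x. F1 p x \<Longrightarrow> q \<epsilon> P \<Longrightarrow> le q p \<Longrightarrow> F1 q x" "\<And>x. Q1 x \<longleftrightarrow> (\<exists>p\<in>G. F1 p x)"
    by (rule fc1E) (rule that)
  \<comment> \<open>The index i demands a colour \<beta> \<ge> i. This demand speaks only of V, so
    it is added to the witness relation F outright.\<close>
  define Q where "Q z \<longleftrightarrow> \<not> sndv (sndv z) \<epsilon> fstv (sndv z) \<and> Q1 z" for z
  define F where "F p z \<longleftrightarrow> \<not> sndv (sndv z) \<epsilon> fstv (sndv z) \<and> F1 p z" for p z
  have F: "\<And>t u. dt t \<Longrightarrow> dt u \<Longrightarrow> dfn (\<lambda>e. F (t e) (u e))"
    "\<And>p q x. F p x \<Longrightarrow> q \<epsilon> P \<Longrightarrow> le q p \<Longrightarrow> F q x" "\<And>x. Q x \<longleftrightarrow> (\<exists>p\<in>G. F p x)"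
  proof -
    show "dfn (\<lambda>e. F (t e) (u e))" if "dt t" "dt u" for t u unfolding F_def by (intro dfn F1(1) that)
    show "F q x" if "F p x" "q \<epsilon> P" "le q p" for p q x using that F1(2) unfolding F_def by blast
    show "Q x \<longleftrightarrow> (\<exists>p\<in>G. F p x)" for x using F1(3) unfolding F_def Q_def by blast
  qed
  have tot: "\<exists>\<beta>. \<beta> \<epsilon> \<kappa> \<and> Q (pr \<alpha> (pr i \<beta>))" if "\<alpha> \<epsilon> \<mu>" "i \<epsilon> \<kappa>" for \<alpha> i
    using unb[OF that] unfolding Q_def Q1_def by simp
  obtain p0 I E where p0: "p0 \<in> G" and I: "df1 I" "\<And>a. a \<epsilon> \<mu> \<Longrightarrow> I a \<epsilon> pow \<mu>" "\<And>a. a \<epsilon> \<mu> \<Longrightarrow> lep (I a) \<kappa>"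
    and dE: "\<And>t u v. dt t \<Longrightarrow> dt u \<Longrightarrow> dt v \<Longrightarrow> dt (\<lambda>e. E (t e) (u e) (v e))"
    and EY: "\<And>a q i. q \<epsilon> P \<Longrightarrow> sndv (E a q i) \<epsilon> \<kappa>"
    and E: "\<And>a i p. a \<epsilon> \<mu> \<Longrightarrow> i \<epsilon> \<kappa> \<Longrightarrow> p \<epsilon> P \<Longrightarrow> le p p0 \<Longrightarrow>
       fstv (E a (restr p (I a)) i) \<epsilon> Fni (I a) \<and> le (un (fstv (E a (restr p (I a)) i)) p) p \<and>
       un (fstv (E a (restr p (I a)) i)) p \<epsilon> P \<and>
       F (fstv (E a (restr p (I a)) i)) (pr a (pr i (sndv (E a (restr p (I a)) i))))"
    by (rule support[OF F tot lep_refl emp_inf[OF k]]) (assumption | rule that)+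
  show thesis
  proof (rule that[OF I(1) I(3)])
    fix h \<epsilon>' \<alpha>
    assume h: "df1 h" "avoids h I"
      and al: "\<alpha> \<epsilon> \<mu>" and ep: "\<epsilon>' = emp \<or> \<epsilon>' = one"
    define B where "B q \<longleftrightarrow> (\<exists>i \<beta>. \<beta> \<epsilon> \<kappa> \<and> F q (pr \<alpha> (pr i \<beta>)) \<and> pr (h \<beta>) \<epsilon>' \<epsilon> q)" for q
    have "dfn (\<lambda>e. B (e 0))" unfolding B_def by (intro dfn F(1) df1_app[OF h(1)])
    then consider q where "q \<in> G" "B q" | p1 where "p1 \<in> G" "\<And>q. q \<epsilon> P \<Longrightarrow> le q p1 \<Longrightarrow> \<not> B q"
      using dichotomy[of B] by blast
    then show "\<exists>\<beta> q. \<beta> \<epsilon> \<kappa> \<and> R \<alpha> \<beta> \<and> q \<in> G \<and> pr (h \<beta>) \<epsilon>' \<epsilon> q"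
    proof cases
      case 1
      then obtain i \<beta> where b: "\<beta> \<epsilon> \<kappa>" "F q (pr \<alpha> (pr i \<beta>))" "pr (h \<beta>) \<epsilon>' \<epsilon> q" unfolding B_def by blast
      then have "Q (pr \<alpha> (pr i \<beta>))" using F(3) 1(1) by blast
      then have "R \<alpha> \<beta>" unfolding Q_def Q1_def by simp
      then show ?thesis using b 1(1) by blast
    next
      case 2
      obtain p where p: "p \<in> G" "le p p0" "le p p1" using G_common[OF p0 2(1)] by blast
      have pP: "p \<epsilon> P" using G_P[OF p(1)] .
      obtain x where x: "x \<epsilon> \<mu>" "\<And>y. y \<epsilon> dom p \<Longrightarrow> y \<epsilon> x" by (rule dom_bounded[OF pP]) (rule that)
      obtain i0 where i0: "i0 \<epsilon> \<kappa>" "\<And>\<beta>. \<beta> \<epsilon> \<kappa> \<Longrightarrow> \<not> \<beta> \<epsilon> i0 \<Longrightarrow> h \<beta> \<epsilon> \<mu> \<and> \<not> h \<beta> \<epsilon> x"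
        using h(2) x(1) unfolding avoids_def by blast
      obtain i1 where i1: "i1 \<epsilon> \<kappa>" "\<And>\<beta>. \<beta> \<epsilon> \<kappa> \<Longrightarrow> \<not> \<beta> \<epsilon> i1 \<Longrightarrow> \<not> h \<beta> \<epsilon> I \<alpha>"
        using h(2) al unfolding avoids_def by blast
      obtain i where i: "i \<epsilon> \<kappa>" "\<And>\<beta>. \<not> \<beta> \<epsilon> i \<Longrightarrow> \<not> \<beta> \<epsilon> i0 \<and> \<not> \<beta> \<epsilon> i1"
        using ordinal_linear[OF ordinal_mem[OF kD(2) i0(1)] ordinal_mem[OF kD(2) i1(1)]] i0(1) i1(1)
          ordinal_trans[OF ordinal_mem[OF kD(2) i0(1)]] ordinal_trans[OF ordinal_mem[OF kD(2) i1(1)]] by blast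
      define z where "z = E \<alpha> (restr p (I \<alpha>)) i"
      define \<beta> where "\<beta> = sndv z"
      have z: "fstv z \<epsilon> Fni (I \<alpha>)" "le (un (fstv z) p) p" "un (fstv z) p \<epsilon> P" "F (fstv z) (pr \<alpha> (pr i \<beta>))"
        using E[OF al i(1) pP p(2)] unfolding z_def \<beta>_def by blast+
      have be: "\<beta> \<epsilon> \<kappa>" unfolding \<beta>_def z_def using EY restr_P[OF pP] by blast
      have "\<not> \<beta> \<epsilon> i" using z(4) unfolding F_def by simp
      then have hb: "h \<beta> \<epsilon> \<mu>" "\<not> h \<beta> \<epsilon> x" "\<not> h \<beta> \<epsilon> I \<alpha>" using i(2) i0(2)[OF be] i1(2)[OF be] by blast+
      have "\<not> h \<beta> \<epsilon> dom (un (fstv z) p)"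
      proof
        assume "h \<beta> \<epsilon> dom (un (fstv z) p)"
        then have "h \<beta> \<epsilon> dom (fstv z) \<or> h \<beta> \<epsilon> dom p" unfolding dom_def mem_im[OF df_fstv] mem_un by blast
        then show False using hb x(2) z(1) unfolding mem_Fni by blast
      qed
      then have q: "ins (pr (h \<beta>) \<epsilon>') (un (fstv z) p) \<epsilon> P" using extend_P[OF z(3) hb(1) _ ep] by blast
      have "F (ins (pr (h \<beta>) \<epsilon>') (un (fstv z) p)) (pr \<alpha> (pr i \<beta>))"
        by (rule F(2)[OF z(4) q]) (simp add: le_def mem_ins mem_un)
      then have "B (ins (pr (h \<beta>) \<epsilon>') (un (fstv z) p))" unfolding B_def using be mem_ins by blast
      moreover have "le (ins (pr (h \<beta>) \<epsilon>') (un (fstv z) p)) p1"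
        using p(3) by (simp add: le_def mem_ins mem_un)
      ultimately show ?thesis using 2(2)[OF q] by blast
    qed
  qed
qed

text \<open>\<open>h \<beta>\<close> avoids the supports of the first \<open>f \<beta>\<close> lists, so \<open>h\<close> eventually avoids each support.\<close>

lemma avoiding_function:
  assumes I: "df1 I" "\<And>\<alpha>. \<alpha> \<epsilon> \<mu> \<Longrightarrow> lep (I \<alpha>) \<kappa>"
  obtains h where "df1 h" "avoids h I"
proof -
  obtain f where f: "\<And>i. i \<epsilon> \<kappa> \<Longrightarrow> app f i \<epsilon> \<mu>" "\<And>x. x \<epsilon> \<mu> \<Longrightarrow> \<exists>i. i \<epsilon> \<kappa> \<and> (x = app f i \<or> x \<epsilon> app f i)"
    by (rule cofinal_index) (rule that)
  \<comment> \<open>Taking all k \<le> i makes m increasing although f is arbitrary, and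
    \<open>succ\<close> makes \<open>app f k\<close> itself a member.\<close>
  define m where "m i = Un' (im (\<lambda>k. succ (app f k)) (succ i))" for i
  have d1: "df1 (\<lambda>k. succ (app f k))" unfolding df1_def by (intro dfn)
  have dm: "df1 m" unfolding df1_def m_def by (intro dfn)
  have mm: "x \<epsilon> m i \<longleftrightarrow> (\<exists>k. (k = i \<or> k \<epsilon> i) \<and> (x = app f k \<or> x \<epsilon> app f k))" for x i
    unfolding m_def mem_Un' mem_im[OF d1] mem_succ[of _ i] by (auto simp: mem_succ)
  define U where "U i = un (m i) (Un' (im I (m i)))" for i
  have dU: "df1 U" unfolding df1_def U_def by (intro dfn df1_app[OF dm] df1_app[OF I(1)])
  define h where "h i = least (\<lambda>x. x \<epsilon> \<mu> \<and> \<not> x \<epsilon> U i)" for i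
  have dh: "df1 h" unfolding df1_def h_def by (intro dfn df1_app[OF dU])
  have h: "h i \<epsilon> \<mu> \<and> \<not> h i \<epsilon> U i" if i: "i \<epsilon> \<kappa>" for i
  proof -
    have fk: "app f k \<epsilon> \<mu>" if "k = i \<or> k \<epsilon> i" for k using that f(1) i k_trans[OF i] by blast
    have of: "ordinal (app f k)" if "k = i \<or> k \<epsilon> i" for k using ordinal_mem[OF muD(2) fk[OF that]] .
    obtain x where x: "x \<epsilon> \<mu>" "\<And>k. k \<epsilon> succ i \<Longrightarrow> app f k \<epsilon> x"
      using cofinality_bounded[OF cf muD(2) emp_inf[OF mu] k_succ[OF i] lep_refl df1_app_const[of f]] fk
      unfolding mem_succ by blast
    have ox: "ordinal x" using ordinal_mem[OF muD(2) x(1)] .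
    have om: "ordinal (m i)"
      unfolding m_def by (rule ordinal_Un') (use of ordinal_succ in \<open>auto simp: mem_im[OF d1] mem_succ\<close>)
    have "elts (m i) \<subseteq> elts x"
      using x(2) ordinal_trans[OF ox] unfolding subset_eq Ball_def mem_elts mm mem_succ by blast
    then have mi: "m i \<epsilon> \<mu>" using ordinal_subset[OF om ox] x(1) ordinal_trans[OF muD(2) x(1)] by blast
    \<comment> \<open>Adding \<kappa> yields an infinite bound \<theta> < \<mu> for the supports as
      well as for their number, so U i has size at most \<theta> and cannot cover \<mu>.\<close>
    have small: "small \<mu> (un (m i) \<kappa>)"
      using small_un[OF w mu] mi km lep_refl unfolding small_def by blast
    then obtain \<theta> where th: "\<theta> \<epsilon> \<mu>" "lep (un (m i) \<kappa>) \<theta>" unfolding small_def by blast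
    have ot: "ordinal \<theta>" using ordinal_mem[OF muD(2) th(1)] .
    have l: "lep (m i) \<theta>" "lep \<kappa> \<theta>"
      using lep_trans[OF lep_subset th(2), of "m i"] lep_trans[OF lep_subset th(2), of \<kappa>] by (auto simp: mem_un)
    have it: "infinite (elts \<theta>)" using lep_finite[OF l(2)] kD(3) by blast
    have "lep (I \<alpha>) \<theta>" if "\<alpha> \<epsilon> m i" for \<alpha>
      using lep_trans[OF I(2) l(2)] ordinal_trans[OF muD(2) mi that] by blast
    then have "lep (U i) \<theta>" unfolding U_def
      using lep_un[OF w ot it l(1) lep_Union[OF w ot it l(1) I(1)]] by blast
    then have "\<not> (\<forall>x. x \<epsilon> \<mu> \<longrightarrow> x \<epsilon> U i)"
      using cardinal_not_lep[OF muD(1) th(1)] lep_trans lep_subset by blast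
    then show ?thesis unfolding h_def
      using least_ordinal(2)[of _ "\<lambda>x. x \<epsilon> \<mu> \<and> \<not> x \<epsilon> U i"] ordinal_mem[OF muD(2)] by blast
  qed
  show thesis
  proof (rule that[OF dh], unfold avoids_def, intro allI impI)
    fix x assume x: "x \<epsilon> \<mu>"
    obtain i where i: "i \<epsilon> \<kappa>" "x = app f i \<or> x \<epsilon> app f i" using f(2)[OF x] by blast
    have "h \<beta> \<epsilon> \<mu> \<and> \<not> h \<beta> \<epsilon> x \<and> \<not> h \<beta> \<epsilon> I x" if b: "\<beta> \<epsilon> \<kappa>" "\<not> \<beta> \<epsilon> i" for \<beta>
    proof -
      have "i = \<beta> \<or> i \<epsilon> \<beta>" using ordinal_linear[of i \<beta>] ordinal_mem[OF kD(2)] i(1) b by blast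
      then have xm: "x \<epsilon> m \<beta>" "\<And>y. y \<epsilon> x \<Longrightarrow> y \<epsilon> m \<beta>"
        using i(2) ordinal_trans[OF ordinal_mem[OF muD(2) f(1)[OF i(1)]]] unfolding mm by blast+
      then show ?thesis using h[OF b(1)] unfolding U_def mem_un mem_Un' mem_im[OF I(1)] by blast
    qed
    then show "\<exists>i. i \<epsilon> \<kappa> \<and> (\<forall>\<beta>. \<beta> \<epsilon> \<kappa> \<longrightarrow> \<not> \<beta> \<epsilon> i \<longrightarrow> h \<beta> \<epsilon> \<mu> \<and> \<not> h \<beta> \<epsilon> x \<and> \<not> h \<beta> \<epsilon> I x)"
      using i(1) by blast
  qed
qed

theorem RList:
  assumes cb: "W.complete_bipartite X Fe (j \<mu>)" shows "W.RList X Fe (j \<kappa>)"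
  unfolding W.RList_def
proof (intro allI impI, elim conjE)
  fix L assume L: "W.fun_on L X" "\<forall>v S. W.maps L v S \<longrightarrow> W.elts S \<subseteq> W.elts (j \<kappa>) \<and> W.equinumerous S (j \<kappa>)"
  obtain A B gA gB where gA: "W.bijection gA A (j \<mu>)" and gB: "W.bijection gB B (j \<mu>)"
    and AB: "\<And>x. \<not> (x \<epsilon>\<^sub>G A \<and> x \<epsilon>\<^sub>G B)" and X: "\<And>x. x \<epsilon>\<^sub>G X \<longleftrightarrow> x \<epsilon>\<^sub>G A \<or> x \<epsilon>\<^sub>G B"
    and Fe: "\<And>e. e \<epsilon>\<^sub>G Fe \<longleftrightarrow> (\<exists>a b. a \<epsilon>\<^sub>G A \<and> b \<epsilon>\<^sub>G B \<and> W.elts e = {a, b})"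
    by (rule complete_bipartite'E[OF cb]) (rule that)
  note a = bijection'D[OF gA] and b = bijection'D[OF gB]
  define R where "R g \<alpha> \<beta> \<longleftrightarrow> (\<exists>v S. W.maps g v (j \<alpha>) \<and> W.maps L v S \<and> j \<beta> \<epsilon>\<^sub>G S)" for g \<alpha> \<beta>
  have fR: "fcb (\<lambda>e. R g (e 0) (e 1))" for g unfolding R_def by (intro fc dfn)
  have unb: "\<exists>\<beta>. \<beta> \<epsilon> \<kappa> \<and> \<not> \<beta> \<epsilon> i \<and> R g \<alpha> \<beta>"
    if g: "W.bijection g C (j \<mu>)" "\<And>v. v \<epsilon>\<^sub>G C \<Longrightarrow> v \<epsilon>\<^sub>G X" "\<alpha> \<epsilon> \<mu>" "i \<epsilon> \<kappa>" for g C \<alpha> i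
  proof -
    obtain v where v: "v \<epsilon>\<^sub>G C" "W.maps g v (j \<alpha>)" using bijection'D(3)[OF g(1)] g(3) j_mem by blast
    obtain S where S: "W.maps L v S" using L(1) g(2)[OF v(1)] unfolding W.fun_on_def Ball_def Wmem by blast
    have "\<exists>\<beta>. \<beta> \<epsilon> \<kappa> \<and> \<not> \<beta> \<epsilon> i \<and> j \<beta> \<epsilon>\<^sub>G S"
      using unbounded_section[of S, OF _ _ g(4)] L(2) S unfolding subset_eq Ball_def Wmem by blast
    then show ?thesis unfolding R_def using v S by blast
  qed
  have unbA: "\<exists>\<beta>. \<beta> \<epsilon> \<kappa> \<and> \<not> \<beta> \<epsilon> i \<and> R gA \<alpha> \<beta>" if "\<alpha> \<epsilon> \<mu>" "i \<epsilon> \<kappa>" for \<alpha> i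
    using unb[OF gA _ that] X by blast
  have unbB: "\<exists>\<beta>. \<beta> \<epsilon> \<kappa> \<and> \<not> \<beta> \<epsilon> i \<and> R gB \<alpha> \<beta>" if "\<alpha> \<epsilon> \<mu>" "i \<epsilon> \<kappa>" for \<alpha> i
    using unb[OF gB _ that] X by blast
  obtain IA where IA: "df1 IA" "\<And>\<alpha>. \<alpha> \<epsilon> \<mu> \<Longrightarrow> lep (IA \<alpha>) \<kappa>"
    "\<And>h \<epsilon>' \<alpha>. df1 h \<Longrightarrow> avoids h IA \<Longrightarrow>
      \<alpha> \<epsilon> \<mu> \<Longrightarrow> \<epsilon>' = emp \<or> \<epsilon>' = one \<Longrightarrow> \<exists>\<beta> q. \<beta> \<epsilon> \<kappa> \<and> R gA \<alpha> \<beta> \<and> q \<in> G \<and> pr (h \<beta>) \<epsilon>' \<epsilon> q"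
    by (rule dense_split[OF fR unbA]) (assumption | rule that)+
  obtain IB where IB: "df1 IB" "\<And>\<alpha>. \<alpha> \<epsilon> \<mu> \<Longrightarrow> lep (IB \<alpha>) \<kappa>"
    "\<And>h \<epsilon>' \<alpha>. df1 h \<Longrightarrow> avoids h IB \<Longrightarrow>
      \<alpha> \<epsilon> \<mu> \<Longrightarrow> \<epsilon>' = emp \<or> \<epsilon>' = one \<Longrightarrow> \<exists>\<beta> q. \<beta> \<epsilon> \<kappa> \<and> R gB \<alpha> \<beta> \<and> q \<in> G \<and> pr (h \<beta>) \<epsilon>' \<epsilon> q"
    by (rule dense_split[OF fR unbB]) (assumption | rule that)+
  \<comment> \<open>A colour shared by the two sides is refuted by a single value G(h \<beta>), so
    both sides need the same h, which has to avoid the supports of both.\<close>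
  have "df1 (\<lambda>\<alpha>. un (IA \<alpha>) (IB \<alpha>))" unfolding df1_def by (intro dfn df1_app[OF IA(1)] df1_app[OF IB(1)])
  moreover have "lep (un (IA \<alpha>) (IB \<alpha>)) \<kappa>" if "\<alpha> \<epsilon> \<mu>" for \<alpha>
    using lep_un[OF w kD(2,3) IA(2) IB(2)] that by blast
  ultimately obtain h where h: "df1 h" "avoids h (\<lambda>\<alpha>. un (IA \<alpha>) (IB \<alpha>))"
    by (rule avoiding_function) (assumption | rule that)+
  have h2: "avoids h IA" "avoids h IB" using h(2) unfolding avoids_def mem_un by blast+
  have hA: "\<exists>\<beta> q. \<beta> \<epsilon> \<kappa> \<and> R gA \<alpha> \<beta> \<and> q \<in> G \<and> pr (h \<beta>) emp \<epsilon> q" if "\<alpha> \<epsilon> \<mu>" for \<alpha>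
    by (rule IA(3)[OF h(1) h2(1) that]) simp
  have hB: "\<exists>\<beta> q. \<beta> \<epsilon> \<kappa> \<and> R gB \<alpha> \<beta> \<and> q \<in> G \<and> pr (h \<beta>) one \<epsilon> q" if "\<alpha> \<epsilon> \<mu>" for \<alpha>
    by (rule IB(3)[OF h(1) h2(2) that]) simp
  define body where "body x \<beta> \<longleftrightarrow> \<beta> \<epsilon> \<kappa> \<and> (\<exists>S. W.maps L x S \<and> j \<beta> \<epsilon>\<^sub>G S) \<and>
    (x \<epsilon>\<^sub>G A \<and> (\<exists>q. q \<in> G \<and> pr (h \<beta>) emp \<epsilon> q) \<or> x \<epsilon>\<^sub>G B \<and> (\<exists>q. q \<in> G \<and> pr (h \<beta>) one \<epsilon> q))" for x \<beta>
  \<comment> \<open>Taking the least admissible colour makes the colouring single-valued and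
    definable over (V, G).\<close>
  define sel where "sel x \<beta> \<longleftrightarrow> body x \<beta> \<and> (\<forall>\<beta>'. \<beta>' \<epsilon> \<beta> \<longrightarrow> \<not> body x \<beta>')" for x \<beta>
  have fsel: "fcb (\<lambda>e. sel (V (e 0)) (e 1))" unfolding sel_def body_def by (intro fc dfn df1_app[OF h(1)])
  have exb: "\<exists>\<beta>. body x \<beta>" if x: "x \<epsilon>\<^sub>G X" for x
  proof -
    consider "x \<epsilon>\<^sub>G A" | "x \<epsilon>\<^sub>G B" using x X by blast
    then show ?thesis
    proof cases
      case 1
      obtain \<alpha> where al: "\<alpha> \<epsilon> \<mu>" "W.maps gA x (j \<alpha>)" using a(2)[OF 1] unfolding mem_j by blast
      obtain \<beta> q where "\<beta> \<epsilon> \<kappa>" "R gA \<alpha> \<beta>" "q \<in> G" "pr (h \<beta>) emp \<epsilon> q" using hA[OF al(1)] by blast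
      then show ?thesis unfolding body_def R_def using 1 a(5)[OF al(2)] by blast
    next
      case 2
      obtain \<alpha> where al: "\<alpha> \<epsilon> \<mu>" "W.maps gB x (j \<alpha>)" using b(2)[OF 2] unfolding mem_j by blast
      obtain \<beta> q where "\<beta> \<epsilon> \<kappa>" "R gB \<alpha> \<beta>" "q \<in> G" "pr (h \<beta>) one \<epsilon> q" using hB[OF al(1)] by blast
      then show ?thesis unfolding body_def R_def using 2 b(5)[OF al(2)] by blast
    qed
  qed
  have exs: "\<exists>\<beta>. \<beta> \<epsilon> \<kappa> \<and> sel x \<beta>" if x: "x \<epsilon>\<^sub>G X" for x
  proof -
    obtain \<beta> where "body x \<beta>" "\<forall>z. z \<epsilon> \<beta> \<longrightarrow> \<not> body x z" using exb[OF x] wf_min[of "body x"] by blast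
    then show ?thesis unfolding sel_def using body_def by blast
  qed
  have un: "\<beta> = \<beta>'" if "sel x \<beta>" "sel x \<beta>'" "\<beta> \<epsilon> \<kappa>" "\<beta>' \<epsilon> \<kappa>" for x \<beta> \<beta>'
    using that ordinal_linear ordinal_mem[OF kD(2)] unfolding sel_def by blast
  obtain c where c: "W.fun_on c X" "\<And>x y. W.maps c x y \<longleftrightarrow> x \<epsilon>\<^sub>G X \<and> (\<exists>N. N \<epsilon> \<kappa> \<and> sel x N \<and> y = V (chk N))"
  proof (rule make_fun[OF chk(1) fsel exs])
    show "V (chk N) = V (chk N')" if "x \<epsilon>\<^sub>G X" "N \<epsilon> \<kappa>" "N' \<epsilon> \<kappa>" "sel x N" "sel x N'" for x N N'
      using un that by blast
  qed (assumption, rule that)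
  have cb: "\<exists>\<beta>. body x \<beta> \<and> y = j \<beta>" if "W.maps c x y" for x y
    using that unfolding c(2) sel_def j_def by blast
  have ne: False if u: "u \<epsilon>\<^sub>G A" "W.maps c u x" and v: "v \<epsilon>\<^sub>G B" "W.maps c v x" for u v x
  proof -
    obtain \<beta> where be: "body u \<beta>" "x = j \<beta>" using cb[OF u(2)] by blast
    have bv: "body v \<beta>" using cb[OF v(2)] be(2) by auto
    obtain q where q: "q \<in> G" "pr (h \<beta>) emp \<epsilon> q" using be(1) u(1) AB unfolding body_def by blast
    obtain q' where q': "q' \<in> G" "pr (h \<beta>) one \<epsilon> q'" using bv v(1) AB unfolding body_def by blast
    obtain r where r: "r \<in> G" "le r q" "le r q'" using G_common[OF q(1) q'(1)] by blast
    \<comment> \<open>A common extension in G would take both values at the point h \<beta>.\<close>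
    have "emp = one" using P_fun[OF G_P[OF r(1)]] r(2,3) q(2) q'(2) unfolding le_def by blast
    then show False using one_ne by blast
  qed
  have "W.good X Fe c" unfolding W.good_def
  proof (intro conjI allI impI c(1), elim conjE)
    fix e v u x y assume e: "e \<epsilon>\<^sub>G Fe" "W.elts e = {v, u}" and m: "W.maps c v x" "W.maps c u y"
    obtain s t where st: "s \<epsilon>\<^sub>G A" "t \<epsilon>\<^sub>G B" "W.elts e = {s, t}" using e(1) unfolding Fe by blast
    then have "s = v \<and> t = u \<or> s = u \<and> t = v" using e(2) doubleton_eq_iff[of v u s t] by auto
    then show "x \<noteq> y" using ne[OF st(1) _ st(2)] m by blast
  qed
  moreover have "x \<epsilon>\<^sub>G S" if "W.maps L v S" "W.maps c v x" for v S x
    using cb[OF that(2)] that(1) maps'_unique[OF L(1)] unfolding body_def by blast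
  ultimately show "W.colourable_from X Fe L" unfolding W.colourable_from_def by blast
qed

text \<open>The graph of V with parts \<mu> \<times> {0} and \<mu> \<times> {1} remains complete
  bipartite in V[G]. Its existence keeps the statement about all copies from being vacuous.\<close>

lemma complete_bipartite_ex: "\<exists>X Fe. W.complete_bipartite X Fe (j \<mu>)"
proof -
  define C where "C i = prod' \<mu> (sing i)" for i
  have mC: "x \<epsilon> C i \<longleftrightarrow> (\<exists>\<beta>. \<beta> \<epsilon> \<mu> \<and> x = pr \<beta> i)" for x i
    unfolding C_def mem_prod' mem_sing by blast
  have eq: "W.equinumerous (j (C i)) (j \<mu>)" for i
  proof -
    define R where "R x \<beta> \<longleftrightarrow> x = j (pr \<beta> i)" for x \<beta>
    have "fcb (\<lambda>e. R (V (e 0)) (e 1))" unfolding R_def by (intro fc dfn)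
    moreover have "\<exists>\<beta>. \<beta> \<epsilon> \<mu> \<and> R x \<beta>" if "x \<epsilon>\<^sub>G j (C i)" for x
      using that unfolding R_def mem_j mC by blast
    moreover have "V (chk N) = V (chk N')" if "R x N" "R x N'" for x N N'
      using that unfolding R_def by (metis j_inject pr_inject)
    ultimately obtain f where f: "W.fun_on f (j (C i))"
      "\<And>x y. W.maps f x y \<longleftrightarrow> x \<epsilon>\<^sub>G j (C i) \<and> (\<exists>N. N \<epsilon> \<mu> \<and> R x N \<and> y = V (chk N))"
      by (rule make_fun[OF chk(1), of R "j (C i)" \<mu>]) (assumption+, rule that)
    have m: "W.maps f x y \<longleftrightarrow> (\<exists>\<beta>. \<beta> \<epsilon> \<mu> \<and> x = j (pr \<beta> i) \<and> y = j \<beta>)" for x y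
      unfolding f(2) R_def j_def[symmetric] by (auto simp: mC)
    have "W.bijection f (j (C i)) (j \<mu>)"
      unfolding W.bijection_def W.fun_into_def m using f(1) by (auto simp: mem_j Wmem)
    then show ?thesis unfolding W.equinumerous_def by blast
  qed
  define Fe where "Fe = Un' (im (\<lambda>a. im (\<lambda>b. up a b) (C one)) (C emp))"
  have d: "df1 (\<lambda>b. up a b)" "df1 (\<lambda>a. im (\<lambda>b. up a b) (C one))" for a unfolding df1_def by (intro dfn)+
  have mF: "e \<epsilon> Fe \<longleftrightarrow> (\<exists>a b. a \<epsilon> C emp \<and> b \<epsilon> C one \<and> e = up a b)" for e
    unfolding Fe_def mem_Un' mem_im[OF d(2)] using mem_im[OF d(1)] by metis
  have ju: "W.elts (j (up a b)) = {j a, j b}" for a b by (auto simp: W.elts_def mem_j mem_up)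
  have "W.complete_bipartite (j (un (C emp) (C one))) (j Fe) (j \<mu>)"
    unfolding W.complete_bipartite_def
  proof (intro exI conjI allI)
    show "W.elts (j (C emp)) \<inter> W.elts (j (C one)) = {}" using one_ne by (auto simp: W.elts_def mem_j mC)
    show "W.elts (j (un (C emp) (C one))) = W.elts (j (C emp)) \<union> W.elts (j (C one))"
      by (auto simp: W.elts_def mem_j mem_un)
    fix e show "e \<epsilon>\<^sub>G j Fe \<longleftrightarrow> (\<exists>a\<in>W.elts (j (C emp)). \<exists>b\<in>W.elts (j (C one)). W.elts e = {a, b})"
    proof
      assume "e \<epsilon>\<^sub>G j Fe"
      then obtain a b where "a \<epsilon> C emp" "b \<epsilon> C one" "e = j (up a b)" unfolding mem_j mF by blast
      then show "\<exists>a\<in>W.elts (j (C emp)). \<exists>b\<in>W.elts (j (C one)). W.elts e = {a, b}"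
        unfolding Bex_def Wmem mem_j using ju by blast
    next
      assume "\<exists>a\<in>W.elts (j (C emp)). \<exists>b\<in>W.elts (j (C one)). W.elts e = {a, b}"
      then obtain a b where ab: "a \<epsilon> C emp" "b \<epsilon> C one" "W.elts e = {j a, j b}"
        unfolding Bex_def Wmem mem_j by blast
      have "e = j (up a b)" using ab(3) ju[of a b] ext' unfolding W.extensional_def by metis
      then show "e \<epsilon>\<^sub>G j Fe" unfolding mem_j mF using ab by blast
    qed
  qed (rule eq)+
  then show ?thesis by blast
qed

end

theorem theorem3p1:
  fixes E :: "'v \<Rightarrow> 'v \<Rightarrow> bool"
    and E' :: "'w \<Rightarrow> 'w \<Rightarrow> bool"
    and kappa lambda mu P :: 'v
    and G :: "'v set"
  assumes "wfp E" and "set_struct.ZFC E" and "set_struct.GCH E"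
    and "set_struct.regular E kappa" and "set_struct.regular E lambda" and "E kappa lambda"
    and "set_struct.singular E mu" and "E lambda mu" and "set_struct.cofinality E mu kappa"
    and "set_struct.is_Fn E P kappa mu"
    and "set_struct.generic E P (set_struct.reverse_inclusion E) G"
    and "generic_extension E P G E'"
  shows "(\<exists>X F. set_struct.complete_bipartite E' X F (ground_inclusion E E' mu)) \<and>
    (\<forall>X F. set_struct.complete_bipartite E' X F (ground_inclusion E E' mu) \<longrightarrow>
       set_struct.RList E' X F (ground_inclusion E E' kappa) \<and>
       \<not> set_struct.SList E' X F (ground_inclusion E E' lambda))"
proof -
  interpret M: zfc_model E by unfold_locales (fact assms)+
  have mu: "M.infinite_cardinal mu" using assms(7) unfolding M.singular_def by blast
  have la: "M.infinite_cardinal lambda" "M.cofinality lambda lambda" using assms(5) unfolding M.regular_def by auto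
  obtain w where w: "M.is_omega w" using mu unfolding M.infinite_cardinal_def by blast
  have km: "E kappa mu" using M.ordinal_trans[OF M.infinite_cardinalD(2)[OF mu] assms(8,6)] .
  interpret N: fn_poset E w kappa mu P by unfold_locales (fact assms w mu km)+
  obtain val where val: "set_struct.extensional E'"
    "\<forall>t. M.name P t \<longrightarrow> set_struct.elts E' (val t) = {val s | s p z. E z t \<and> M.is_opair z s p \<and> p \<in> G}"
    "\<forall>x. \<exists>t. M.name P t \<and> x = val t"
    using assms(12) unfolding generic_extension_def by blast
  interpret F: fn_forcing E E' w kappa mu P G val
    by unfold_locales (use assms(11) N.emp_P val in blast)+
  show ?thesis unfolding F.ground_inclusion
    using F.complete_bipartite_ex F.RList F.not_SList[OF la assms(6,8)] by blast
qed

end
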